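(* Let $(X,\rho,\mu)$ be a space of homogeneous type (with the standing assumptions listed in the context), $q\in(1,\infty)$, and $\gamma\in[0,1)$. Assume that $\omega\in A^+_q(\gamma)$. Then there exist two positive constants $\kappa$ and $C$ such that, for any parabolic cylinder $R$, $$\left(⨍_{R^-}\omega^{\kappa+1}\right)^{\frac1{\kappa+1}}\le C\,⨍_{R^+}\omega$$ and $$\left[⨍_{R^+}\omega^{(1-q')(\kappa+1)}\right]^{\frac1{\kappa+1}}\le C\,⨍_{R^-}\omega^{1-q'} .$$
   Context: Setting. $(X,\rho)$ is a quasi-metric space: $\rho:X\times X\to[0,\infty)$, $\rho(x,y)=0$ iff $x=y$, $\rho(x,y)=\rho(y,x)$, and $\rho(x,y)\le K_0[\rho(x,z)+\rho(z,y)]$ for all $x,y,z\in X$, with a constant $K_0\in[1,\infty)$. Balls are $B(x,r)=\{y\in X:\rho(x,y)<r\}$. $\mu$ is a nonnegative measure on a $\sigma$-algebra containing the balls which is doubling: $\mu(B(x,2r))\le C_\mu\mu(B(x,r))$ for all $x\in X$, $r\in(0,\infty)$; then $(X,\rho,\mu)$ is called a space of homogeneous type. Standing assumptions: (a) for each $x$ the balls $\{B(x,r)\}_{r>0}$ form a basis of open neighborhoods of $x$; (b) $\mu$ is Borel regular (open sets are measurable and every $A\subset X$ lies in a Borel set $E$ with $\mu(A)=\mu(E)$); (c) $0<\mu(B(x,r))<\infty$ for all balls; (d) $\operatorname{diam}(X)=\infty$ and $\mu(\{x\})=0$ for all $x$; (e) monotone geodesic property: there is a constant $\widetilde K>0$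 such that for all $s\in(0,\infty)$ and $x,y\in X$ with $\rho(x,y)\ge s$ there are $m\in\mathbb N$ and points $x_0=x,x_1,\dots,x_m=y$ with $\rho(x_i,x_{i+1})\le\widetilde K s$ and $\rho(x_{i+1},x_m)\le\rho(x_i,x_m)-s$ for $i=0,\dots,m-1$. Fix $p\in(1,\infty)$. $X\times\mathbb R$ carries the quasi-metric $d((x,t),(y,s))=\max\{\rho(x,y),|t-s|^{1/p}\}$ and the product measure $\lambda=\mu\times m$, $m$ being Lebesgue measure on $\mathbb R$; the same basic assumptions (a)-(d) are made for $(X\times\mathbb R,d,\lambda)$. All integrals are with respect to $\lambda$, and $⨍_E f:=\frac1{\lambda(E)}\int_E f$ denotes the average. Parabolic cylinders. For $x\in X$, $t\in\mathbb R$, $l\in(0,\infty)$, $\gamma\in[0,1)$ put $R=R(x,t,l)=B(x,l)\times(t-l^p,t+l^p)$, $R^-(\gamma)=B(x,l)\times(t-l^p,t-\gamma l^p)$, $R^+(\gamma)=B(x,l)\times(t+\gamma l^p,t+l^p)$; $R^-=R^-(0)$, $R^+=R^+(0)$. Weights. A weight is a real-valued, $\lambda$-almost everywhere positive, locally integrable function on $X\times\mathbb R$ (integrable on some cylinder $R(x,t,r)$ around each point). For $q\in(1,\infty)$, with $1/q+1/q'=1$, and $\gamma\in[0,1)$, a weight $\omega$ belongs to $A^+_q(\gamma)$ if $\sup_{R}\left[⨍_{R^-(\gamma)}\omega\right]\left[⨍_{R^+(\gamma)}\omega^{1-q'}\right]^{q-1}<\infty$, the supremum being over all parabolic cylinders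 $R(x,t,l)$. *)

theory Defs
  imports "HOL-Analysis.Analysis"
begin

definition qball :: "('a \<Rightarrow> 'a \<Rightarrow> real) \<Rightarrow> 'a \<Rightarrow> real \<Rightarrow> 'a set" where
  "qball \<rho> x r = {y. \<rho> x y < r}"

locale quasi_metric =
  fixes \<rho> :: "'a \<Rightarrow> 'a \<Rightarrow> real"
  assumes nonneg: "\<rho> x y \<ge> 0"
    and zero_iff: "\<rho> x y = 0 \<longleftrightarrow> x = y"
    and symmetric: "\<rho> x y = \<rho> y x"
    and quasi_triangle: "\<exists>K0\<ge>1. \<forall>x y z. \<rho> x y \<le> K0 * (\<rho> x z + \<rho> z y)"

text \<open>The space \<open>X\<close> is the whole type. The \<open>\<sigma>\<close>-algebra of \<open>M\<close> need not be
  complete, nor is it required to be the Borel one.\<close>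

locale homogeneous_type = quasi_metric \<rho>
  for \<rho> :: "'a \<Rightarrow> 'a \<Rightarrow> real" +
  fixes M :: "'a measure"
  assumes space_UNIV: "space M = UNIV"
    and qball_sets: "qball \<rho> x r \<in> sets M"
    and doubling: "\<exists>C::real. \<forall>x. \<forall>r>0.
          emeasure M (qball \<rho> x (2 * r)) \<le> ennreal C * emeasure M (qball \<rho> x r)"

definition quasi_topology :: "('a \<Rightarrow> 'a \<Rightarrow> real) \<Rightarrow> 'a topology" where
  "quasi_topology \<rho> = topology (\<lambda>U. \<forall>x\<in>U. \<exists>r>0. qball \<rho> x r \<subseteq> U)"

lemma openin_quasi_topology:
  "openin (quasi_topology \<rho>) U \<longleftrightarrow> (\<forall>x\<in>U. \<exists>r>0. qball \<rho> x r \<subseteq> U)"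
proof -
  have "istopology (\<lambda>U. \<forall>x\<in>U. \<exists>r>0. qball \<rho> x r \<subseteq> U)"
    unfolding istopology_def
  proof (intro conjI allI impI ballI)
    fix S T x
    assume "\<forall>x\<in>S. \<exists>r>0. qball \<rho> x r \<subseteq> S" "\<forall>x\<in>T. \<exists>r>0. qball \<rho> x r \<subseteq> T" "x \<in> S \<inter> T"
    then obtain r s where "r > 0" "s > 0" "qball \<rho> x r \<subseteq> S" "qball \<rho> x s \<subseteq> T"
      by blast
    then show "\<exists>r>0. qball \<rho> x r \<subseteq> S \<inter> T"
      by (intro exI[of _ "min r s"]) (auto simp: qball_def)
  next
    fix \<K> x
    assume "\<forall>K\<in>\<K>. \<forall>x\<in>K. \<exists>r>0. qball \<rho> x r \<subseteq> K" "x \<in> \<Union>\<K>"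
    then show "\<exists>r>0. qball \<rho> x r \<subseteq> \<Union>\<K>"
      by (meson Union_iff Union_upper order_trans)
  qed
  then show ?thesis
    by (simp add: quasi_topology_def)
qed

text \<open>By definition of \<open>quasi_topology\<close>, every open set containing \<open>x\<close> contains a ball
  centred at \<open>x\<close>, so the balls at \<open>x\<close> form a basis of open neighbourhoods of \<open>x\<close> as soon
  as they are open. The measure of an arbitrary set in the Borel regularity condition is
  its outer measure.\<close>

locale basic_assumptions =
  fixes \<rho> :: "'a \<Rightarrow> 'a \<Rightarrow> real" and M :: "'a measure"
  assumes open_qball: "r > 0 \<Longrightarrow> openin (quasi_topology \<rho>) (qball \<rho> x r)"
    and open_sets: "openin (quasi_topology \<rho>) U \<Longrightarrow> U \<in> sets M"
    and borel_regular: "\<exists>E \<in> sigma_sets UNIV {U. openin (quasi_topology \<rho>) U}.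
          A \<subseteq> E \<and> outer_measure_of M A = emeasure M E"
    and qball_pos: "r > 0 \<Longrightarrow> 0 < emeasure M (qball \<rho> x r)"
    and qball_finite: "r > 0 \<Longrightarrow> emeasure M (qball \<rho> x r) < \<infinity>"
    and diam_infinite: "(SUP x. SUP y. ereal (\<rho> x y)) = \<infinity>"
    and point_null: "emeasure M {x} = 0"

definition monotone_geodesic :: "('a \<Rightarrow> 'a \<Rightarrow> real) \<Rightarrow> bool" where
  "monotone_geodesic \<rho> \<longleftrightarrow> (\<exists>K>0. \<forall>s>0. \<forall>x y. \<rho> x y \<ge> s \<longrightarrow>
     (\<exists>(m::nat) z. z 0 = x \<and> z m = y \<and>
        (\<forall>i<m. \<rho> (z i) (z (Suc i)) \<le> K * s \<and>
                \<rho> (z (Suc i)) (z m) \<le> \<rho> (z i) (z m) - s)))"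

definition parabolic_dist ::
    "('a \<Rightarrow> 'a \<Rightarrow> real) \<Rightarrow> real \<Rightarrow> 'a \<times> real \<Rightarrow> 'a \<times> real \<Rightarrow> real" where
  "parabolic_dist \<rho> p z w = max (\<rho> (fst z) (fst w)) (\<bar>snd z - snd w\<bar> powr (1 / p))"

text \<open>The product of \<open>M\<close> with one-dimensional Lebesgue measure. It is completed so that all
  functions measurable in the sense of Lebesgue (rather than only those measurable for the
  product \<open>\<sigma>\<close>-algebra) are covered; the integrals and null sets are not affected.\<close>

definition parabolic_measure :: "'a measure \<Rightarrow> ('a \<times> real) measure" where
  "parabolic_measure M = completion (M \<Otimes>\<^sub>M lborel)"

definition cyl :: "('a \<Rightarrow> 'a \<Rightarrow> real) \<Rightarrow> real \<Rightarrow> 'a \<Rightarrow> real \<Rightarrow> real \<Rightarrow> ('a \<times> real) set" where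
  "cyl \<rho> p x t l = qball \<rho> x l \<times> {t - l powr p <..< t + l powr p}"

definition cyl_lower ::
    "('a \<Rightarrow> 'a \<Rightarrow> real) \<Rightarrow> real \<Rightarrow> real \<Rightarrow> 'a \<Rightarrow> real \<Rightarrow> real \<Rightarrow> ('a \<times> real) set" where
  "cyl_lower \<rho> p \<gamma> x t l = qball \<rho> x l \<times> {t - l powr p <..< t - \<gamma> * l powr p}"

definition cyl_upper ::
    "('a \<Rightarrow> 'a \<Rightarrow> real) \<Rightarrow> real \<Rightarrow> real \<Rightarrow> 'a \<Rightarrow> real \<Rightarrow> real \<Rightarrow> ('a \<times> real) set" where
  "cyl_upper \<rho> p \<gamma> x t l = qball \<rho> x l \<times> {t + \<gamma> * l powr p <..< t + l powr p}"

text \<open>Averages and their powers are taken in the extended nonnegative reals, so a divergent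
  integral counts as \<open>\<infinity>\<close>. They are only applied to functions that are nonnegative almost
  everywhere, for which the truncation performed by \<open>ennreal\<close> is immaterial.\<close>

definition average :: "'b measure \<Rightarrow> 'b set \<Rightarrow> ('b \<Rightarrow> real) \<Rightarrow> ennreal" where
  "average N E f = (\<integral>\<^sup>+z\<in>E. ennreal (f z) \<partial>N) / emeasure N E"

text \<open>Powers with a positive exponent.\<close>

definition ennreal_powr :: "ennreal \<Rightarrow> real \<Rightarrow> ennreal" where
  "ennreal_powr a r = (if a = \<infinity> then \<infinity> else ennreal (enn2real a powr r))"

definition conj_exp :: "real \<Rightarrow> real" where
  "conj_exp q = q / (q - 1)"

lemma conj_exp: "q > 1 \<Longrightarrow> 1 / q + 1 / conj_exp q = 1"
  by (simp add: conj_exp_def field_simps)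

definition weight ::
    "('a \<Rightarrow> 'a \<Rightarrow> real) \<Rightarrow> 'a measure \<Rightarrow> real \<Rightarrow> ('a \<times> real \<Rightarrow> real) \<Rightarrow> bool" where
  "weight \<rho> M p \<omega> \<longleftrightarrow>
     \<omega> \<in> borel_measurable (parabolic_measure M) \<and>
     (AE z in parabolic_measure M. \<omega> z > 0) \<and>
     (\<forall>x t. \<exists>r>0. set_integrable (parabolic_measure M) (cyl \<rho> p x t r) \<omega>)"

definition A_plus ::
    "('a \<Rightarrow> 'a \<Rightarrow> real) \<Rightarrow> 'a measure \<Rightarrow> real \<Rightarrow> real \<Rightarrow> real \<Rightarrow> ('a \<times> real \<Rightarrow> real) set" where
  "A_plus \<rho> M p q \<gamma> = {\<omega>. weight \<rho> M p \<omega> \<and>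
     (SUP x. SUP t. SUP l\<in>{0<..}.
        average (parabolic_measure M) (cyl_lower \<rho> p \<gamma> x t l) \<omega> *
        ennreal_powr (average (parabolic_measure M) (cyl_upper \<rho> p \<gamma> x t l)
                        (\<lambda>z. \<omega> z powr (1 - conj_exp q))) (q - 1)) < \<infinity>}"

end

(* Call v "weakly A_infinity" if on every ball B with average v_B > l the function v exceeds
   beta * l on a fixed proportion of a fixed dilate of B. The A_q^+ condition gives this property,
   without any time direction left in it, for v = omega (the proportion lies later in time) and
   for v = omega^(1-q') (the proportion lies earlier in time). In a doubling quasi-metric space it
   implies a reverse Hoelder inequality with an enlarged ball on the right: a stopping radius and
   the Vitali covering lemma bound the integral of v over {v > C l} by l times the measure of
   {v > beta l} in a slightly larger set; integrating against dl^kappa, the factor 2^kappa - 1 is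
   small enough to absorb the left-hand side along a sequence of neighbourhoods of geometrically
   shrinking width.
   To have no time lag and the same spatial ball on both sides, cover the one half of the cylinder
   by balls of radius k * l and compare each of them with the other half. The A_q^+ condition
   controls the v-mass of a ball by that of a ball shifted in time by O((k l)^p) and in space by
   O(k l); about 1/k such steps along a monotone geodesic take the time O(k^(p-1) l^p), which for
   small k is a small fraction of l^p because p > 1. *)

theory Submission
  imports Defs
begin

section \<open>Doubling quasi-metric spaces\<close>

text \<open>The good-lambda estimate controls a set \<open>S\<close> only by a neighbourhood of
  \<open>S\<close>, so nothing can be absorbed on one fixed set. Each enlargement uses a narrower
  neighbourhood; the admissible level then grows by a factor \<open>G\<close> that depends only on
  the doubling and quasi-triangle constants, and \<kappa> is so small that the absorption factor
  times \<open>G\<close> is at most 1/2. Truncating \<open>v\<close> keeps the remainder finite; it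
  disappears before the truncation is removed. The Muckenhoupt condition enters the argument through
  Chebyshev's inequality for \<open>v powr (- a)\<close>: a large average of \<open>v\<close> on one
  part of a cylinder makes \<open>v\<close> large on most of the other part. Exchanging the weight
  with its dual and reversing time preserves the condition, so one argument with a time direction
  \<open>e\<close> serves both inequalities. Mass can be moved only in the direction
  \<open>e\<close>, and the two halves of the final cylinder touch. What remains free is the step
  size: small balls need many steps in space but little time in total.\<close>

text \<open>Subadditivity for the sets \<open>Q g\<close> and additivity for the disjoint sets
  \<open>P g\<close>. This is how a bound for each ball of a Vitali family becomes a bound for the
  union of the dilated balls.\<close>

lemma emeasure_countable_cover_le:
  assumes "countable G" "sets W = sets N"
    and Q: "\<And>g. g \<in> G \<Longrightarrow> Q g \<in> sets N" and P: "\<And>g. g \<in> G \<Longrightarrow> P g \<in> sets N"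
    and disj: "disjoint_family_on P G"
    and le: "\<And>g. g \<in> G \<Longrightarrow> emeasure W (Q g) \<le> c * emeasure N (P g)"
  shows "emeasure W (\<Union>g\<in>G. Q g) \<le> c * emeasure N (\<Union>g\<in>G. P g)"
proof -
  \<comment> \<open>\<open>G\<close> may be finite, so its enumeration is padded with empty sets to
    obtain a sequence.\<close>
  define X where "X Y n = (if n \<in> to_nat_on G ` G then Y (from_nat_into G n) else {})"
    for Y :: "'a \<Rightarrow> 'b set" and n
  have dom: "from_nat_into G n \<in> G" if "n \<in> to_nat_on G ` G" for n
    using that assms(1) by auto
  have un: "(\<Union>n. X Y n) = (\<Union>g\<in>G. Y g)" for Y
  proof
    show "(\<Union>n. X Y n) \<subseteq> (\<Union>g\<in>G. Y g)"
      using dom by (auto simp: X_def split: if_splits)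
    show "(\<Union>g\<in>G. Y g) \<subseteq> (\<Union>n. X Y n)"
    proof
      fix y assume "y \<in> (\<Union>g\<in>G. Y g)"
      then obtain g where "g \<in> G" "y \<in> Y g" by auto
      then have "y \<in> X Y (to_nat_on G g)" using assms(1) by (auto simp: X_def)
      then show "y \<in> (\<Union>n. X Y n)" by auto
    qed
  qed
  have sQ: "range (X Q) \<subseteq> sets W" and sP: "range (X P) \<subseteq> sets N"
    using Q P dom assms(2) by (auto simp: X_def)
  have dX: "disjoint_family (X P)"
    unfolding disjoint_family_on_def
  proof (intro ballI impI)
    fix m n :: nat assume "m \<noteq> n"
    show "X P m \<inter> X P n = {}"
    proof (cases "m \<in> to_nat_on G ` G \<and> n \<in> to_nat_on G ` G")
      case True
      then have "from_nat_into G m \<noteq> from_nat_into G n"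
        using \<open>m \<noteq> n\<close> assms(1) by auto
      then show ?thesis using True disj dom[of m] dom[of n]
        by (auto simp: X_def disjoint_family_on_def)
    qed (auto simp: X_def)
  qed
  have leX: "emeasure W (X Q n) \<le> c * emeasure N (X P n)" for n
    using le dom by (auto simp: X_def)
  have "emeasure W (\<Union>g\<in>G. Q g) = emeasure W (\<Union>n. X Q n)" by (simp add: un)
  also have "\<dots> \<le> (\<Sum>n. emeasure W (X Q n))"
    by (rule emeasure_subadditive_countably[OF sQ])
  also have "\<dots> \<le> (\<Sum>n. c * emeasure N (X P n))"
    by (intro suminf_le leX) auto
  also have "\<dots> = c * (\<Sum>n. emeasure N (X P n))" by simp
  also have "\<dots> = c * emeasure N (\<Union>g\<in>G. P g)"
    using suminf_emeasure[OF sP dX] by (simp add: un)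
  finally show ?thesis .
qed

text \<open>To be interpreted with the parabolic quasi-metric on the product of the space with the
  time axis; no notion of time occurs here. \<open>K\<close> and \<open>D\<close> are parameters, so
  that constants built from them are uniform in all balls.\<close>

locale doubling_space =
  fixes d :: "'z \<Rightarrow> 'z \<Rightarrow> real" and N :: "'z measure" and K D :: real
  assumes d_nonneg: "0 \<le> d x y" and d_self: "d x x = 0" and d_sym: "d x y = d y x"
    and d_tri: "d x y \<le> K * (d x z + d z y)" and K1: "1 \<le> K"
    and basic: "basic_assumptions d N"
    and D1: "1 \<le> D"
    and doubl: "0 < r \<Longrightarrow> emeasure N (qball d x (2 * r)) \<le> ennreal D * emeasure N (qball d x r)"
begin

abbreviation "B \<equiv> qball d"
abbreviation "opn \<equiv> openin (quasi_topology d)"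

lemma opn_iff: "opn U \<longleftrightarrow> (\<forall>x\<in>U. \<exists>r>0. B x r \<subseteq> U)"
  by (rule openin_quasi_topology)

lemma opn_B: "opn (B x r)"
proof (cases "r > 0")
  case True then show ?thesis using basic by (simp add: basic_assumptions_def)
next
  case False
  then have "B x r = {}" using d_nonneg[of x] by (auto simp: qball_def not_less intro: order_trans)
  then show ?thesis by simp
qed

lemma opn_sets: "opn U \<Longrightarrow> U \<in> sets N"
  using basic by (simp add: basic_assumptions_def)

lemma B_sets [simp, measurable]: "B x r \<in> sets N"
  by (rule opn_sets[OF opn_B])

lemma space_N [simp]: "space N = UNIV"
proof -
  have "UNIV \<in> sets N" by (rule opn_sets) (auto simp: opn_iff intro: exI[of _ 1])
  then show ?thesis using sets.sets_into_space by blast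
qed

lemma B_pos: "0 < r \<Longrightarrow> 0 < emeasure N (B x r)"
  and B_fin: "0 < r \<Longrightarrow> emeasure N (B x r) < \<infinity>"
  using basic by (simp_all add: basic_assumptions_def)

lemma B_fin': "emeasure N (B x r) < \<infinity>"
proof (cases "r > 0")
  case False
  then have "B x r = {}" using d_nonneg[of x] by (auto simp: qball_def not_less intro: order_trans)
  then show ?thesis by simp
qed (rule B_fin)

lemma B_center: "0 < r \<Longrightarrow> x \<in> B x r"
  by (simp add: qball_def d_self)

lemma B_subset: "K * (d z y + r) \<le> R \<Longrightarrow> B y r \<subseteq> B z R"
proof
  fix w assume *: "K * (d z y + r) \<le> R" "w \<in> B y r"
  have "d z w \<le> K * (d z y + d y w)" by (rule d_tri)
  also have "\<dots> < K * (d z y + r)" using * K1 by (simp add: qball_def)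
  finally show "w \<in> B z R" using * by (simp add: qball_def)
qed

lemma B_mono: "r \<le> s \<Longrightarrow> B x r \<subseteq> B x s"
  by (auto simp: qball_def)

lemma doubling_pow:
  assumes "0 < r" shows "emeasure N (B x (2 ^ n * r)) \<le> ennreal (D ^ n) * emeasure N (B x r)"
proof (induction n)
  case (Suc n)
  have "emeasure N (B x (2 ^ Suc n * r)) \<le> ennreal D * emeasure N (B x (2 ^ n * r))"
    using doubl[of "2 ^ n * r" x] assms by (simp add: mult.assoc)
  also have "\<dots> \<le> ennreal D * (ennreal (D ^ n) * emeasure N (B x r))"
    by (rule mult_left_mono[OF Suc]) simp
  also have "\<dots> = ennreal (D ^ Suc n) * emeasure N (B x r)"
    using D1 by (simp add: ennreal_mult mult.assoc)
  finally show ?case .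
qed simp

lemma doubling_factor:
  obtains C where "1 \<le> C" "\<And>x r. 0 < r \<Longrightarrow> emeasure N (B x (L * r)) \<le> ennreal C * emeasure N (B x r)"
proof -
  obtain n where n: "L < 2 ^ n" using real_arch_pow[of 2 L] by auto
  show thesis
  proof (rule that[of "D ^ n"])
    show "1 \<le> D ^ n" using D1 by simp
    fix x and r :: real assume "0 < r"
    then have "L * r \<le> 2 ^ n * r" using n by (intro mult_right_mono) auto
    then have "emeasure N (B x (L * r)) \<le> emeasure N (B x (2 ^ n * r))"
      by (intro emeasure_mono B_mono) auto
    then show "emeasure N (B x (L * r)) \<le> ennreal (D ^ n) * emeasure N (B x r)"
      using doubling_pow[OF \<open>0 < r\<close>, of x n] by simp
  qed
qed

section \<open>Vitali covering lemma\<close>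

text \<open>Every ball has positive measure, and inside a ball of finite measure only finitely many
  disjoint ones can have measure above a given \<open>1 / real (Suc n)\<close>.\<close>

lemma countable_disjoint_balls:
  assumes pos: "\<And>g. g \<in> G \<Longrightarrow> 0 < r g" and sub: "\<And>g. g \<in> G \<Longrightarrow> B g (r g) \<subseteq> B z0 R0"
    and disj: "disjoint_family_on (\<lambda>g. B g (r g)) G"
  shows "countable G"
proof -
  define H where "H n = {g \<in> G. measure N (B g (r g)) > 1 / real (Suc n)}" for n
  have fm: "B x s \<in> fmeasurable N" for x s using B_fin' by (auto simp: fmeasurable_def)
  have "G \<subseteq> (\<Union>n. H n)"
  proof
    fix g assume g: "g \<in> G"
    have "0 < measure N (B g (r g))"
      using B_pos[OF pos[OF g], of g] B_fin'[of g "r g"]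
      by (simp add: measure_def enn2real_positive_iff)
    then obtain n where "1 / real (Suc n) < measure N (B g (r g))"
      using reals_Archimedean by (auto simp: inverse_eq_divide)
    then show "g \<in> (\<Union>n. H n)" using g by (auto simp: H_def)
  qed
  moreover have "countable (H n)" for n
  proof (rule ccontr)
    assume "\<not> countable (H n)"
    then have inf: "infinite (H n)" using countable_finite by blast
    obtain m :: nat where m: "real m > measure N (B z0 R0) * real (Suc n)"
      using reals_Archimedean2 by blast
    obtain F where F: "F \<subseteq> H n" "finite F" "card F = m"
      using infinite_arbitrarily_large[OF inf] by blast
    have "disjoint_family_on (\<lambda>g. B g (r g)) F"
      using disj F by (auto simp: H_def disjoint_family_on_def)
    then have "measure N (\<Union>g\<in>F. B g (r g)) = (\<Sum>g\<in>F. measure N (B g (r g)))"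
      using F B_fin' by (intro measure_finite_Union) (auto simp: less_top[symmetric])
    moreover have "measure N (\<Union>g\<in>F. B g (r g)) \<le> measure N (B z0 R0)"
      using F sub by (intro measure_mono_fmeasurable fm) (auto simp: H_def)
    moreover have "(\<Sum>g\<in>F. measure N (B g (r g))) \<ge> (\<Sum>g\<in>F. 1 / real (Suc n))"
      using F by (intro sum_mono) (auto simp: H_def)
    ultimately have "real m / real (Suc n) \<le> measure N (B z0 R0)" using F by simp
    then show False using m by (simp add: field_simps)
  qed
  ultimately show ?thesis by (meson countable_UN countable_subset uncountable_def countableI_type)
qed

text \<open>Only the centres are covered, which is why the factor \<open>3 * K\<close> is enough: if
  \<open>u\<close> lies in the balls of \<open>a\<close> and \<open>g\<close>, and
  \<open>r a \<le> 2 * r g\<close>, then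
  \<open>d g a < K * (r g + r a) \<le> 3 * K * r g\<close>.\<close>

lemma vitali:
  assumes pos: "\<And>a. a \<in> A \<Longrightarrow> 0 < r a" and bd: "\<And>a. a \<in> A \<Longrightarrow> r a \<le> R"
    and sub: "\<And>a. a \<in> A \<Longrightarrow> B a (r a) \<subseteq> B z0 R0"
  obtains G where "G \<subseteq> A" "countable G" "disjoint_family_on (\<lambda>g. B g (r g)) G"
    "A \<subseteq> (\<Union>g\<in>G. B g (3 * K * r g))"
proof -
  define meets where "meets a b \<longleftrightarrow> B a (r a) \<inter> B b (r b) \<noteq> {}" for a b
  \<comment> \<open>Zorn's lemma is applied to disjoint families with a greedy property: whatever
    meets the family meets a member of at least half its radius. The property passes to unions of
    chains.\<close>
  define \<A> where "\<A> = {H. H \<subseteq> A \<and> disjoint_family_on (\<lambda>g. B g (r g)) H \<and>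
      (\<forall>a\<in>A. (\<exists>h\<in>H. meets a h) \<longrightarrow> (\<exists>h\<in>H. meets a h \<and> r a \<le> 2 * r h))}"
  have "\<exists>G\<in>\<A>. \<forall>X\<in>\<A>. G \<subseteq> X \<longrightarrow> X = G"
  proof (rule subset_Zorn_nonempty)
    show "\<A> \<noteq> {}" by (auto simp: \<A>_def disjoint_family_on_def intro!: exI[of _ "{}"])
  next
    fix \<C> assume ne: "\<C> \<noteq> {}" and ch: "subset.chain \<A> \<C>"
    have sub\<A>: "\<C> \<subseteq> \<A>" and cmp: "\<And>X Y. X \<in> \<C> \<Longrightarrow> Y \<in> \<C> \<Longrightarrow> X \<subseteq> Y \<or> Y \<subseteq> X"
      using ch by (auto simp: subset.chain_def)
    have "disjoint_family_on (\<lambda>g. B g (r g)) (\<Union>\<C>)"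
      unfolding disjoint_family_on_def
    proof (intro ballI impI)
      fix m n assume "m \<in> \<Union>\<C>" "n \<in> \<Union>\<C>" "m \<noteq> n"
      then obtain X Y where XY: "X \<in> \<C>" "Y \<in> \<C>" "m \<in> X" "n \<in> Y" by auto
      then obtain Z where "Z \<in> \<C>" "m \<in> Z" "n \<in> Z" using cmp[OF XY(1,2)] by auto
      then show "B m (r m) \<inter> B n (r n) = {}"
        using sub\<A> \<open>m \<noteq> n\<close> by (auto simp: \<A>_def disjoint_family_on_def)
    qed
    moreover have "\<Union>\<C> \<subseteq> A" using sub\<A> by (auto simp: \<A>_def)
    moreover have "\<exists>h\<in>\<Union>\<C>. meets a h \<and> r a \<le> 2 * r h" if ah: "a \<in> A" "h \<in> \<Union>\<C>" "meets a h" for a h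
    proof -
      obtain X where X: "X \<in> \<C>" "h \<in> X" using ah by auto
      then have "X \<in> \<A>" using sub\<A> by auto
      then have "\<exists>h\<in>X. meets a h \<and> r a \<le> 2 * r h" using ah X by (auto simp: \<A>_def)
      then show ?thesis using X by auto
    qed
    ultimately show "\<Union>\<C> \<in> \<A>" unfolding \<A>_def by blast
  qed
  then obtain G where G: "G \<in> \<A>" and max: "\<And>X. X \<in> \<A> \<Longrightarrow> G \<subseteq> X \<Longrightarrow> X = G" by blast
  have GA: "G \<subseteq> A" and Gd: "disjoint_family_on (\<lambda>g. B g (r g)) G"
    and Gm: "\<And>a. a \<in> A \<Longrightarrow> (\<exists>h\<in>G. meets a h) \<Longrightarrow> (\<exists>h\<in>G. meets a h \<and> r a \<le> 2 * r h)"
    using G by (auto simp: \<A>_def)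
  have self: "meets a a" if "a \<in> A" for a
    using B_center[OF pos[OF that], of a] by (auto simp: meets_def)
  have all: "\<exists>h\<in>G. meets a h" if "a \<in> A" for a
  proof (rule ccontr)
    assume no: "\<not> (\<exists>h\<in>G. meets a h)"
    \<comment> \<open>If some ball missed the maximal family \<open>G\<close>, then a ball of more
      than half the supremal radius among those missing \<open>G\<close> could be added: the newly
      met balls have at most twice its radius.\<close>
    define F where "F = {b \<in> A. \<not> (\<exists>h\<in>G. meets b h)}"
    have aF: "a \<in> F" using that no by (simp add: F_def)
    have bdd: "bdd_above (r ` F)" using bd by (auto simp: F_def bdd_above_def)
    define S where "S = Sup (r ` F)"
    have "r a \<le> S" unfolding S_def using aF bdd by (intro cSup_upper) auto
    then have "S / 2 < S" using pos[OF that] by simp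
    then obtain y where "y \<in> r ` F" "S / 2 < y"
      using less_cSup_iff[of "r ` F" "S / 2"] aF bdd unfolding S_def by auto
    then obtain b where b: "b \<in> F" "S / 2 < r b" by auto
    have rF: "r c \<le> 2 * r b" if "c \<in> F" for c
    proof -
      have "r c \<le> S" unfolding S_def using that bdd by (intro cSup_upper) auto
      then show ?thesis using b by simp
    qed
    have bA: "b \<in> A" and bG: "\<And>h. h \<in> G \<Longrightarrow> \<not> meets b h" using b by (auto simp: F_def)
    have "insert b G \<in> \<A>"
    proof -
      have "insert b G \<subseteq> A" using bA GA by auto
      moreover have "disjoint_family_on (\<lambda>g. B g (r g)) (insert b G)"
        using Gd bG by (auto simp: disjoint_family_on_def meets_def)
      moreover have "\<exists>h\<in>insert b G. meets c h \<and> r c \<le> 2 * r h"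
        if c: "c \<in> A" "\<exists>h\<in>insert b G. meets c h" for c
      proof (cases "\<exists>h\<in>G. meets c h")
        case True then show ?thesis using Gm[OF c(1)] by auto
      next
        case False
        then have "meets c b" "c \<in> F" using c by (auto simp: F_def)
        then show ?thesis using rF by auto
      qed
      ultimately show ?thesis unfolding \<A>_def by blast
    qed
    then have "b \<in> G" using max by blast
    then show False using bG self[OF bA] by blast
  qed
  have "A \<subseteq> (\<Union>g\<in>G. B g (3 * K * r g))"
  proof
    fix a assume a: "a \<in> A"
    then obtain g where g: "g \<in> G" "meets a g" "r a \<le> 2 * r g" using all Gm by blast
    then obtain u where u: "d a u < r a" "d g u < r g" by (auto simp: meets_def qball_def)
    have "d g a \<le> K * (d g u + d u a)" by (rule d_tri)
    also have "\<dots> < K * (r g + r a)" using u K1 by (simp add: d_sym[of u a])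
    also have "\<dots> \<le> K * (3 * r g)" using g K1 by (intro mult_left_mono) auto
    finally show "a \<in> (\<Union>g\<in>G. B g (3 * K * r g))" using g by (auto simp: qball_def mult.commute mult.left_commute)
  qed
  moreover have "countable G"
    by (rule countable_disjoint_balls[OF _ _ Gd]) (use GA pos sub in auto)
  ultimately show thesis using that GA Gd by blast
qed


section \<open>Outer regularity by open sets\<close>

lemma sigma_opn_sets: "S \<in> sigma_sets UNIV {U. opn U} \<Longrightarrow> S \<in> sets N"
proof (induction rule: sigma_sets.induct)
  case (Compl a)
  then show ?case using sets.compl_sets[of a N] by simp
qed (auto intro: opn_sets)

lemma opn_Union: "(\<And>i. i \<in> I \<Longrightarrow> opn (U i)) \<Longrightarrow> opn (\<Union>i\<in>I. U i)"
  by (rule openin_clauses(3)) auto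

lemma opn_Int: "opn U \<Longrightarrow> opn V \<Longrightarrow> opn (U \<inter> V)"
  by (rule openin_Int)

lemma decseq_small:
  assumes "decseq A" "\<And>n. A n \<in> sets N" "\<And>n. A n \<subseteq> B z R" "(\<Inter>n. A n) = {}" "0 < e"
  obtains n where "emeasure N (A n) \<le> ennreal e"
proof -
  have "emeasure N (A n) \<noteq> \<infinity>" for n
    using emeasure_mono[OF assms(3)[of n], of N] B_fin'[of z R] by (auto simp: top_unique)
  then have "(\<lambda>n. emeasure N (A n)) \<longlonglongrightarrow> emeasure N (\<Inter>n. A n)"
    using assms by (intro Lim_emeasure_decseq) auto
  then have "eventually (\<lambda>n. emeasure N (A n) < ennreal e) sequentially"
    using assms(4,5) by (auto dest!: order_tendstoD(2)[where a = "ennreal e"])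
  then show thesis using that by (auto simp: eventually_sequentially intro: less_imp_le)
qed

text \<open>A point outside the closed set \<open>F\<close> has a ball disjoint from
  \<open>F\<close>; by symmetry of \<open>d\<close> it lies in no ball of smaller radius centred in
  \<open>F\<close>.\<close>

lemma closed_G_delta:
  assumes "opn (- F)"
  shows "(\<Inter>n. \<Union>x\<in>F. B x (1 / real (Suc n))) = F"
proof
  show "F \<subseteq> (\<Inter>n. \<Union>x\<in>F. B x (1 / real (Suc n)))"
    by (auto intro!: B_center)
  show "(\<Inter>n. \<Union>x\<in>F. B x (1 / real (Suc n))) \<subseteq> F"
  proof (rule ccontr)
    assume "\<not> ?thesis"
    then obtain z where z: "z \<in> (\<Inter>n. \<Union>x\<in>F. B x (1 / real (Suc n)))" "z \<in> - F" by blast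
    then obtain r where r: "r > 0" "B z r \<subseteq> - F" using assms unfolding opn_iff by blast
    obtain n where n: "1 / real (Suc n) < r"
      using reals_Archimedean[OF r(1)] by (auto simp: inverse_eq_divide)
    obtain x where "x \<in> F" "z \<in> B x (1 / real (Suc n))" using z by blast
    then have "x \<in> B z r" using n d_sym[of x z] by (auto simp: qball_def)
    then show False using r \<open>x \<in> F\<close> by auto
  qed
qed

text \<open>Sets caught between a closed and an open set up to measure \<open>e\<close> include the
  open sets and are stable under complements and countable unions. Everything is measured inside a
  fixed ball, because continuity from above needs finite measure.\<close>

lemma regular_sets:
  assumes "S \<in> sigma_sets UNIV {U. opn U}" "0 < e"
  shows "\<exists>F U. opn (- F) \<and> opn U \<and> F \<subseteq> S \<and> S \<subseteq> U \<and> emeasure N ((U - F) \<inter> B z R) \<le> ennreal e"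
  using assms
proof (induction arbitrary: e rule: sigma_sets.induct)
  case (Basic S)
  \<comment> \<open>The neighbourhoods of the complement of \<open>S\<close> shrink to that
    complement, so their own complements are closed sets exhausting \<open>S\<close> from
    inside.\<close>
  define P where "P n = (\<Union>x\<in>-S. B x (1 / real (Suc n)))" for n
  have opP: "opn (P n)" for n unfolding P_def by (intro opn_Union opn_B)
  have "decseq P"
  proof (rule decseq_SucI)
    fix n
    have "B x (1 / real (Suc (Suc n))) \<subseteq> B x (1 / real (Suc n))" for x
      by (rule B_mono) (simp add: field_simps)
    then show "P (Suc n) \<subseteq> P n" unfolding P_def by blast
  qed
  have S: "opn S" using Basic by simp
  have IO: "(\<Inter>n. P n) = - S" unfolding P_def using S by (intro closed_G_delta) simp
  have "decseq (\<lambda>n. (S \<inter> P n) \<inter> B z R)"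
    using \<open>decseq P\<close> by (auto simp: decseq_def)
  moreover have "(\<Inter>n. (S \<inter> P n) \<inter> B z R) = {}" using IO by blast
  moreover have "(S \<inter> P n) \<inter> B z R \<in> sets N" for n
    using opn_sets[OF S] opn_sets[OF opP] by auto
  ultimately obtain n where n: "emeasure N ((S \<inter> P n) \<inter> B z R) \<le> ennreal e"
    using decseq_small[of "\<lambda>n. (S \<inter> P n) \<inter> B z R" z R e] Basic(2) by blast
  have "- P n \<subseteq> S" using IO by blast
  moreover have "S - - P n = S \<inter> P n" by auto
  ultimately show ?case using opP S n by (intro exI[of _ "- P n"] exI[of _ S]) auto
next
  case Empty
  show ?case by (intro exI[of _ "{}"]) (auto simp: opn_iff intro!: exI[of _ 1])
next
  case (Compl S)
  then obtain F U where "opn (- F)" "opn U" "F \<subseteq> S" "S \<subseteq> U"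
    "emeasure N ((U - F) \<inter> B z R) \<le> ennreal e" by blast
  moreover have "- F - - U = U - F" by auto
  ultimately show ?case by (intro exI[of _ "- U"] exI[of _ "- F"]) auto
next
  case (Union S)
  \<comment> \<open>These tolerances add up to \<open>e / 2\<close>; the other half is kept for
    replacing the infinite union of closed sets by a finite one.\<close>
  define c where "c i = e / 2 * (1 / 2) ^ Suc i" for i :: nat
  have c: "0 < c i" for i using Union(3) by (simp add: c_def)
  have "\<forall>i. \<exists>F U. opn (- F) \<and> opn U \<and> F \<subseteq> S i \<and> S i \<subseteq> U \<and>
      emeasure N ((U - F) \<inter> B z R) \<le> ennreal (c i)"
    using Union(2) c by blast
  then obtain F U where FU: "\<And>i. opn (- F i)" "\<And>i. opn (U i)" "\<And>i. F i \<subseteq> S i" "\<And>i. S i \<subseteq> U i"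
      "\<And>i. emeasure N ((U i - F i) \<inter> B z R) \<le> ennreal (c i)"
    by metis
  have Fs: "F i \<in> sets N" for i
  proof -
    have "space N - (- F i) \<in> sets N" by (intro sets.compl_sets opn_sets FU)
    then show ?thesis by simp
  qed
  have Us: "U i \<in> sets N" for i by (intro opn_sets FU)
  define V where "V = (\<Union>i. U i)"
  have Vs: "V \<in> sets N" unfolding V_def using Us by auto
  \<comment> \<open>An infinite union of closed sets need not be closed. \<open>A n\<close> is what
    is lost in the ball when only the first \<open>n\<close> of them are kept.\<close>
  define A where "A n = ((\<Union>i. F i) - (\<Union>i<n. F i)) \<inter> B z R" for n :: nat
  have As: "A n \<in> sets N" for n unfolding A_def using Fs by auto
  have "decseq A"
  proof (rule decseq_SucI)
    show "A (Suc n) \<subseteq> A n" for n unfolding A_def by (auto simp: less_Suc_eq)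
  qed
  moreover have "(\<Inter>n. A n) = {}" unfolding A_def by (auto intro: lessI)
  ultimately obtain n where n: "emeasure N (A n) \<le> ennreal (e / 2)"
    using As Union(3) decseq_small[of A z R "e / 2"] A_def by (metis Int_lower2 half_gt_zero)
  have "emeasure N ((V - (\<Union>i. F i)) \<inter> B z R) \<le> emeasure N (\<Union>i. (U i - F i) \<inter> B z R)"
    unfolding V_def using Us Fs by (intro emeasure_mono) auto
  also have "\<dots> \<le> (\<Sum>i. emeasure N ((U i - F i) \<inter> B z R))"
    using Us Fs by (intro emeasure_subadditive_countably) auto
  also have "\<dots> \<le> (\<Sum>i. ennreal (c i))" by (intro suminf_le FU) auto
  also have "\<dots> = ennreal (e / 2)"
  proof (rule suminf_ennreal_eq)
    show "0 \<le> c i" for i using c[of i] by simp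
    show "(\<lambda>i. c i) sums (e / 2)" using sums_mult[OF power_half_series, of "e / 2"] unfolding c_def by simp
  qed
  finally have 1: "emeasure N ((V - (\<Union>i. F i)) \<inter> B z R) \<le> ennreal (e / 2)" .
  have "emeasure N ((V - (\<Union>i<n. F i)) \<inter> B z R)
      \<le> emeasure N ((V - (\<Union>i. F i)) \<inter> B z R \<union> A n)"
    using Vs Fs As by (intro emeasure_mono) (auto simp: A_def)
  also have "\<dots> \<le> emeasure N ((V - (\<Union>i. F i)) \<inter> B z R) + emeasure N (A n)"
    using Vs Fs As by (intro emeasure_subadditive) auto
  also have "\<dots> \<le> ennreal (e / 2) + ennreal (e / 2)" by (intro add_mono 1 n)
  also have "\<dots> = ennreal e" using Union(3) by (simp flip: ennreal_plus)
  finally have 2: "emeasure N ((V - (\<Union>i<n. F i)) \<inter> B z R) \<le> ennreal e" .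
  have cl: "opn (- (\<Union>i<n. F i))"
  proof -
    have "openin (quasi_topology d) (\<Inter>i\<in>{..<n}. - F i)" if "n \<noteq> 0"
      using that FU(1) by (intro openin_Inter) auto
    moreover have "opn UNIV" by (auto simp: opn_iff intro!: exI[of _ 1])
    ultimately show ?thesis by (cases "n = 0") (auto simp: Compl_UN)
  qed
  have opV: "opn V" unfolding V_def by (intro opn_Union FU)
  have "(\<Union>i<n. F i) \<subseteq> (\<Union>i. S i)" "(\<Union>i. S i) \<subseteq> V" using FU(3,4) by (force simp: V_def)+
  then show ?case using 2 cl opV by blast
qed

text \<open>\<open>E\<close> is measurable, so its outer measure is its measure and the Borel hull
  \<open>E'\<close> has the same measure. An open set close to \<open>E'\<close> inside the ball is
  then intersected with the ball.\<close>

lemma outer_regular: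
  assumes E: "E \<in> sets N" "E \<subseteq> B z R" and c: "emeasure N E < c"
  obtains U where "opn U" "E \<subseteq> U" "emeasure N U < c"
proof -
  obtain E' where E': "E' \<in> sigma_sets UNIV {U. opn U}" "E \<subseteq> E'"
      "outer_measure_of N E = emeasure N E'"
    using basic_assumptions.borel_regular[OF basic, of E] by blast
  have nE: "emeasure N E' = emeasure N E" using E' E(1) by simp
  obtain e where e: "0 < e" "emeasure N E + ennreal e < c"
  proof -
    obtain b where b: "emeasure N E < b" "b < c" using dense[OF c] by blast
    obtain x where x: "emeasure N E = ennreal x" "0 \<le> x" using c by (cases "emeasure N E") auto
    obtain y where y: "b = ennreal y" "0 \<le> y" using b by (cases b) auto
    have "x < y" using b x y by (simp add: ennreal_less_iff)
    then have "emeasure N E + ennreal (y - x) = b" using x y by (simp flip: ennreal_plus)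
    then show thesis using that[of "y - x"] b \<open>x < y\<close> by simp
  qed
  obtain F U where FU: "opn (- F)" "opn U" "F \<subseteq> E'" "E' \<subseteq> U"
      "emeasure N ((U - F) \<inter> B z R) \<le> ennreal e"
    using regular_sets[OF E'(1) e(1)] by blast
  have s: "U \<in> sets N" "E' \<in> sets N" "F \<in> sets N"
    using opn_sets[OF FU(2)] sigma_opn_sets[OF E'(1)] sets.compl_sets[OF opn_sets[OF FU(1)]] by auto
  have "emeasure N (U \<inter> B z R) \<le> emeasure N (E' \<union> (U - F) \<inter> B z R)"
    using s FU by (intro emeasure_mono) auto
  also have "\<dots> \<le> emeasure N E' + emeasure N ((U - F) \<inter> B z R)"
    using s by (intro emeasure_subadditive) auto
  also have "\<dots> \<le> emeasure N E + ennreal e" using FU nE by (intro add_mono) auto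
  finally have "emeasure N (U \<inter> B z R) < c" using e(2) by (rule le_less_trans)
  moreover have "E \<subseteq> U \<inter> B z R" using E E' FU by auto
  ultimately show thesis using that opn_Int[OF FU(2) opn_B] by blast
qed

end

section \<open>Weighted measures and differentiation of integrals\<close>

locale doubling_weight = doubling_space +
  fixes v :: "'a \<Rightarrow> real" and W :: "'a measure"
  assumes v_meas [measurable]: "v \<in> borel_measurable N"
    and W_def: "W = density N (\<lambda>z. ennreal (v z))"
    and v_pos: "AE z in N. 0 < v z"
    and W_fin: "0 < r \<Longrightarrow> emeasure W (qball d x r) < \<infinity>"
begin

lemma sets_W [simp, measurable_cong]: "sets W = sets N"
  by (simp add: W_def)

lemma sublevel_sets: "{z. v z \<le> c} \<in> sets N" and superlevel_sets: "{z. c < v z} \<in> sets N"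
proof -
  have "{z \<in> space N. v z \<le> c} \<in> sets N" "{z \<in> space N. c < v z} \<in> sets N" by measurable
  then show "{z. v z \<le> c} \<in> sets N" "{z. c < v z} \<in> sets N" by simp_all
qed

text \<open>Losing the factor \<open>C\<close>, the Lebesgue differentiation theorem needs only outer regularity
  and the covering lemma.\<close>

lemma weak_lebesgue:
  obtains C where "1 \<le> C" "\<And>l z0 R0 R. \<lbrakk>0 < l; 0 < R0\<rbrakk> \<Longrightarrow> AE z in N. z \<in> B z0 R \<longrightarrow> C * l < v z \<longrightarrow>
    (\<exists>r. 0 < r \<and> r \<le> R0 \<and> ennreal l * emeasure N (B z r) < emeasure W (B z r))"
proof -
  obtain D' where D': "1 \<le> D'"
      "\<And>x r. 0 < r \<Longrightarrow> emeasure N (B x ((3 * K\<^sup>2) * r)) \<le> ennreal D' * emeasure N (B x r)"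
    using doubling_factor[of "3 * K\<^sup>2"] by blast
  obtain D3 where D3: "1 \<le> D3"
      "\<And>x r. 0 < r \<Longrightarrow> emeasure N (B x ((3 * K) * r)) \<le> ennreal D3 * emeasure N (B x r)"
    using doubling_factor[of "3 * K"] by blast
  show thesis
  \<comment> \<open>\<open>D'\<close> pays for replacing a ball containing \<open>z\<close> by one
    centred at \<open>z\<close>, \<open>D3\<close> for the dilation in the covering lemma, and 2 for
    the open set around \<open>E\<close>.\<close>
  proof (rule that[of "2 * D' * D3"])
    have "1 \<le> D' * D3" using mult_mono[OF D'(1) D3(1)] D'(1) by simp
    then show "1 \<le> 2 * D' * D3" by simp
    fix l R0 :: real and z0 R assume l: "0 < l" and R0: "0 < R0"
    define l' where "l' = l * D'"
    define R1 where "R1 = R0 / (2 * K)"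
    have R1: "0 < R1" using R0 K1 by (simp add: R1_def)
    have l': "0 < l'" using l D'(1) by (simp add: l'_def)
    \<comment> \<open>Balls that merely contain the point are used, since their union is open and
      hence measurable. The higher level \<open>l'\<close> and the smaller radius bound
      \<open>R1\<close> leave room to recentre them in \<open>good\<close>.\<close>
    define G where "G = (\<Union>(y, r) \<in> {(y, r). 0 < r \<and> r \<le> R1 \<and>
        ennreal l' * emeasure N (B y r) < emeasure W (B y r)}. B y r)"
    have "opn G" unfolding G_def by (rule opn_Union) (auto intro: opn_B)
    then have Gs: "G \<in> sets N" by (rule opn_sets)
    have good: "\<exists>r. 0 < r \<and> r \<le> R0 \<and> ennreal l * emeasure N (B z r) < emeasure W (B z r)"
      if zG: "z \<in> G" for z
    proof -
      obtain y r where y: "0 < r" "r \<le> R1" "ennreal l' * emeasure N (B y r) < emeasure W (B y r)"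
          "z \<in> B y r" using zG by (auto simp: G_def)
      have dz: "d z y < r" "d y z < r" using y d_sym[of y z] by (auto simp: qball_def)
      have "K * (d z y + r) \<le> 2 * K * r" using dz K1 by simp
      then have s1: "B y r \<subseteq> B z (2 * K * r)" by (rule B_subset)
      have "r \<le> K * r" using K1 y by simp
      then have "d y z + 2 * K * r \<le> 3 * K * r" using dz by simp
      then have "K * (d y z + 2 * K * r) \<le> K * (3 * K * r)" using K1 by (intro mult_left_mono) auto
      then have "K * (d y z + 2 * K * r) \<le> (3 * K\<^sup>2) * r" by (simp add: power2_eq_square)
      then have s2: "B z (2 * K * r) \<subseteq> B y ((3 * K\<^sup>2) * r)" by (rule B_subset)
      have "ennreal l * emeasure N (B z (2 * K * r)) \<le> ennreal l * emeasure N (B y ((3 * K\<^sup>2) * r))"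
        by (intro mult_left_mono emeasure_mono s2) auto
      also have "\<dots> \<le> ennreal l * (ennreal D' * emeasure N (B y r))"
        by (intro mult_left_mono D' y) auto
      also have "\<dots> = ennreal l' * emeasure N (B y r)"
        using l D' by (simp add: l'_def ennreal_mult mult.assoc)
      also have "\<dots> < emeasure W (B y r)" by (rule y)
      also have "\<dots> \<le> emeasure W (B z (2 * K * r))" by (intro emeasure_mono s1) auto
      finally have "ennreal l * emeasure N (B z (2 * K * r)) < emeasure W (B z (2 * K * r))" .
      moreover have "2 * K * r \<le> R0" "0 < 2 * K * r"
        using y K1 by (simp_all add: R1_def field_simps)
      ultimately show ?thesis by blast
    qed
    define E where "E = {z \<in> space N. 2 * D' * D3 * l < v z} \<inter> B z0 R - G"
    have Es: "E \<in> sets N" unfolding E_def using Gs by measurable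
    have Efin: "emeasure N E < \<infinity>"
    proof -
      have "emeasure N E \<le> emeasure N (B z0 R)" by (intro emeasure_mono) (auto simp: E_def)
      then show ?thesis using B_fin'[of z0 R] by (rule le_less_trans)
    qed
    have "emeasure N E = 0"
    proof (rule ccontr)
      assume ne: "emeasure N E \<noteq> 0"
      define c where "c = 2 * D' * D3 * l"
      have c: "0 < c" using l D' D3 by (simp add: c_def)
      \<comment> \<open>\<open>E\<close> has positive finite measure, so outer regularity yields an
        open \<open>U\<close> of less than twice that measure. The Vitali balls are chosen inside
        \<open>U\<close>.\<close>
      have "emeasure N E < 2 * emeasure N E"
      proof -
        obtain x where "emeasure N E = ennreal x" "0 \<le> x" using Efin by (cases "emeasure N E") auto
        then show ?thesis using ne by (cases "x = 0")
            (simp_all add: ennreal_numeral[symmetric] ennreal_mult[symmetric] ennreal_less_iff del: ennreal_numeral)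
      qed
      then obtain U where U: "opn U" "E \<subseteq> U" "emeasure N U < 2 * emeasure N E"
        using outer_regular[OF Es, of z0 R] by (auto simp: E_def)
      have "opn (U \<inter> B z0 R)" by (intro opn_Int U opn_B)
      moreover have "E \<subseteq> U \<inter> B z0 R" using U by (auto simp: E_def)
      ultimately have "\<forall>z\<in>E. \<exists>r>0. B z r \<subseteq> U \<inter> B z0 R" by (auto simp: opn_iff)
      then obtain r0 where r0: "\<And>z. z \<in> E \<Longrightarrow> 0 < r0 z \<and> B z (r0 z) \<subseteq> U \<inter> B z0 R" by metis
      define r where "r z = min (r0 z) (R1 / (3 * K))" for z
      have rp: "0 < r z" if "z \<in> E" for z using r0[OF that] R1 K1 by (auto simp: r_def)
      have rb: "3 * K * r z \<le> R1" for z
      proof -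
        have "r z \<le> R1 / (3 * K)" by (simp add: r_def)
        then show ?thesis using K1 by (simp add: field_simps)
      qed
      have rs: "B z (r z) \<subseteq> U \<inter> B z0 R" if "z \<in> E" for z
        using r0[OF that] B_mono[of "r z" "r0 z" z] by (auto simp: r_def)
      obtain H where H: "H \<subseteq> E" "countable H" "disjoint_family_on (\<lambda>g. B g (r g)) H"
          "E \<subseteq> (\<Union>g\<in>H. B g (3 * K * r g))"
      proof (rule vitali[of E r "R1 / (3 * K)" z0 R])
        show "r a \<le> R1 / (3 * K)" for a by (simp add: r_def)
      qed (use rp rs that in auto)
      \<comment> \<open>A dilated ball still has radius at most \<open>R1\<close> and contains its
        centre \<open>g\<close>, which is outside \<open>G\<close>; so its average cannot exceed
        \<open>l'\<close>.\<close>
      have "emeasure W (\<Union>g\<in>H. B g (3 * K * r g))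
          \<le> ennreal (l' * D3) * emeasure N (\<Union>g\<in>H. B g (r g))"
      proof (rule emeasure_countable_cover_le)
        fix g assume "g \<in> H"
        then have g: "g \<in> E" "g \<notin> G" using H by (auto simp: E_def)
        have p: "0 < 3 * K * r g" using rp[OF g(1)] K1 by simp
        have "\<not> (ennreal l' * emeasure N (B g (3 * K * r g)) < emeasure W (B g (3 * K * r g)))"
        proof
          assume "ennreal l' * emeasure N (B g (3 * K * r g)) < emeasure W (B g (3 * K * r g))"
          then have "(g, 3 * K * r g) \<in> {(y, r). 0 < r \<and> r \<le> R1 \<and>
              ennreal l' * emeasure N (B y r) < emeasure W (B y r)}" using p rb by auto
          then have "g \<in> G" unfolding G_def using B_center[OF p] by blast
          then show False using g by simp
        qed
        then have "emeasure W (B g (3 * K * r g)) \<le> ennreal l' * emeasure N (B g (3 * K * r g))"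
          by simp
        also have "\<dots> \<le> ennreal l' * (ennreal D3 * emeasure N (B g (r g)))"
          by (intro mult_left_mono D3 rp g) auto
        also have "\<dots> = ennreal (l' * D3) * emeasure N (B g (r g))"
          using l' D3 by (simp add: ennreal_mult mult.assoc)
        finally show "emeasure W (B g (3 * K * r g)) \<le> ennreal (l' * D3) * emeasure N (B g (r g))" .
      qed (use H in auto)
      also have "\<dots> \<le> ennreal (l' * D3) * emeasure N U"
        using H(1) rs opn_sets[OF U(1)] by (intro mult_left_mono emeasure_mono) auto
      finally have 1: "emeasure W E \<le> ennreal (l' * D3) * emeasure N U"
        using order_trans[OF emeasure_mono[OF H(4), of W]] sets.countable_UN''[OF H(2), of "\<lambda>g. B g (3 * K * r g)" N]
        by simp
      have "ennreal (l' * D3) * emeasure N U < ennreal (l' * D3) * (2 * emeasure N E)"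
        using l' D3 U(3) by (intro ennreal_mult_strict_left_mono) auto
      also have "\<dots> = ennreal c * emeasure N E"
      proof -
        have "ennreal c = ennreal (l' * D3 * 2)" by (simp add: c_def l'_def mult_ac)
        also have "\<dots> = ennreal (l' * D3) * ennreal 2" using l' D3 by (intro ennreal_mult) auto
        finally have "ennreal (l' * D3) * 2 = ennreal c" by simp
        then show ?thesis by (simp add: mult.assoc[symmetric])
      qed
      also have "\<dots> = (\<integral>\<^sup>+z. ennreal c * indicator E z \<partial>N)"
        using Es by (simp add: nn_integral_cmult_indicator)
      also have "\<dots> \<le> (\<integral>\<^sup>+z. ennreal (v z) * indicator E z \<partial>N)"
        by (intro nn_integral_mono) (auto simp: E_def c_def indicator_def intro!: ennreal_leI)
      also have "\<dots> = emeasure W E" using Es by (simp add: W_def emeasure_density)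
      finally show False using 1 by simp
    qed
    then have "AE z in N. z \<notin> E" using Es by (intro AE_not_in) auto
    then show "AE z in N. z \<in> B z0 R \<longrightarrow> 2 * D' * D3 * l < v z \<longrightarrow>
      (\<exists>r. 0 < r \<and> r \<le> R0 \<and> ennreal l * emeasure N (B z r) < emeasure W (B z r))"
      by eventually_elim (use good in \<open>auto simp: E_def\<close>)
  qed
qed

end

section \<open>Local reverse Hoelder inequality\<close>

text \<open>The summands without the indicator are the increments of
  \<open>(c * 2 ^ j) powr a\<close>, so they telescope. The factor \<open>2 powr a - 1\<close> tends
  to 0 with \<open>a\<close> and is the source of smallness in the absorption.\<close>

lemma powr_le_dyadic_sum:
  fixes u c a :: real
  assumes "0 \<le> u" "0 < c" "0 < a" "u \<le> c * 2 ^ n"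
  shows "u powr a \<le> c powr a
      + (\<Sum>j<n. (2 powr a - 1) * (c * 2 ^ j) powr a * of_bool (c * 2 ^ j < u))"
  using assms(4)
proof (induction n)
  case 0
  then show ?case using assms by (simp add: powr_mono2)
next
  case (Suc n)
  have tele: "c powr a + (\<Sum>j<n. (2 powr a - 1) * (c * 2 ^ j) powr a) = (c * 2 ^ n) powr a" for n
  proof (induction n)
    case (Suc n)
    have "(c * 2 ^ Suc n) powr a = 2 powr a * (c * 2 ^ n) powr a"
      using assms by (simp add: powr_mult[symmetric] mult_ac)
    then show ?case using Suc by (simp add: algebra_simps)
  qed simp
  show ?case
  proof (cases "u \<le> c * 2 ^ n")
    case True
    then show ?thesis using Suc by simp
  next
    case False
    have "c * 2 ^ j < u" if "j < Suc n" for j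
    proof -
      have "c * 2 ^ j \<le> c * 2 ^ n" using that assms by (intro mult_left_mono power_increasing) auto
      then show ?thesis using False by simp
    qed
    then have "(\<Sum>j<Suc n. (2 powr a - 1) * (c * 2 ^ j) powr a * of_bool (c * 2 ^ j < u))
        = (\<Sum>j<Suc n. (2 powr a - 1) * (c * 2 ^ j) powr a)"
      by (intro sum.cong) auto
    then show ?thesis using tele[of "Suc n"] assms Suc.prems by (simp add: powr_mono2)
  qed
qed

text \<open>The levels below \<open>x\<close> form an initial segment of a geometric sequence of
  ratio \<open>2 powr e\<close>, at least 2, whose sum is at most twice its last term.\<close>

lemma dyadic_sum_le_powr:
  fixes x c e :: real
  assumes "0 \<le> x" "0 < c" "1 \<le> e"
  shows "(\<Sum>j<n. (c * 2 ^ j) powr e * of_bool (c * 2 ^ j < x)) \<le> 2 * x powr e"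
proof (induction n)
  case (Suc n)
  have geo: "(\<Sum>j<Suc n. (c * 2 ^ j) powr e) \<le> 2 * (c * 2 ^ n) powr e" for n
  proof (induction n)
    case (Suc n)
    have "(2::real) powr 1 \<le> 2 powr e" using assms by (intro powr_mono) auto
    then have "2 * (c * 2 ^ n) powr e \<le> 2 powr e * (c * 2 ^ n) powr e"
      by (intro mult_right_mono) auto
    also have "\<dots> = (c * 2 ^ Suc n) powr e"
      using assms by (simp add: powr_mult[symmetric] mult_ac)
    finally show ?case using Suc by simp
  qed simp
  show ?case
  proof (cases "c * 2 ^ n < x")
    case True
    have "(\<Sum>j<Suc n. (c * 2 ^ j) powr e * of_bool (c * 2 ^ j < x)) \<le> (\<Sum>j<Suc n. (c * 2 ^ j) powr e)"
      by (intro sum_mono) auto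
    also have "\<dots> \<le> 2 * (c * 2 ^ n) powr e" by (rule geo)
    also have "\<dots> \<le> 2 * x powr e" using True assms by (intro mult_left_mono powr_mono2) auto
    finally show ?thesis .
  next
    case False
    then show ?thesis using Suc by simp
  qed
qed simp

section \<open>Good-lambda inequality\<close>

locale weak_A_infinity = doubling_weight +
  fixes A \<Lambda> \<beta> :: real
  assumes A: "0 < A" and Lam: "1 \<le> \<Lambda>" and beta: "0 < \<beta>" "\<beta> \<le> 1"
    and weakA: "\<lbrakk>0 < r; 0 < l; ennreal l * emeasure N (qball d z r) < emeasure W (qball d z r)\<rbrakk>
      \<Longrightarrow> emeasure N (qball d z r)
        \<le> ennreal A * emeasure N (qball d z (\<Lambda> * r) \<inter> {z. \<beta> * l < v z})"
begin

abbreviation "nbhd S s \<equiv> (\<Union>z\<in>S. B z s)"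

lemma nbhd_sets [simp, measurable]: "nbhd S s \<in> sets N"
  by (intro opn_sets opn_Union opn_B)

text \<open>Radii are tried along the powers of \<open>L\<close>, so a greatest admissible exponent
  exists. The next radius either is still at most \<open>s / L\<close> and fails by maximality, or
  falls between \<open>s / L\<close> and \<open>s\<close>, where the average is small by
  assumption.\<close>

lemma stopping_radius:
  assumes "0 < r" "r \<le> s / L" "1 < L" and "ennreal l * emeasure N (B z r) < emeasure W (B z r)"
    and top: "\<And>r. \<lbrakk>s / L \<le> r; r \<le> s\<rbrakk> \<Longrightarrow> emeasure W (B z r) \<le> ennreal l * emeasure N (B z r)"
  obtains t where "0 < t" "t \<le> s / L" "ennreal l * emeasure N (B z t) < emeasure W (B z t)"
    "emeasure W (B z (L * t)) \<le> ennreal l * emeasure N (B z (L * t))"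
proof -
  define P where "P n \<longleftrightarrow> L ^ n * r \<le> s / L \<and>
    ennreal l * emeasure N (B z (L ^ n * r)) < emeasure W (B z (L ^ n * r))" for n
  obtain b where b: "s / L / r < L ^ b" using real_arch_pow[OF assms(3)] by blast
  have bd: "n \<le> b" if "P n" for n
  proof (rule ccontr)
    assume "\<not> n \<le> b"
    then have "L ^ b \<le> L ^ n" using assms(3) by (intro power_increasing) auto
    then have "s / L / r < L ^ n" using b by simp
    then have "s / L < L ^ n * r" using assms(1) by (simp only: pos_divide_less_eq)
    then show False using that by (simp add: P_def)
  qed
  have "P 0" using assms by (simp add: P_def)
  define n where "n = Greatest P"
  have n: "P n" unfolding n_def by (rule GreatestI_nat[of P 0 b]) (use \<open>P 0\<close> bd in auto)
  have "\<not> P (Suc n)"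
  proof
    assume "P (Suc n)"
    then have "Suc n \<le> n" unfolding n_def using bd by (intro Greatest_le_nat[of P _ b]) auto
    then show False by simp
  qed
  show thesis
  proof (rule that[of "L ^ n * r"])
    show "0 < L ^ n * r" using assms by simp
    show "L ^ n * r \<le> s / L" "ennreal l * emeasure N (B z (L ^ n * r)) < emeasure W (B z (L ^ n * r))"
      using n by (simp_all add: P_def)
    show "emeasure W (B z (L * (L ^ n * r))) \<le> ennreal l * emeasure N (B z (L * (L ^ n * r)))"
    proof (cases "L ^ Suc n * r \<le> s / L")
      case True
      then show ?thesis using \<open>\<not> P (Suc n)\<close> by (simp add: P_def not_less mult.assoc)
    next
      case False
      have "L * (L ^ n * r) \<le> s" using n assms by (simp add: P_def field_simps)
      then show ?thesis using False by (intro top) (auto simp: mult.assoc)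
    qed
  qed
qed

text \<open>The bound on averages at radii comparable to \<open>s\<close> makes the stopping
  argument work and keeps all selected balls inside the \<open>s\<close>-neighbourhood of
  \<open>S\<close>. The ball \<open>B z0 R\<close> confines the family for the covering and
  differentiation lemmas.\<close>

lemma good_lambda:
  obtains C1 C2 where "1 \<le> C1" "0 < C2"
    "\<And>S s l z0 R. \<lbrakk>S \<in> sets N; 0 < s; 0 < l; nbhd S s \<subseteq> B z0 R;
        \<And>z r. \<lbrakk>z \<in> S; s / (3 * K * \<Lambda>) \<le> r; r \<le> s\<rbrakk>
          \<Longrightarrow> emeasure W (B z r) \<le> ennreal l * emeasure N (B z r)\<rbrakk>
      \<Longrightarrow> emeasure W (S \<inter> {z. C1 * l < v z})
          \<le> ennreal (C2 * l) * emeasure N (nbhd S s \<inter> {z. \<beta> * l < v z})"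
proof -
  \<comment> \<open>A selected ball has radius \<open>\<Lambda> * t\<close>, large enough to contain
    the superlevel portion; its covering dilate by \<open>3 * K\<close> then has exactly the radius
    \<open>L * t\<close> at which the average has dropped to \<open>l\<close>.\<close>
  define L where "L = 3 * K * \<Lambda>"
  have KL: "1 \<le> K * \<Lambda>" using mult_mono[OF K1 Lam] K1 by simp
  then have L: "1 < L" "\<Lambda> \<le> L" using K1 Lam mult_right_mono[of 1 "3 * K" \<Lambda>] by (auto simp: L_def)
  obtain C1 where C1: "1 \<le> C1" "\<And>l z0 R0 R. \<lbrakk>0 < l; 0 < R0\<rbrakk> \<Longrightarrow> AE z in N. z \<in> B z0 R \<longrightarrow> C1 * l < v z \<longrightarrow>
      (\<exists>r. 0 < r \<and> r \<le> R0 \<and> ennreal l * emeasure N (B z r) < emeasure W (B z r))"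
    using weak_lebesgue by blast
  obtain D' where D': "1 \<le> D'"
      "\<And>x r. 0 < r \<Longrightarrow> emeasure N (B x (L * r)) \<le> ennreal D' * emeasure N (B x r)"
    using doubling_factor[of L] by blast
  show thesis
  proof (rule that[of C1 "D' * A"])
    show "1 \<le> C1" "0 < D' * A" using C1 D' A by auto
    fix S s l z0 R
    assume S: "S \<in> sets N" and s: "0 < s" and l: "0 < l" and sub: "nbhd S s \<subseteq> B z0 R"
      and "\<And>z r. \<lbrakk>z \<in> S; s / (3 * K * \<Lambda>) \<le> r; r \<le> s\<rbrakk>
          \<Longrightarrow> emeasure W (B z r) \<le> ennreal l * emeasure N (B z r)"
    then have top: "\<And>z r. \<lbrakk>z \<in> S; s / L \<le> r; r \<le> s\<rbrakk>
          \<Longrightarrow> emeasure W (B z r) \<le> ennreal l * emeasure N (B z r)" by (simp add: L_def)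
    \<comment> \<open>By differentiation only a null set of
      \<open>S \<inter> {z. C1 * l < v z}\<close> is missed by \<open>T\<close>.\<close>
    define T where "T = {z \<in> S. C1 * l < v z \<and>
      (\<exists>r. 0 < r \<and> r \<le> s / L \<and> ennreal l * emeasure N (B z r) < emeasure W (B z r))}"
    have "\<forall>z\<in>T. \<exists>t. 0 < t \<and> t \<le> s / L \<and> ennreal l * emeasure N (B z t) < emeasure W (B z t) \<and>
        emeasure W (B z (L * t)) \<le> ennreal l * emeasure N (B z (L * t))"
    proof
      fix z assume "z \<in> T"
      then obtain r where r: "z \<in> S" "0 < r" "r \<le> s / L"
          "ennreal l * emeasure N (B z r) < emeasure W (B z r)" by (auto simp: T_def)
      show "\<exists>t. 0 < t \<and> t \<le> s / L \<and> ennreal l * emeasure N (B z t) < emeasure W (B z t) \<and>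
        emeasure W (B z (L * t)) \<le> ennreal l * emeasure N (B z (L * t))"
        using stopping_radius[OF r(2,3) L(1) r(4) top[OF r(1)]] by metis
    qed
    then obtain t where t: "\<And>z. z \<in> T \<Longrightarrow> 0 < t z" "\<And>z. z \<in> T \<Longrightarrow> t z \<le> s / L"
        "\<And>z. z \<in> T \<Longrightarrow> ennreal l * emeasure N (B z (t z)) < emeasure W (B z (t z))"
        "\<And>z. z \<in> T \<Longrightarrow> emeasure W (B z (L * t z)) \<le> ennreal l * emeasure N (B z (L * t z))"
      by metis
    have ts: "\<Lambda> * t z \<le> s" if "z \<in> T" for z
    proof -
      have "\<Lambda> * t z \<le> L * t z" using L t(1)[OF that] by (intro mult_right_mono) auto
      also have "\<dots> \<le> s" using t(2)[OF that] L by (simp add: field_simps)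
      finally show ?thesis .
    qed
    have bs: "B z (\<Lambda> * t z) \<subseteq> nbhd S s" if "z \<in> T" for z
      using B_mono[OF ts[OF that], of z] that by (auto simp: T_def)
    obtain G where G: "G \<subseteq> T" "countable G" "disjoint_family_on (\<lambda>g. B g (\<Lambda> * t g)) G"
        "T \<subseteq> (\<Union>g\<in>G. B g (3 * K * (\<Lambda> * t g)))"
    proof (rule vitali[of T "\<lambda>z. \<Lambda> * t z" s z0 R])
      show "0 < \<Lambda> * t a" if "a \<in> T" for a using t(1)[OF that] Lam by simp
      show "B a (\<Lambda> * t a) \<subseteq> B z0 R" if "a \<in> T" for a using bs[OF that] sub by blast
    qed (use ts in auto)
    \<comment> \<open>The portions of the disjoint balls where \<open>v\<close> exceeds
      \<open>\<beta> * l\<close> are disjoint too. Their measure bounds that of the small stopped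
      ball, hence, by doubling, the mass of the dilated one.\<close>
    define P where "P g = B g (\<Lambda> * t g) \<inter> {z. \<beta> * l < v z}" for g
    have Ps: "P g \<in> sets N" for g unfolding P_def by (intro sets.Int B_sets superlevel_sets)
    have "emeasure W (\<Union>g\<in>G. B g (L * t g)) \<le> ennreal (D' * A * l) * emeasure N (\<Union>g\<in>G. P g)"
    proof (rule emeasure_countable_cover_le)
      show "disjoint_family_on P G"
        using G(3) by (force simp: disjoint_family_on_def P_def)
      fix g assume "g \<in> G"
      then have g: "g \<in> T" using G by auto
      have "emeasure W (B g (L * t g)) \<le> ennreal l * emeasure N (B g (L * t g))"
        by (rule t(4)[OF g])
      also have "\<dots> \<le> ennreal l * (ennreal D' * emeasure N (B g (t g)))"
        by (intro mult_left_mono D' t(1) g) auto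
      also have "\<dots> \<le> ennreal l * (ennreal D' * (ennreal A * emeasure N (P g)))"
        unfolding P_def by (intro mult_left_mono weakA t(1,3) g l) auto
      also have "\<dots> = ennreal (D' * A * l) * emeasure N (P g)"
        using D' A l by (simp add: ennreal_mult mult_ac)
      finally show "emeasure W (B g (L * t g)) \<le> ennreal (D' * A * l) * emeasure N (P g)" .
    qed (use G Ps in auto)
    also have "\<dots> \<le> ennreal (D' * A * l) * emeasure N (nbhd S s \<inter> {z. \<beta> * l < v z})"
      using bs G(1) by (intro mult_left_mono emeasure_mono sets.Int nbhd_sets superlevel_sets)
        (auto simp: P_def)
    finally have 1: "emeasure W (\<Union>g\<in>G. B g (L * t g))
      \<le> ennreal (D' * A * l) * emeasure N (nbhd S s \<inter> {z. \<beta> * l < v z})" .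
    have "AE z in N. z \<in> B z0 R \<longrightarrow> C1 * l < v z \<longrightarrow>
      (\<exists>r. 0 < r \<and> r \<le> s / L \<and> ennreal l * emeasure N (B z r) < emeasure W (B z r))"
      using C1(2)[OF l, of "s / L" z0 R] s L by simp
    then have "AE z in N. z \<in> S \<inter> {z. C1 * l < v z} \<longrightarrow> z \<in> (\<Union>g\<in>G. B g (L * t g))"
    proof eventually_elim
      case (elim z)
      show ?case
      proof
        assume z: "z \<in> S \<inter> {z. C1 * l < v z}"
        then have "z \<in> B z0 R" using sub B_center[OF s, of z] by auto
        then have "z \<in> T" using elim z by (auto simp: T_def)
        then show "z \<in> (\<Union>g\<in>G. B g (L * t g))" using G(4) by (auto simp: L_def mult.assoc)
      qed
    qed
    then have "AE z in W. z \<in> S \<inter> {z. C1 * l < v z} \<longrightarrow> z \<in> (\<Union>g\<in>G. B g (L * t g))"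
      unfolding W_def by (subst AE_density) (measurable, auto)
    then have "emeasure W (S \<inter> {z. C1 * l < v z}) \<le> emeasure W (\<Union>g\<in>G. B g (L * t g))"
      using sets.countable_UN''[OF G(2), of "\<lambda>g. B g (L * t g)" N] by (intro emeasure_mono_AE) auto
    then show "emeasure W (S \<inter> {z. C1 * l < v z})
        \<le> ennreal (D' * A * l) * emeasure N (nbhd S s \<inter> {z. \<beta> * l < v z})"
      using 1 by (rule order_trans)
  qed
qed

section \<open>Truncated power integrals\<close>

definition trunc :: "real \<Rightarrow> 'a \<Rightarrow> real" where
  "trunc m z = min (max 0 (v z)) m"

lemma trunc_meas [measurable]: "trunc m \<in> borel_measurable N"
  unfolding trunc_def by measurable

text \<open>A truncated version of the integral of \<open>v powr (1 + \<kappa>)\<close> against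
  \<open>N\<close>: one factor \<open>v\<close> is hidden in \<open>W\<close> and only the power
  \<kappa> is truncated. It is finite wherever \<open>W\<close> is finite, as the absorption
  requires.\<close>

definition pmass :: "real \<Rightarrow> real \<Rightarrow> 'a set \<Rightarrow> ennreal" where
  "pmass \<kappa> m S = (\<integral>\<^sup>+z. ennreal (trunc m z powr \<kappa>) * indicator S z \<partial>W)"

text \<open>The good-lambda bounds at the levels \<open>l * 2 ^ j\<close> are added with the weights
  of the dyadic layer cake sum. Values below \<open>C1 * l\<close> give the first term; the set on
  the right is the enlarged \<open>S'\<close>.\<close>

lemma pmass_step:
  assumes C: "1 \<le> C1" "0 < C2" and k: "0 < \<kappa>" "\<kappa> \<le> 1" and l: "0 < l" and m: "0 < m"
    and S: "S \<in> sets N" and S': "S' \<in> sets N"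
    and gl: "\<And>l'. l \<le> l' \<Longrightarrow> emeasure W (S \<inter> {z. C1 * l' < v z})
          \<le> ennreal (C2 * l') * emeasure N (S' \<inter> {z. \<beta> * l' < v z})"
  shows "pmass \<kappa> m S \<le> ennreal ((C1 * l) powr \<kappa>) * emeasure W S
      + ennreal (2 * (2 powr \<kappa> - 1) * C1 * C2 / \<beta>\<^sup>2) * pmass \<kappa> m S'"
proof -
  define c where "c = C1 * l"
  have c: "0 < c" using C l by (simp add: c_def)
  obtain n where n: "m / c < 2 ^ n" using real_arch_pow[of 2 "m / c"] by auto
  define b where "b j = (2 powr \<kappa> - 1) * (c * 2 ^ j) powr \<kappa>" for j :: nat
  have p2: "0 \<le> 2 powr \<kappa> - 1" using k ge_one_powr_ge_zero[of 2 \<kappa>] by simp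
  have b0: "0 \<le> b j" for j unfolding b_def using p2 by (intro mult_nonneg_nonneg) auto
  have t0: "0 \<le> trunc m z" and tm: "trunc m z \<le> m" for z using m by (auto simp: trunc_def)
  define E where "E j = S \<inter> {z. c * 2 ^ j < trunc m z}" for j :: nat
  \<comment> \<open>The level sets on the right are also written with \<open>trunc m\<close>, so
    that their sum is again bounded by a truncated integral.\<close>
  define F where "F j = S' \<inter> {z. l * 2 ^ j < trunc m z / \<beta>}" for j :: nat
  have "{z \<in> space N. c * 2 ^ j < trunc m z} \<in> sets N" for j :: nat by measurable
  then have Es [measurable]: "E j \<in> sets N" for j using S by (auto simp: E_def)
  have "{z \<in> space N. l * 2 ^ j < trunc m z / \<beta>} \<in> sets N" for j :: nat by measurable
  then have Fs [measurable]: "F j \<in> sets N" for j using S' by (auto simp: F_def)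
  have EF: "emeasure W (E j) \<le> ennreal (C2 * (l * 2 ^ j)) * emeasure N (F j)" for j
  \<comment> \<open>As \<open>\<beta> \<le> 1 \<le> C1\<close>, in this case
    \<open>\<beta> * (l * 2 ^ j)\<close> is below \<open>m\<close> as well, and truncation does not
    change that level set. In the other case \<open>E j\<close> is empty.\<close>
  proof (cases "c * 2 ^ j < m")
    case True
    have l2: "l \<le> l * 2 ^ j" using l mult_left_mono[of 1 "2 ^ j" l] by simp
    have "E j \<subseteq> S \<inter> {z. C1 * (l * 2 ^ j) < v z}"
    proof
      fix z assume z: "z \<in> E j"
      then have "c * 2 ^ j < max 0 (v z)" by (simp add: E_def trunc_def)
      moreover have "0 < c * 2 ^ j" using c by simp
      ultimately have "c * 2 ^ j < v z" by (simp only: less_max_iff_disj) linarith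
      then show "z \<in> S \<inter> {z. C1 * (l * 2 ^ j) < v z}" using z by (simp add: E_def c_def mult.assoc)
    qed
    then have "emeasure W (E j) \<le> emeasure W (S \<inter> {z. C1 * (l * 2 ^ j) < v z})"
      using S superlevel_sets by (intro emeasure_mono) auto
    also have "\<dots> \<le> ennreal (C2 * (l * 2 ^ j)) * emeasure N (S' \<inter> {z. \<beta> * (l * 2 ^ j) < v z})"
      by (rule gl[OF l2])
    also have "\<dots> \<le> ennreal (C2 * (l * 2 ^ j)) * emeasure N (F j)"
    proof (intro mult_left_mono emeasure_mono Fs)
      have "\<beta> * (l * 2 ^ j) \<le> 1 * (l * 2 ^ j)" using beta l by (intro mult_right_mono) auto
      also have "\<dots> \<le> C1 * (l * 2 ^ j)" using C l by (intro mult_right_mono) auto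
      also have "\<dots> < m" using True by (simp add: c_def mult.assoc)
      finally have "\<beta> * (l * 2 ^ j) < m" .
      then show "S' \<inter> {z. \<beta> * (l * 2 ^ j) < v z} \<subseteq> F j"
        using beta by (auto simp: F_def trunc_def field_simps)
    qed simp
    finally show ?thesis .
  next
    case False
    then have "\<not> c * 2 ^ j < trunc m z" for z using tm[of z] by linarith
    then have "E j = {}" by (auto simp: E_def)
    then show ?thesis by simp
  qed
  have pw: "ennreal (trunc m z powr \<kappa>) * indicator S z
      \<le> ennreal (c powr \<kappa>) * indicator S z + (\<Sum>j<n. ennreal (b j) * indicator (E j) z)" for z
  proof (cases "z \<in> S")
    case True
    have "trunc m z \<le> c * 2 ^ n" using tm[of z] n c by (simp add: field_simps)
    then have "trunc m z powr \<kappa> \<le> c powr \<kappa> + (\<Sum>j<n. b j * of_bool (c * 2 ^ j < trunc m z))"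
      using powr_le_dyadic_sum[OF t0 c k(1)] by (simp add: b_def)
    then have "ennreal (trunc m z powr \<kappa>)
        \<le> ennreal (c powr \<kappa> + (\<Sum>j<n. b j * of_bool (c * 2 ^ j < trunc m z)))"
      by (rule ennreal_leI)
    also have "\<dots> = ennreal (c powr \<kappa>) + (\<Sum>j<n. ennreal (b j * of_bool (c * 2 ^ j < trunc m z)))"
      using b0 by (simp add: ennreal_plus sum_nonneg)
    also have "(\<Sum>j<n. ennreal (b j * of_bool (c * 2 ^ j < trunc m z)))
        = (\<Sum>j<n. ennreal (b j) * indicator (E j) z)"
      using True by (intro sum.cong) (auto simp: E_def)
    finally show ?thesis using True by simp
  qed simp
  have "pmass \<kappa> m S \<le> (\<integral>\<^sup>+z. ennreal (c powr \<kappa>) * indicator S z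
      + (\<Sum>j<n. ennreal (b j) * indicator (E j) z) \<partial>W)"
    unfolding pmass_def by (intro nn_integral_mono pw)
  also have "\<dots> = (\<integral>\<^sup>+z. ennreal (c powr \<kappa>) * indicator S z \<partial>W)
      + (\<integral>\<^sup>+z. (\<Sum>j<n. ennreal (b j) * indicator (E j) z) \<partial>W)"
    using S Es by (intro nn_integral_add borel_measurable_sum borel_measurable_times
        borel_measurable_indicator borel_measurable_const) auto
  also have "\<dots> = ennreal (c powr \<kappa>) * emeasure W S + (\<Sum>j<n. ennreal (b j) * emeasure W (E j))"
    using S Es by (subst nn_integral_sum) (auto simp: nn_integral_cmult_indicator
        intro!: borel_measurable_times borel_measurable_indicator)
  finally have 1: "pmass \<kappa> m S
      \<le> ennreal (c powr \<kappa>) * emeasure W S + (\<Sum>j<n. ennreal (b j) * emeasure W (E j))" .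
  define q where "q = (2 powr \<kappa> - 1) * C1 powr \<kappa> * C2"
  have q0: "0 \<le> q" unfolding q_def using p2 C by (intro mult_nonneg_nonneg) auto
  \<comment> \<open>The layer weight contributes the power \<kappa> of the level and the good-lambda
    bound one more power; summing in \<open>j\<close> gives the power \<open>1 + \<kappa>\<close> of
    the truncated function, one factor of which is bounded by \<open>v\<close>.\<close>
  have bq: "b j * (C2 * (l * 2 ^ j)) = q * (l * 2 ^ j) powr (1 + \<kappa>)" for j
    using l C by (simp add: b_def q_def c_def powr_add powr_mult mult_ac)
  have "(\<Sum>j<n. ennreal (b j) * emeasure W (E j))
      \<le> (\<Sum>j<n. ennreal (b j) * (ennreal (C2 * (l * 2 ^ j)) * emeasure N (F j)))"
    by (intro sum_mono mult_left_mono EF) auto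
  also have "\<dots> = (\<Sum>j<n. ennreal (q * (l * 2 ^ j) powr (1 + \<kappa>)) * emeasure N (F j))"
    using b0 C l by (intro sum.cong) (auto simp: bq[symmetric] ennreal_mult mult.assoc)
  also have "\<dots> = (\<integral>\<^sup>+z. (\<Sum>j<n. ennreal (q * (l * 2 ^ j) powr (1 + \<kappa>)) * indicator (F j) z) \<partial>N)"
    using Fs by (subst nn_integral_sum) (auto simp: nn_integral_cmult_indicator
        intro!: borel_measurable_times borel_measurable_indicator)
  also have "\<dots> \<le> (\<integral>\<^sup>+z. ennreal (v z) *
      (ennreal (2 * q / \<beta>\<^sup>2) * (ennreal (trunc m z powr \<kappa>) * indicator S' z)) \<partial>N)"
  proof (intro nn_integral_mono)
    fix z
    show "(\<Sum>j<n. ennreal (q * (l * 2 ^ j) powr (1 + \<kappa>)) * indicator (F j) z)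
      \<le> ennreal (v z) * (ennreal (2 * q / \<beta>\<^sup>2) * (ennreal (trunc m z powr \<kappa>) * indicator S' z))"
    proof (cases "z \<in> S'")
      case True
      let ?x = "trunc m z / \<beta>"
      have x0: "0 \<le> ?x" using t0 beta by simp
      have "(\<Sum>j<n. ennreal (q * (l * 2 ^ j) powr (1 + \<kappa>)) * indicator (F j) z)
        = (\<Sum>j<n. ennreal (q * ((l * 2 ^ j) powr (1 + \<kappa>) * of_bool (l * 2 ^ j < ?x))))"
        using True by (intro sum.cong) (auto simp: F_def)
      also have "\<dots> = ennreal (q * (\<Sum>j<n. (l * 2 ^ j) powr (1 + \<kappa>) * of_bool (l * 2 ^ j < ?x)))"
        unfolding sum_distrib_left using q0 by (intro sum_ennreal mult_nonneg_nonneg) auto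
      also have "\<dots> \<le> ennreal (q * (2 * ?x powr (1 + \<kappa>)))"
        using q0 k by (intro ennreal_leI mult_left_mono dyadic_sum_le_powr x0 l) auto
      also have "\<dots> \<le> ennreal (max 0 (v z) * (2 * q / \<beta>\<^sup>2 * trunc m z powr \<kappa>))"
      proof (rule ennreal_leI)
        \<comment> \<open>Here \<open>\<kappa> \<le> 1\<close> is used, as for
          \<open>C1 powr \<kappa> \<le> C1\<close> below: apart from
          \<open>2 powr \<kappa> - 1\<close> the factor must not depend on \<kappa>.\<close>
        have "\<beta> powr 2 \<le> \<beta> powr (1 + \<kappa>)" using beta k by (intro powr_mono') auto
        then have bb: "\<beta>\<^sup>2 \<le> \<beta> powr (1 + \<kappa>)" using beta by simp
        have "?x powr (1 + \<kappa>) = trunc m z powr (1 + \<kappa>) / \<beta> powr (1 + \<kappa>)"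
          using t0 beta by (simp add: powr_divide)
        also have "\<dots> \<le> trunc m z powr (1 + \<kappa>) / \<beta>\<^sup>2"
          using bb beta by (intro divide_left_mono) auto
        also have "trunc m z powr (1 + \<kappa>) = trunc m z * trunc m z powr \<kappa>"
          using t0[of z] by (cases "trunc m z = 0") (auto simp: powr_add)
        also have "\<dots> / \<beta>\<^sup>2 \<le> max 0 (v z) * trunc m z powr \<kappa> / \<beta>\<^sup>2"
          by (intro divide_right_mono mult_right_mono) (auto simp: trunc_def)
        finally have "q * (2 * ?x powr (1 + \<kappa>)) \<le> q * (2 * (max 0 (v z) * trunc m z powr \<kappa> / \<beta>\<^sup>2))"
          using q0 by (intro mult_left_mono) auto
        then show "q * (2 * ?x powr (1 + \<kappa>)) \<le> max 0 (v z) * (2 * q / \<beta>\<^sup>2 * trunc m z powr \<kappa>)"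
          by (simp add: field_simps)
      qed
      also have "\<dots> = ennreal (v z) * (ennreal (2 * q / \<beta>\<^sup>2) * ennreal (trunc m z powr \<kappa>))"
      proof -
        have "0 \<le> 2 * q / \<beta>\<^sup>2" using q0 by simp
        then show ?thesis
          by (simp only: ennreal_mult max.cobounded1 mult_nonneg_nonneg powr_ge_zero ennreal_max_0)
      qed
      finally show ?thesis using True by simp
    next
      case False
      then have "z \<notin> F j" for j by (simp add: F_def)
      then show ?thesis by simp
    qed
  qed
  also have "\<dots> = (\<integral>\<^sup>+z. ennreal (2 * q / \<beta>\<^sup>2) * (ennreal (trunc m z powr \<kappa>) * indicator S' z) \<partial>W)"
    using S' unfolding W_def by (subst nn_integral_density) auto
  also have "\<dots> = ennreal (2 * q / \<beta>\<^sup>2) * pmass \<kappa> m S'"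
    unfolding pmass_def using S'
    by (intro nn_integral_cmult borel_measurable_times borel_measurable_indicator) auto
  also have "\<dots> \<le> ennreal (2 * (2 powr \<kappa> - 1) * C1 * C2 / \<beta>\<^sup>2) * pmass \<kappa> m S'"
  proof (intro mult_right_mono ennreal_leI divide_right_mono)
    have "C1 powr \<kappa> \<le> C1 powr 1" using C k by (intro powr_mono) auto
    then have "(2 powr \<kappa> - 1) * C1 powr \<kappa> * C2 \<le> (2 powr \<kappa> - 1) * C1 * C2"
      using C p2 by (intro mult_right_mono mult_left_mono) auto
    then show "2 * q \<le> 2 * (2 powr \<kappa> - 1) * C1 * C2" unfolding q_def by linarith
  qed auto
  finally show ?thesis using 1 by (auto simp: c_def intro: order_trans add_left_mono)
qed


lemma W_pos: "0 < r \<Longrightarrow> 0 < emeasure W (B x r)"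
proof (rule ccontr)
  assume r: "0 < r" and "\<not> 0 < emeasure W (B x r)"
  then have "(\<integral>\<^sup>+z. ennreal (v z) * indicator (B x r) z \<partial>N) = 0"
    by (simp add: W_def emeasure_density)
  then have "AE z in N. ennreal (v z) * indicator (B x r) z = 0"
    by (subst (asm) nn_integral_0_iff_AE) auto
  then have "AE z in N. z \<notin> B x r"
    using v_pos by eventually_elim (auto simp: indicator_def)
  then have "emeasure N (B x r) = 0"
    by (subst (asm) AE_iff_measurable[OF B_sets]) auto
  then show False using B_pos[OF r, of x] by simp
qed

lemma pmass_le:
  assumes "S \<in> sets N" "S \<subseteq> T" "T \<in> sets N" "0 < m" "0 < \<kappa>"
  shows "pmass \<kappa> m S \<le> ennreal (m powr \<kappa>) * emeasure W T"
proof -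
  have "pmass \<kappa> m S \<le> (\<integral>\<^sup>+z. ennreal (m powr \<kappa>) * indicator T z \<partial>W)"
    unfolding pmass_def using assms
    by (intro nn_integral_mono) (auto simp: indicator_def trunc_def intro!: ennreal_leI powr_mono2)
  then show ?thesis using assms by (simp add: nn_integral_cmult_indicator)
qed

text \<open>Monotone convergence along the truncation levels \<open>Suc i\<close>, which are
  positive as \<open>bd\<close> demands.\<close>

lemma pmass_unbounded:
  assumes S: "S \<in> sets N" and k: "0 < \<kappa>" and bd: "\<And>m. 0 < m \<Longrightarrow> pmass \<kappa> m S \<le> c"
  shows "(\<integral>\<^sup>+z\<in>S. ennreal (v z powr (1 + \<kappa>)) \<partial>N) \<le> c"
proof -
  have "(\<integral>\<^sup>+z\<in>S. ennreal (v z powr (1 + \<kappa>)) \<partial>N)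
      = (\<integral>\<^sup>+z. ennreal (v z) * (ennreal (max 0 (v z) powr \<kappa>) * indicator S z) \<partial>N)"
  proof (rule nn_integral_cong_AE)
    show "AE z in N. ennreal (v z powr (1 + \<kappa>)) * indicator S z
        = ennreal (v z) * (ennreal (max 0 (v z) powr \<kappa>) * indicator S z)"
      using v_pos
      by eventually_elim (auto simp: powr_add ennreal_mult mult.assoc)
  qed
  also have "\<dots> = (\<integral>\<^sup>+z. ennreal (max 0 (v z) powr \<kappa>) * indicator S z \<partial>W)"
    unfolding W_def using S by (subst nn_integral_density) auto
  also have "\<dots> \<le> (\<integral>\<^sup>+z. (SUP i. ennreal (trunc (real (Suc i)) z powr \<kappa>) * indicator S z) \<partial>W)"
  proof (intro nn_integral_mono)
    fix z
    obtain i where "max 0 (v z) \<le> real i" using real_arch_simple by blast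
    then have "trunc (real (Suc i)) z = max 0 (v z)" by (simp add: trunc_def)
    then show "ennreal (max 0 (v z) powr \<kappa>) * indicator S z
        \<le> (SUP i. ennreal (trunc (real (Suc i)) z powr \<kappa>) * indicator S z)"
      by (intro SUP_upper2[of i]) auto
  qed
  also have "\<dots> = (SUP i. \<integral>\<^sup>+z. ennreal (trunc (real (Suc i)) z powr \<kappa>) * indicator S z \<partial>W)"
  proof (rule nn_integral_monotone_convergence_SUP)
    show "incseq (\<lambda>i z. ennreal (trunc (real (Suc i)) z powr \<kappa>) * indicator S z)"
      using k by (auto simp: incseq_def le_fun_def trunc_def intro!: mult_right_mono ennreal_leI powr_mono2)
    show "(\<lambda>z. ennreal (trunc (real (Suc i)) z powr \<kappa>) * indicator S z) \<in> borel_measurable W" for i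
      using S by measurable
  qed
  also have "\<dots> \<le> c"
    using bd by (intro SUP_least) (auto simp: pmass_def)
  finally show ?thesis .
qed

theorem local_reverse_holder:
  obtains \<kappa>0 L where "0 < \<kappa>0" "1 \<le> L"
    "\<And>\<kappa>. \<lbrakk>0 < \<kappa>; \<kappa> \<le> \<kappa>0\<rbrakk> \<Longrightarrow> \<exists>C>0. \<forall>z R. 0 < R \<longrightarrow>
      (\<integral>\<^sup>+w\<in>B z R. ennreal (v w powr (1 + \<kappa>)) \<partial>N)
      \<le> ennreal (C * (measure W (B z (L * R)) / measure N (B z (L * R))) powr (1 + \<kappa>))
        * emeasure N (B z (L * R))"
proof -
  obtain C1 C2 where C: "1 \<le> C1" "0 < C2" and gl:
    "\<And>S s l z0 R. \<lbrakk>S \<in> sets N; 0 < s; 0 < l; nbhd S s \<subseteq> B z0 R;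
        \<And>z r. \<lbrakk>z \<in> S; s / (3 * K * \<Lambda>) \<le> r; r \<le> s\<rbrakk>
          \<Longrightarrow> emeasure W (B z r) \<le> ennreal l * emeasure N (B z r)\<rbrakk>
      \<Longrightarrow> emeasure W (S \<inter> {z. C1 * l < v z})
          \<le> ennreal (C2 * l) * emeasure N (nbhd S s \<inter> {z. \<beta> * l < v z})"
    using good_lambda by blast
  obtain n0 where n0: "2 * K < 2 ^ n0" using real_arch_pow[of 2 "2 * K"] by auto
  \<comment> \<open>The widths are \<open>R * \<tau> ^ j\<close>. With
    \<open>2 * K * \<tau> \<le> 1\<close> the neighbourhoods still to come stay within distance
    \<open>2 * K * s\<close> of the current set, despite the quasi-triangle constant; a power of 2
    makes \<open>G\<close> the doubling cost of one step.\<close>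
  define \<tau> :: real where "\<tau> = 1 / 2 ^ n0"
  have tau: "0 < \<tau>" "2 * K * \<tau> \<le> 1" using n0 by (auto simp: \<tau>_def field_simps)
  define G where "G = D ^ n0"
  have G: "1 \<le> G" using D1 by (simp add: G_def)
  \<comment> \<open>Chosen so that the \<open>2 * K * R\<close>-neighbourhood of a ball of radius
    \<open>R\<close> lies in the concentric ball of radius \<open>L * R\<close>.\<close>
  define L where "L = K * (1 + 2 * K)"
  have L: "1 \<le> L" using mult_mono[of 1 K 1 "1 + 2 * K"] K1 by (simp add: L_def)
  have KL: "1 \<le> K * \<Lambda>" using mult_mono[OF K1 Lam] K1 by simp
  obtain C3 where C3: "1 \<le> C3" "\<And>x r. 0 < r \<Longrightarrow>
      emeasure N (B x ((2 * K * L * (3 * K * \<Lambda>)) * r)) \<le> ennreal C3 * emeasure N (B x r)"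
    using doubling_factor by blast
  \<comment> \<open>Exactly what turns \<open>2 powr \<kappa> - 1 \<le> \<eta>\<close> into
    \<open>2 * \<theta> * G \<le> 1\<close>, with \<theta> the absorption factor of
    \<open>pmass_step\<close>.\<close>
  define \<eta> where "\<eta> = \<beta>\<^sup>2 / (4 * C1 * C2 * G)"
  have eta: "0 < \<eta>" using beta C G by (simp add: \<eta>_def)
  define \<kappa>0 where "\<kappa>0 = min 1 (log 2 (1 + \<eta>))"
  have k0: "0 < \<kappa>0" using eta by (simp add: \<kappa>0_def)
  show thesis
  proof (rule that[OF k0 L])
    fix \<kappa> assume k: "0 < \<kappa>" "\<kappa> \<le> \<kappa>0"
    have k1: "\<kappa> \<le> 1" using k by (simp add: \<kappa>0_def)
    define \<theta> where "\<theta> = 2 * (2 powr \<kappa> - 1) * C1 * C2 / \<beta>\<^sup>2"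
    have p2: "0 \<le> 2 powr \<kappa> - 1" using k ge_one_powr_ge_zero[of 2 \<kappa>] by simp
    have th0: "0 \<le> \<theta>" unfolding \<theta>_def using p2 C by (intro divide_nonneg_nonneg mult_nonneg_nonneg) auto
    have th: "2 * \<theta> * G \<le> 1"
    proof -
      have "2 powr \<kappa> \<le> 2 powr (log 2 (1 + \<eta>))" using k by (intro powr_mono) (auto simp: \<kappa>0_def)
      also have "\<dots> = 1 + \<eta>" using eta by (subst powr_log_cancel) auto
      finally have "2 powr \<kappa> - 1 \<le> \<eta>" by simp
      then have "4 * C1 * C2 * G / \<beta>\<^sup>2 * (2 powr \<kappa> - 1) \<le> 4 * C1 * C2 * G / \<beta>\<^sup>2 * \<eta>"
        using C G by (intro mult_left_mono) auto
      also have "\<dots> = 1" using C G beta by (simp add: \<eta>_def)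
      finally show ?thesis by (simp add: \<theta>_def field_simps)
    qed
    have "2 * \<theta> \<le> 2 * \<theta> * G" using th0 G mult_left_mono[of 1 G "2 * \<theta>"] by simp
    then have th1: "\<theta> < 1" using th th0 by linarith
    define Cf where "Cf = 2 * (C1 * C3) powr \<kappa>"
    have Cf: "0 < Cf" using C C3 by (simp add: Cf_def)
    show "\<exists>C>0. \<forall>z R. 0 < R \<longrightarrow>
      (\<integral>\<^sup>+w\<in>B z R. ennreal (v w powr (1 + \<kappa>)) \<partial>N)
      \<le> ennreal (C * (measure W (B z (L * R)) / measure N (B z (L * R))) powr (1 + \<kappa>))
        * emeasure N (B z (L * R))"
    proof (intro exI[of _ Cf] conjI Cf allI impI)
      fix z0 and R :: real assume R: "0 < R"
      define Q where "Q = B z0 (L * R)"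
      have LR: "0 < L * R" using L R by simp
      have Qs [measurable]: "Q \<in> sets N" by (simp add: Q_def)
      define \<omega> where "\<omega> = measure W Q"
      define \<nu> where "\<nu> = measure N Q"
      have w: "emeasure W Q = ennreal \<omega>" "0 < \<omega>"
        using W_fin[OF LR, of z0] W_pos[OF LR, of z0]
        by (auto simp: Q_def \<omega>_def measure_def enn2real_positive_iff)
      have nu: "emeasure N Q = ennreal \<nu>" "0 < \<nu>"
        using B_fin[OF LR, of z0] B_pos[OF LR, of z0]
        by (auto simp: Q_def \<nu>_def measure_def enn2real_positive_iff)
      define a where "a = \<omega> / \<nu>"
      have a: "0 < a" using w nu by (simp add: a_def)
      define Am where "Am = (C1 * C3 * a) powr \<kappa> * \<omega>"
      have Am: "0 \<le> Am" using w by (simp add: Am_def)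
      have step: "pmass \<kappa> m S \<le> ennreal (Am * G ^ j) + ennreal \<theta> * pmass \<kappa> m (nbhd S (R * \<tau> ^ j))"
        if m: "0 < m" and S: "S \<in> sets N" and sub: "nbhd S (R * \<tau> ^ j) \<subseteq> Q" for m S j
      proof -
        define s where "s = R * \<tau> ^ j"
        have s: "0 < s" using R tau by (simp add: s_def)
        have SQ: "S \<subseteq> Q" using sub B_center[OF s] unfolding s_def by blast
        \<comment> \<open>A ball centred in \<open>S\<close> with radius between
          \<open>s / (3 * K * \<Lambda>)\<close> and \<open>s\<close> has measure at least that of
          \<open>Q\<close> divided by \<open>C3 * G ^ j\<close>, and its mass is at most that of
          \<open>Q\<close>; so \<open>l\<close> bounds its average.\<close>
        define l where "l = C3 * G ^ j * a"
        have l: "0 < l" using C3 G a by (simp add: l_def)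
        have Rs: "R = 2 ^ (n0 * j) * s" by (simp add: s_def \<tau>_def power_mult power_divide)
        have avg: "emeasure W (B z r) \<le> ennreal l * emeasure N (B z r)"
          if z: "z \<in> S" and r: "s / (3 * K * \<Lambda>) \<le> r" "r \<le> s" for z r
        proof -
          have r0: "0 < r" using r(1) s KL by (auto intro: less_le_trans[rotated])
          have "s \<le> 3 * K * \<Lambda> * r"
            using r(1) KL by (simp add: field_simps)
          then have "R \<le> 2 ^ (n0 * j) * (3 * K * \<Lambda> * r)"
            unfolding Rs by (intro mult_left_mono) auto
          then have "2 * K * L * R \<le> 2 * K * L * (2 ^ (n0 * j) * (3 * K * \<Lambda> * r))"
            using K1 L by (intro mult_left_mono) auto
          also have "\<dots> = 2 ^ (n0 * j) * ((2 * K * L * (3 * K * \<Lambda>)) * r)" by simp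
          finally have 1: "2 * K * L * R \<le> 2 ^ (n0 * j) * ((2 * K * L * (3 * K * \<Lambda>)) * r)" .
          have "d z z0 < L * R" using z SQ d_sym[of z z0] by (auto simp: Q_def qball_def)
          then have "K * (d z z0 + L * R) \<le> K * (2 * (L * R))" using K1 by (intro mult_left_mono) auto
          also have "\<dots> = 2 * K * L * R" by simp
          finally have "K * (d z z0 + L * R) \<le> 2 ^ (n0 * j) * ((2 * K * L * (3 * K * \<Lambda>)) * r)"
            using 1 by (rule order_trans)
          then have "Q \<subseteq> B z (2 ^ (n0 * j) * ((2 * K * L * (3 * K * \<Lambda>)) * r))"
            unfolding Q_def by (rule B_subset)
          then have "emeasure N Q \<le> emeasure N (B z (2 ^ (n0 * j) * ((2 * K * L * (3 * K * \<Lambda>)) * r)))"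
            by (intro emeasure_mono) auto
          also have "\<dots> \<le> ennreal (D ^ (n0 * j)) * emeasure N (B z ((2 * K * L * (3 * K * \<Lambda>)) * r))"
            using r0 K1 L Lam by (intro doubling_pow) auto
          also have "\<dots> \<le> ennreal (D ^ (n0 * j)) * (ennreal C3 * emeasure N (B z r))"
            by (intro mult_left_mono C3 r0) auto
          also have "\<dots> = ennreal (C3 * G ^ j) * emeasure N (B z r)"
            using C3(1) D1 by (simp only: G_def power_mult[symmetric]) (simp add: ennreal_mult mult_ac)
          finally have NQ: "emeasure N Q \<le> ennreal (C3 * G ^ j) * emeasure N (B z r)" .
          have "B z r \<subseteq> Q" using B_mono[OF r(2), of z] z sub unfolding s_def by blast
          then have "emeasure W (B z r) \<le> emeasure W Q" by (intro emeasure_mono) auto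
          also have "\<dots> = ennreal a * emeasure N Q"
            using w nu a by (simp add: a_def ennreal_mult[symmetric])
          also have "\<dots> \<le> ennreal a * (ennreal (C3 * G ^ j) * emeasure N (B z r))"
            by (intro mult_left_mono NQ) auto
          also have "\<dots> = ennreal l * emeasure N (B z r)"
            using a C3 G by (simp add: l_def ennreal_mult mult_ac)
          finally show ?thesis .
        qed
        have "pmass \<kappa> m S \<le> ennreal ((C1 * l) powr \<kappa>) * emeasure W S + ennreal \<theta> * pmass \<kappa> m (nbhd S s)"
          unfolding \<theta>_def
        proof (rule pmass_step[OF C k(1) k1 l m S nbhd_sets])
          fix l' assume l': "l \<le> l'"
          show "emeasure W (S \<inter> {z. C1 * l' < v z})
              \<le> ennreal (C2 * l') * emeasure N (nbhd S s \<inter> {z. \<beta> * l' < v z})"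
          proof (rule gl[OF S s])
            show "0 < l'" using l l' by simp
            show "nbhd S s \<subseteq> B z0 (L * R)" using sub by (simp add: s_def Q_def)
            show "emeasure W (B z r) \<le> ennreal l' * emeasure N (B z r)"
              if "z \<in> S" "s / (3 * K * \<Lambda>) \<le> r" "r \<le> s" for z r
              by (rule order_trans[OF avg[OF that]]) (intro mult_right_mono ennreal_leI l', simp)
          qed
        qed
        also have "ennreal ((C1 * l) powr \<kappa>) * emeasure W S \<le> ennreal (Am * G ^ j)"
        proof -
          have "(C1 * l) powr \<kappa> = (C1 * C3 * a) powr \<kappa> * (G ^ j) powr \<kappa>"
            using C C3 a G by (simp add: l_def powr_mult mult_ac)
          also have "\<dots> \<le> (C1 * C3 * a) powr \<kappa> * (G ^ j) powr 1"
            using G k1 by (intro mult_left_mono powr_mono) auto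
          finally have 1: "(C1 * l) powr \<kappa> \<le> (C1 * C3 * a) powr \<kappa> * G ^ j" using G by simp
          have "ennreal ((C1 * l) powr \<kappa>) * emeasure W S
              \<le> ennreal ((C1 * C3 * a) powr \<kappa> * G ^ j) * ennreal \<omega>"
            unfolding w(1)[symmetric] using SQ by (intro mult_mono ennreal_leI 1 emeasure_mono) auto
          also have "\<dots> = ennreal (Am * G ^ j)"
            using G w by (simp add: Am_def ennreal_mult[symmetric] mult_ac)
          finally show ?thesis .
        qed
        finally show ?thesis by (simp add: s_def)
      qed
      \<comment> \<open>\<open>i\<close> counts the steps still to be made and \<open>j\<close> the
        current width, so \<open>S\<close> and \<open>j\<close> vary in the induction. The crude
        bound by \<open>m powr \<kappa>\<close> is used only after \<open>i\<close> steps, with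
        factor \<open>\<theta> ^ i\<close>; since \<open>\<theta> * G \<le> 1 / 2\<close>, the other
        terms add up to at most twice the current one.\<close>
      have main: "pmass \<kappa> m S \<le> ennreal (\<theta> ^ i * (m powr \<kappa> * \<omega>) + 2 * Am * G ^ j)"
        if m: "0 < m" and "S \<in> sets N" "nbhd S (2 * K * (R * \<tau> ^ j)) \<subseteq> Q" for m S i j
        using that(2,3)
      proof (induction i arbitrary: S j)
        case 0
        have "0 < 2 * K * (R * \<tau> ^ j)" using K1 R tau by simp
        then have "S \<subseteq> Q" using 0(2) B_center by blast
        then have "pmass \<kappa> m S \<le> ennreal (m powr \<kappa>) * emeasure W Q"
          using pmass_le[OF 0(1) _ Qs m k(1)] by simp
        also have "\<dots> = ennreal (m powr \<kappa> * \<omega>)" using w by (simp add: ennreal_mult)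
        also have "\<dots> \<le> ennreal (\<theta> ^ 0 * (m powr \<kappa> * \<omega>) + 2 * Am * G ^ j)"
          using Am G by (intro ennreal_leI) simp
        finally show ?case .
      next
        case (Suc i)
        define s where "s = R * \<tau> ^ j"
        have s: "0 < s" using R tau by (simp add: s_def)
        have "s \<le> 2 * K * s" using s K1 by simp
        then have "nbhd S s \<subseteq> nbhd S (2 * K * s)" by (intro UN_mono B_mono) auto
        then have sub1: "nbhd S s \<subseteq> Q" using Suc(3) by (simp add: s_def)
        have sub2: "nbhd (nbhd S s) (2 * K * (R * \<tau> ^ Suc j)) \<subseteq> Q"
        proof -
          have "B w (2 * K * (s * \<tau>)) \<subseteq> B z (2 * K * s)" if "w \<in> B z s" for z w
          proof (rule B_subset)
            have "d z w < s" using that by (simp add: qball_def)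
            moreover have "2 * K * \<tau> * s \<le> 1 * s" using tau s by (intro mult_right_mono) auto
            ultimately have "d z w + 2 * K * (s * \<tau>) \<le> 2 * s" by (simp add: mult_ac)
            then have "K * (d z w + 2 * K * (s * \<tau>)) \<le> K * (2 * s)" using K1 by (intro mult_left_mono) auto
            then show "K * (d z w + 2 * K * (s * \<tau>)) \<le> 2 * K * s" by simp
          qed
          then have "nbhd (nbhd S s) (2 * K * (s * \<tau>)) \<subseteq> nbhd S (2 * K * s)" by blast
          then show ?thesis using Suc(3) by (simp add: s_def mult_ac)
        qed
        have "pmass \<kappa> m S \<le> ennreal (Am * G ^ j) + ennreal \<theta> * pmass \<kappa> m (nbhd S s)"
          using step[OF m Suc(2), of j] sub1 by (simp add: s_def)
        also have "\<dots> \<le> ennreal (Am * G ^ j)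
            + ennreal \<theta> * ennreal (\<theta> ^ i * (m powr \<kappa> * \<omega>) + 2 * Am * G ^ Suc j)"
          by (intro add_left_mono mult_left_mono Suc.IH sub2) auto
        also have "\<dots> = ennreal (Am * G ^ j + \<theta> * (\<theta> ^ i * (m powr \<kappa> * \<omega>) + 2 * Am * G ^ Suc j))"
          using Am G th0 w by (simp add: ennreal_mult[symmetric] ennreal_plus[symmetric] del: ennreal_plus)
        also have "\<dots> \<le> ennreal (\<theta> ^ Suc i * (m powr \<kappa> * \<omega>) + 2 * Am * G ^ j)"
        proof (rule ennreal_leI)
          have "2 * \<theta> * G * (Am * G ^ j) \<le> 1 * (Am * G ^ j)"
            using th Am G by (intro mult_right_mono) auto
          then show "Am * G ^ j + \<theta> * (\<theta> ^ i * (m powr \<kappa> * \<omega>) + 2 * Am * G ^ Suc j)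
              \<le> \<theta> ^ Suc i * (m powr \<kappa> * \<omega>) + 2 * Am * G ^ j"
            by (simp add: algebra_simps)
        qed
        finally show ?case .
      qed
      have sub0: "nbhd (B z0 R) (2 * K * (R * \<tau> ^ 0)) \<subseteq> Q"
      proof -
        have "B w (2 * K * R) \<subseteq> Q" if "w \<in> B z0 R" for w
          unfolding Q_def
        proof (rule B_subset)
          have "d z0 w + 2 * K * R \<le> R + 2 * K * R" using that by (simp add: qball_def)
          then have "K * (d z0 w + 2 * K * R) \<le> K * (R + 2 * K * R)" using K1 by (intro mult_left_mono) auto
          then show "K * (d z0 w + 2 * K * R) \<le> L * R" by (simp add: L_def algebra_simps)
        qed
        then show ?thesis by auto
      qed
      \<comment> \<open>Letting \<open>i\<close> tend to infinity removes the dependence on the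
        truncation level \<open>m\<close>.\<close>
      have "pmass \<kappa> m (B z0 R) \<le> ennreal (2 * Am)" if m: "0 < m" for m
      proof (rule LIMSEQ_le_const)
        have "(\<lambda>i. \<theta> ^ i * (m powr \<kappa> * \<omega>) + 2 * Am * G ^ 0) \<longlonglongrightarrow> 0 * (m powr \<kappa> * \<omega>) + 2 * Am * G ^ 0"
          using th0 th1 by (intro tendsto_intros LIMSEQ_realpow_zero)
        then show "(\<lambda>i. ennreal (\<theta> ^ i * (m powr \<kappa> * \<omega>) + 2 * Am * G ^ 0)) \<longlonglongrightarrow> ennreal (2 * Am)"
          by (intro tendsto_ennrealI) simp
        show "\<exists>n. \<forall>i\<ge>n. pmass \<kappa> m (B z0 R) \<le> ennreal (\<theta> ^ i * (m powr \<kappa> * \<omega>) + 2 * Am * G ^ 0)"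
          using main[OF m B_sets sub0] by blast
      qed
      then have "(\<integral>\<^sup>+w\<in>B z0 R. ennreal (v w powr (1 + \<kappa>)) \<partial>N) \<le> ennreal (2 * Am)"
        by (rule pmass_unbounded[OF B_sets k(1)])
      also have "2 * Am = (Cf * a powr (1 + \<kappa>)) * \<nu>"
      proof -
        have "\<omega> = a * \<nu>" using nu by (simp add: a_def)
        then show ?thesis using C C3 a by (simp add: Am_def Cf_def powr_mult powr_add)
      qed
      also have "ennreal (Cf * a powr (1 + \<kappa>) * \<nu>) = ennreal (Cf * a powr (1 + \<kappa>)) * emeasure N Q"
        using Cf nu by (simp add: ennreal_mult)
      finally show "(\<integral>\<^sup>+w\<in>B z0 R. ennreal (v w powr (1 + \<kappa>)) \<partial>N)
          \<le> ennreal (Cf * (measure W (B z0 (L * R)) / measure N (B z0 (L * R))) powr (1 + \<kappa>))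
            * emeasure N (B z0 (L * R))"
        by (simp add: Q_def a_def \<omega>_def \<nu>_def)
    qed
  qed
qed

end

section \<open>Parabolic cylinders\<close>

locale parabolic_space =
  fixes \<rho> :: "'x \<Rightarrow> 'x \<Rightarrow> real" and M :: "'x measure" and p K0 C0 :: real
  assumes rho_nonneg: "0 \<le> \<rho> x y" and rho_self: "\<rho> x x = 0" and rho_sym: "\<rho> x y = \<rho> y x"
    and rho_tri: "\<rho> x y \<le> K0 * (\<rho> x z + \<rho> z y)" and K0: "1 \<le> K0"
    and ball_sets: "qball \<rho> x r \<in> sets M" and C0: "1 \<le> C0"
    and rho_doubling: "0 < r \<Longrightarrow> emeasure M (qball \<rho> x (2 * r)) \<le> ennreal C0 * emeasure M (qball \<rho> x r)"
    and p: "1 < p" and pbasic: "basic_assumptions (parabolic_dist \<rho> p) (parabolic_measure M)"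
begin

abbreviation "pd \<equiv> parabolic_dist \<rho> p"
abbreviation "N \<equiv> parabolic_measure M"

lemma root_less_iff: "0 < r \<Longrightarrow> \<bar>a\<bar> powr (1 / p) < r \<longleftrightarrow> \<bar>a\<bar> < r powr p"
proof -
  assume r: "0 < r"
  have "\<bar>a\<bar> powr (1 / p) < r \<longleftrightarrow> (\<bar>a\<bar> powr (1 / p)) powr p < r powr p"
    using r p powr_less_mono2[of p "\<bar>a\<bar> powr (1 / p)" r] powr_mono2[of p r "\<bar>a\<bar> powr (1 / p)"]
    by (meson less_le_not_le not_less not_less_iff_gr_or_eq order.strict_trans powr_ge_zero zero_less_one order_less_imp_le)
  then show ?thesis using p by (simp add: powr_powr)
qed

lemma mem_pball: "0 < r \<Longrightarrow> (y, s) \<in> qball pd (x, t) r \<longleftrightarrow> \<rho> x y < r \<and> \<bar>s - t\<bar> < r powr p"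
  by (simp add: qball_def parabolic_dist_def root_less_iff abs_minus_commute[of t s])

lemma pball_eq: "0 < r \<Longrightarrow> qball pd (x, t) r = qball \<rho> x r \<times> {t - r powr p <..< t + r powr p}"
proof (intro set_eqI)
  fix w assume r: "0 < r"
  show "w \<in> qball pd (x, t) r \<longleftrightarrow> w \<in> qball \<rho> x r \<times> {t - r powr p <..< t + r powr p}"
    by (cases w) (simp only: mem_pball[OF r], auto simp: qball_def)
qed

lemma emeasure_rect:
  "a \<le> b \<Longrightarrow> emeasure N (qball \<rho> x r \<times> {a<..<b}) = emeasure M (qball \<rho> x r) * ennreal (b - a)"
  unfolding parabolic_measure_def
  by (subst emeasure_completion) (auto simp: ball_sets lborel.emeasure_pair_measure_Times)

lemma rect_sets: "qball \<rho> x r \<times> {a<..<b::real} \<in> sets N"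
  unfolding parabolic_measure_def by (intro sets_completionI_sets pair_measureI ball_sets) auto

text \<open>The factor 2 in \<open>2 * K0\<close> comes from the time part: a time difference is at
  most twice the larger of the two intermediate ones, and \<open>2 powr (1 / p) \<le> 2\<close>.
  Balls are products, whence the doubling factor \<open>2 powr p\<close> for the time
  interval.\<close>

lemma doubling_space_parabolic: "doubling_space pd N (2 * K0) (C0 * 2 powr p)"
proof (rule doubling_space.intro)
  show "0 \<le> pd a b" for a b by (simp add: parabolic_dist_def rho_nonneg le_max_iff_disj)
  show "pd a a = 0" for a by (simp add: parabolic_dist_def rho_self)
  show "pd a b = pd b a" for a b
    by (simp add: parabolic_dist_def rho_sym[of "fst a"] abs_minus_commute[of "snd a"])
  show "pd a b \<le> 2 * K0 * (pd a c + pd c b)" for a b c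
  proof -
    let ?q = "\<lambda>u v :: 'x \<times> real. \<bar>snd u - snd v\<bar> powr (1 / p)"
    have le: "\<rho> (fst u) (fst v) \<le> pd u v" "?q u v \<le> pd u v" "0 \<le> pd u v" for u v
      by (auto simp: parabolic_dist_def rho_nonneg le_max_iff_disj)
    have "\<rho> (fst a) (fst b) \<le> K0 * (\<rho> (fst a) (fst c) + \<rho> (fst c) (fst b))" by (rule rho_tri)
    also have "\<dots> \<le> K0 * (pd a c + pd c b)" using K0 le by (intro mult_left_mono add_mono) auto
    also have "\<dots> \<le> 2 * (K0 * (pd a c + pd c b))" using K0 le(3)[of a c] le(3)[of c b] by simp
    finally have 1: "\<rho> (fst a) (fst b) \<le> 2 * K0 * (pd a c + pd c b)" by simp
    define m where "m = max \<bar>snd a - snd c\<bar> \<bar>snd c - snd b\<bar>"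
    have "\<bar>snd a - snd c\<bar> \<le> m" "\<bar>snd c - snd b\<bar> \<le> m" by (simp_all add: m_def)
    then have "\<bar>snd a - snd b\<bar> \<le> 2 * m" by linarith
    then have "?q a b \<le> (2 * m) powr (1 / p)" using p by (intro powr_mono2) auto
    also have "\<dots> = 2 powr (1 / p) * m powr (1 / p)" by (simp add: powr_mult m_def)
    also have "\<dots> \<le> 2 powr 1 * m powr (1 / p)" using p by (intro mult_right_mono powr_mono) auto
    also have "\<dots> \<le> 2 * (pd a c + pd c b)"
    proof -
      have "m powr (1 / p) \<le> pd a c + pd c b"
        using le(2)[of a c] le(2)[of c b] le(3)[of a c] le(3)[of c b] unfolding m_def max_def by auto
      then show ?thesis by simp
    qed
    also have "\<dots> \<le> 2 * K0 * (pd a c + pd c b)"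
      using K0 le(3)[of a c] le(3)[of c b] by (intro mult_right_mono) auto
    finally have "?q a b \<le> 2 * K0 * (pd a c + pd c b)" .
    moreover have "pd a b = max (\<rho> (fst a) (fst b)) (?q a b)" by (simp add: parabolic_dist_def)
    ultimately show ?thesis using 1 by simp
  qed
  show "1 \<le> 2 * K0" using K0 by simp
  show "basic_assumptions pd N" by (rule pbasic)
  have "1 \<le> 2 powr p" using p by (intro ge_one_powr_ge_zero) auto
  then show "1 \<le> C0 * 2 powr p" using C0 mult_mono[of 1 C0 1 "2 powr p"] by simp
  fix r :: real and a :: "'x \<times> real" assume r: "0 < r"
  obtain x t where a: "a = (x, t)" by (cases a)
  have "emeasure N (qball pd a (2 * r)) = emeasure M (qball \<rho> x (2 * r)) * ennreal (2 powr p * (2 * r powr p))"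
    using r by (simp add: a pball_eq emeasure_rect powr_mult mult_ac)
  also have "\<dots> \<le> (ennreal C0 * emeasure M (qball \<rho> x r)) * ennreal (2 powr p * (2 * r powr p))"
    by (intro mult_right_mono rho_doubling r) auto
  also have "\<dots> = ennreal (C0 * 2 powr p) * (emeasure M (qball \<rho> x r) * ennreal (2 * r powr p))"
    using C0 by (simp add: ennreal_mult mult_ac)
  also have "emeasure M (qball \<rho> x r) * ennreal (2 * r powr p) = emeasure N (qball pd a r)"
    using r by (simp add: a pball_eq emeasure_rect)
  finally show "emeasure N (qball pd a (2 * r)) \<le> ennreal (C0 * 2 powr p) * emeasure N (qball pd a r)" .
qed

sublocale doubling_space pd N "2 * K0" "C0 * 2 powr p"
  by (rule doubling_space_parabolic)

text \<open>\<open>e\<close> is the direction of time: \<open>half 1\<close> are the upper and \<open>half (- 1)\<close> the lower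
  parts of the cylinders.\<close>

definition half :: "real \<Rightarrow> real \<Rightarrow> 'x \<Rightarrow> real \<Rightarrow> real \<Rightarrow> ('x \<times> real) set" where
  "half e \<gamma> x t l = qball \<rho> x l \<times> {s. \<gamma> * l powr p < e * (s - t) \<and> e * (s - t) < l powr p}"

lemma half_upper: "half 1 \<gamma> x t l = cyl_upper \<rho> p \<gamma> x t l"
  by (auto simp: half_def cyl_upper_def)

lemma half_lower: "half (- 1) \<gamma> x t l = cyl_lower \<rho> p \<gamma> x t l"
  by (auto simp: half_def cyl_lower_def)

context
  fixes e \<gamma> :: real
  assumes e: "e = 1 \<or> e = - 1" and g0: "0 \<le> \<gamma>" and g1: "\<gamma> < 1"
begin

lemma half_sets [measurable]: "half e \<gamma> x t l \<in> sets N"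
  using e by (auto simp: half_upper half_lower cyl_upper_def cyl_lower_def intro: rect_sets)

lemma emeasure_half:
  "emeasure N (half e \<gamma> x t l) = emeasure M (qball \<rho> x l) * ennreal ((1 - \<gamma>) * l powr p)"
proof -
  have "\<gamma> * l powr p \<le> 1 * l powr p" using g1 by (intro mult_right_mono) auto
  then show ?thesis using e
    by (auto simp: half_upper half_lower cyl_upper_def cyl_lower_def emeasure_rect algebra_simps)
qed

text \<open>The times differ by less than \<open>2 * l powr p\<close>, and
  \<open>2 \<le> 2 powr p\<close>.\<close>

lemma half_subset:
  assumes "0 < l" "\<bar>T - s\<bar> < l powr p"
  shows "half e \<gamma> y T l \<subseteq> B (y, s) (2 * l)"
proof
  fix w assume "w \<in> half e \<gamma> y T l"
  then obtain x t where w: "w = (x, t)" "\<rho> y x < l" "\<gamma> * l powr p < e * (t - T)" "e * (t - T) < l powr p"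
    by (auto simp: half_def qball_def)
  have "0 \<le> \<gamma> * l powr p" using g0 by simp
  then have "\<bar>t - T\<bar> < l powr p" using w e by auto
  then have "\<bar>t - s\<bar> < 2 * l powr p" using assms by linarith
  also have "\<dots> \<le> 2 powr p * l powr p"
    using p powr_mono[of 1 p 2] by (intro mult_right_mono) auto
  also have "\<dots> = (2 * l) powr p" using assms by (simp add: powr_mult)
  finally show "w \<in> B (y, s) (2 * l)" using w assms by (simp add: mem_pball)
qed

lemma half_subset_ball: "0 < l \<Longrightarrow> half e \<gamma> x t l \<subseteq> B (x, t) l"
proof
  fix w assume l: "0 < l" and w: "w \<in> half e \<gamma> x t l"
  have "0 \<le> \<gamma> * l powr p" using g0 by simp
  moreover obtain y s where ys: "w = (y, s)" by (cases w)
  ultimately have "\<rho> x y < l" "\<bar>s - t\<bar> < l powr p" using w e by (auto simp: half_def qball_def)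
  then show "w \<in> B (x, t) l" using l by (simp add: ys mem_pball)
qed

text \<open>The time interval of the half cylinder is centred at \<open>T + e * (1 + \<gamma>) / 2 * l powr p\<close>.\<close>

lemma ball_subset_half:
  assumes r: "0 < r" and sp: "K0 * (\<rho> y y' + r) \<le> l" and ti: "2 * r powr p \<le> (1 - \<gamma>) * l powr p"
    and T: "s = T + e * ((1 + \<gamma>) / 2 * l powr p)"
  shows "B (y', s) r \<subseteq> half e \<gamma> y T l"
proof
  fix w assume "w \<in> B (y', s) r"
  then obtain x t where w: "w = (x, t)" "\<rho> y' x < r" "\<bar>t - s\<bar> < r powr p"
    using r by (cases w) (auto simp: mem_pball)
  have "\<rho> y x \<le> K0 * (\<rho> y y' + \<rho> y' x)" by (rule rho_tri)
  also have "\<dots> < K0 * (\<rho> y y' + r)" using w K0 by simp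
  finally have "\<rho> y x < l" using sp by simp
  moreover have "\<gamma> * l powr p < e * (t - T) \<and> e * (t - T) < l powr p"
  proof -
    have "e * (t - T) = e * (t - s) + (1 + \<gamma>) / 2 * l powr p" using e T by auto
    also have "(1 + \<gamma>) / 2 * l powr p = l powr p / 2 + \<gamma> * l powr p / 2"
      by (simp add: field_simps)
    finally have "e * (t - T) = e * (t - s) + (l powr p / 2 + \<gamma> * l powr p / 2)" .
    moreover have "\<bar>e * (t - s)\<bar> < r powr p" using w e by auto
    moreover have "2 * r powr p \<le> l powr p - \<gamma> * l powr p" using ti by (simp add: algebra_simps)
    ultimately show ?thesis by linarith
  qed
  ultimately show "w \<in> half e \<gamma> y T l"
    using w by (simp add: half_def qball_def)
qed

lemma half_pos: "0 < l \<Longrightarrow> 0 < emeasure N (half e \<gamma> x t l)"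
proof -
  assume l: "0 < l"
  have "0 < emeasure M (qball \<rho> x l)"
    using B_pos[OF l, of "(x, t)"] l by (simp add: pball_eq emeasure_rect ennreal_zero_less_mult_iff)
  then show ?thesis using l g1 by (simp add: emeasure_half ennreal_zero_less_mult_iff)
qed

lemma half_fin: "0 < l \<Longrightarrow> emeasure N (half e \<gamma> x t l) < \<infinity>"
  using emeasure_mono[OF half_subset_ball, of l x t N] B_fin[of l "(x, t)"] le_less_trans by auto

end

text \<open>With such an \<open>L\<close>, the time interval of a half cylinder of size
  \<open>L * r\<close> has length at least \<open>2 * r powr p\<close>, the height of a ball of
  radius \<open>r\<close>.\<close>

lemma dilation_bounds:
  assumes g: "0 \<le> \<gamma>" "\<gamma> < 1" and L2: "2 / (1 - \<gamma>) \<le> L"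
  shows "1 \<le> L" "2 \<le> (1 - \<gamma>) * L powr p"
proof -
  have "2 \<le> 2 / (1 - \<gamma>)" using g by (simp add: field_simps)
  then show L: "1 \<le> L" using L2 by simp
  have "L powr 1 \<le> L powr p" using L p by (intro powr_mono) auto
  then have "2 / (1 - \<gamma>) \<le> L powr p" using L2 L by simp
  then show "2 \<le> (1 - \<gamma>) * L powr p" using g by (simp add: field_simps)
qed

text \<open>Serves to show that balls have finite mass: the Muckenhoupt condition bounds averages
  over half cylinders only.\<close>

lemma ball_in_half:
  assumes e: "e = 1 \<or> e = - 1" and g: "0 \<le> \<gamma>" "\<gamma> < 1" and r: "0 < r"
  obtains y T l where "0 < l" "B z r \<subseteq> half e \<gamma> y T l"
proof -
  define L where "L = max (2 / (1 - \<gamma>)) K0"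
  have L: "1 \<le> L" "2 \<le> (1 - \<gamma>) * L powr p" using dilation_bounds[OF g, of L] by (auto simp: L_def)
  obtain y s where z: "z = (y, s)" by (cases z)
  have "2 * r powr p \<le> (1 - \<gamma>) * L powr p * r powr p" using L by (intro mult_right_mono) auto
  then have ti: "2 * r powr p \<le> (1 - \<gamma>) * (L * r) powr p" using L r by (simp add: powr_mult mult.assoc)
  have "K0 * (\<rho> y y + r) \<le> L * r" using r by (simp add: rho_self L_def)
  from ball_subset_half[OF e g r this ti, of s "s - e * ((1 + \<gamma>) / 2 * (L * r) powr p)"]
  show thesis using that[of "L * r"] L r by (simp add: z)
qed

end

section \<open>Weights on parabolic cylinders\<close>

text \<open>\<open>transfer\<close> is the form in which the Muckenhoupt condition is used: if
  \<open>v\<close> has average at least \<mu> on the half in direction \<open>- e\<close>, then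
  \<open>v \<le> \<beta> * \<mu>\<close> only on a fraction \<eta> of the opposite half. It is
  needed for arbitrarily small \<eta>, as a ball may fill only a small part of a half
  cylinder.\<close>

locale parabolic_weight =
  parabolic_space \<rho> M p K0 C0 +
  doubling_weight "parabolic_dist \<rho> p" "parabolic_measure M" "2 * K0" "C0 * 2 powr p" v W
  for \<rho> :: "'x \<Rightarrow> 'x \<Rightarrow> real" and M :: "'x measure" and p K0 C0 v W +
  fixes e \<gamma> Kg :: real
  assumes e: "e = 1 \<or> e = - 1" and g0: "0 \<le> \<gamma>" and g1: "\<gamma> < 1"
    and geodesic: "\<lbrakk>0 < s; s \<le> \<rho> x y\<rbrakk> \<Longrightarrow> \<exists>(m::nat) z. z 0 = x \<and> z m = y \<and>
      (\<forall>i<m. \<rho> (z i) (z (Suc i)) \<le> Kg * s \<and> \<rho> (z (Suc i)) (z m) \<le> \<rho> (z i) (z m) - s)"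
    and transfer: "0 < \<eta> \<Longrightarrow> \<exists>\<beta>>0. \<forall>x t l \<mu>. 0 < l \<longrightarrow> 0 < \<mu> \<longrightarrow>
      ennreal \<mu> * emeasure (parabolic_measure M) (half (- e) \<gamma> x t l) \<le> emeasure W (half (- e) \<gamma> x t l) \<longrightarrow>
      emeasure (parabolic_measure M) (half e \<gamma> x t l \<inter> {z. v z \<le> \<beta> * \<mu>})
        \<le> ennreal \<eta> * emeasure (parabolic_measure M) (half e \<gamma> x t l)"
begin

lemma minus_e: "- e = 1 \<or> - e = - 1"
  using e by auto

lemma half_above:
  assumes E: "E \<in> sets N" and fin: "emeasure N E < \<infinity>"
    and le: "emeasure N (E \<inter> {z. v z \<le> c}) \<le> ennreal (1 / 2) * emeasure N E"
  shows "emeasure N E \<le> 2 * emeasure N (E \<inter> {z. c < v z})"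
proof -
  have s: "E \<inter> {z. v z \<le> c} \<in> sets N" "E \<inter> {z. c < v z} \<in> sets N"
    using E sublevel_sets superlevel_sets by auto
  have "emeasure N (E \<inter> {z. v z \<le> c}) + emeasure N (E \<inter> {z. c < v z})
      = emeasure N ((E \<inter> {z. v z \<le> c}) \<union> (E \<inter> {z. c < v z}))"
    using s by (intro plus_emeasure) auto
  also have "(E \<inter> {z. v z \<le> c}) \<union> (E \<inter> {z. c < v z}) = E" by auto
  finally have eq: "emeasure N (E \<inter> {z. v z \<le> c}) + emeasure N (E \<inter> {z. c < v z}) = emeasure N E" .
  obtain a where a: "emeasure N E = ennreal a" "0 \<le> a" using fin by (cases "emeasure N E") auto
  have "emeasure N (E \<inter> {z. v z \<le> c}) \<noteq> top" "emeasure N (E \<inter> {z. c < v z}) \<noteq> top"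
    using eq a by auto
  then obtain b b' where b: "emeasure N (E \<inter> {z. v z \<le> c}) = ennreal b" "0 \<le> b"
      "emeasure N (E \<inter> {z. c < v z}) = ennreal b'" "0 \<le> b'"
    by (metis ennreal_cases)
  have "b + b' = a" using eq a b by (simp flip: ennreal_plus)
  moreover have "b \<le> 1 / 2 * a" using le a b by (simp add: ennreal_mult[symmetric] del: ennreal_half)
  ultimately have "a \<le> 2 * b'" by simp
  then have "ennreal a \<le> ennreal (2 * b')" by (rule ennreal_leI)
  then show ?thesis using a b by (simp add: ennreal_mult)
qed

lemma weak_A_infinity_parabolic:
  obtains A \<Lambda> \<beta> where "weak_A_infinity pd N (2 * K0) (C0 * 2 powr p) v W A \<Lambda> \<beta>"
proof -
  define L where "L = max (2 / (1 - \<gamma>)) K0"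
  have L: "1 \<le> L" "2 \<le> (1 - \<gamma>) * L powr p" using dilation_bounds[OF g0 g1, of L] by (auto simp: L_def)
  obtain D' where D': "1 \<le> D'"
      "\<And>x r. 0 < r \<Longrightarrow> emeasure N (B x ((2 * L) * r)) \<le> ennreal D' * emeasure N (B x r)"
    using doubling_factor[of "2 * L"] by blast
  obtain \<beta>0 where b0: "0 < \<beta>0" and tr: "\<And>x t l \<mu>. \<lbrakk>0 < l; 0 < \<mu>;
      ennreal \<mu> * emeasure N (half (- e) \<gamma> x t l) \<le> emeasure W (half (- e) \<gamma> x t l)\<rbrakk> \<Longrightarrow>
      emeasure N (half e \<gamma> x t l \<inter> {z. v z \<le> \<beta>0 * \<mu>}) \<le> ennreal (1 / 2) * emeasure N (half e \<gamma> x t l)"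
    using transfer[of "1 / 2"] by (auto simp del: ennreal_half)
  \<comment> \<open>The half containing the ball lies in the dilate by \<open>2 * L\<close>, so
    passing from the ball to that half lowers the average at most by the factor
    \<open>D'\<close>.\<close>
  define \<beta> where "\<beta> = min 1 (\<beta>0 / D')"
  have "weak_A_infinity pd N (2 * K0) (C0 * 2 powr p) v W 2 (2 * L) \<beta>"
  proof (unfold_locales)
    show "0 < (2::real)" "1 \<le> 2 * L" "0 < \<beta>" "\<beta> \<le> 1" using L b0 D'(1) by (auto simp: \<beta>_def)
    fix r l z assume r: "0 < r" and l: "0 < l"
      and big: "ennreal l * emeasure N (B z r) < emeasure W (B z r)"
    obtain y s where z: "z = (y, s)" by (cases z)
    \<comment> \<open>The cylinder is placed so that its half in direction \<open>- e\<close> has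
      its time interval centred at \<open>s\<close>.\<close>
    define T where "T = s + e * ((1 + \<gamma>) / 2 * (L * r) powr p)"
    have Lr: "0 < L * r" using L r by simp
    have pw: "(L * r) powr p = L powr p * r powr p" using L r by (simp add: powr_mult)
    have "2 * r powr p \<le> (1 - \<gamma>) * L powr p * r powr p" using L by (intro mult_right_mono) auto
    then have ti: "2 * r powr p \<le> (1 - \<gamma>) * (L * r) powr p" by (simp add: pw mult.assoc)
    have "K0 * (\<rho> y y + r) \<le> L * r" using r by (simp add: rho_self L_def)
    then have sub: "B z r \<subseteq> half (- e) \<gamma> y T (L * r)"
      unfolding z using minus_e g0 g1 r ti by (intro ball_subset_half) (auto simp: T_def)
    have ts: "\<bar>T - s\<bar> < (L * r) powr p"
    proof -
      have "\<bar>T - s\<bar> = (1 + \<gamma>) / 2 * (L * r) powr p" using e g0 by (auto simp: T_def abs_mult)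
      also have "\<dots> < 1 * (L * r) powr p" using g1 Lr by (intro mult_strict_right_mono) auto
      finally show ?thesis by simp
    qed
    have up: "half e' \<gamma> y T (L * r) \<subseteq> B z (2 * L * r)" if "e' = 1 \<or> e' = - 1" for e'
      unfolding z using half_subset[OF that g0 g1 Lr ts, of y] by (simp add: mult.assoc)
    let ?U = "half e \<gamma> y T (L * r)" and ?V = "half (- e) \<gamma> y T (L * r)"
    have NUV: "emeasure N ?U = emeasure N ?V"
      using emeasure_half[OF e g0 g1] emeasure_half[OF minus_e g0 g1] by simp
    have "ennreal (l / D') * emeasure N ?V \<le> ennreal (l / D') * emeasure N (B z (2 * L * r))"
      by (intro mult_left_mono emeasure_mono up minus_e) auto
    also have "\<dots> \<le> ennreal (l / D') * (ennreal D' * emeasure N (B z r))"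
      by (intro mult_left_mono D' r) auto
    also have "\<dots> = ennreal l * emeasure N (B z r)"
      using D'(1) l by (simp add: mult.assoc[symmetric] ennreal_mult[symmetric])
    also have "\<dots> \<le> emeasure W (B z r)" using big by simp
    also have "\<dots> \<le> emeasure W ?V" using half_sets[OF minus_e g0 g1] by (intro emeasure_mono sub) auto
    finally have "emeasure N (?U \<inter> {z. v z \<le> \<beta>0 * (l / D')}) \<le> ennreal (1 / 2) * emeasure N ?U"
      using l D'(1) by (intro tr Lr) auto
    then have U: "emeasure N ?U \<le> 2 * emeasure N (?U \<inter> {z. \<beta>0 * (l / D') < v z})"
      by (intro half_above half_sets half_fin e g0 g1 Lr)
    have "emeasure N (B z r) \<le> emeasure N ?V"
      using half_sets[OF minus_e g0 g1] by (intro emeasure_mono sub) auto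
    also have "\<dots> \<le> 2 * emeasure N (?U \<inter> {z. \<beta>0 * (l / D') < v z})" using U NUV by simp
    also have "\<dots> \<le> 2 * emeasure N (B z (2 * L * r) \<inter> {z. \<beta> * l < v z})"
    proof (intro mult_left_mono emeasure_mono)
      have "\<beta> * l \<le> \<beta>0 / D' * l" using l by (intro mult_right_mono) (auto simp: \<beta>_def)
      then show "?U \<inter> {z. \<beta>0 * (l / D') < v z} \<subseteq> B z (2 * L * r) \<inter> {z. \<beta> * l < v z}"
        using up[OF e] by auto
      show "B z (2 * L * r) \<inter> {z. \<beta> * l < v z} \<in> sets N" using superlevel_sets by auto
    qed auto
    finally show "emeasure N (B z r) \<le> ennreal 2 * emeasure N (B z (2 * L * r) \<inter> {z. \<beta> * l < v z})"
      by simp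
  qed
  then show thesis by (rule that)
qed

section \<open>Moving mass in the direction of time\<close>

text \<open>Both balls fit into the opposite halves of one cylinder of size \<open>L * r\<close>
  centred over \<open>y\<close>. \<open>transfer\<close> makes \<open>v\<close> large on half of the
  target ball, at a level comparable to the average over the half that contains the source
  ball.\<close>

lemma shift_ball:
  assumes "1 \<le> c"
  obtains C H where "1 \<le> C" "1 \<le> H" "\<And>y y' s r. \<lbrakk>0 < r; \<rho> y y' \<le> c * r\<rbrakk>
    \<Longrightarrow> emeasure W (B (y, s) r) \<le> ennreal C * emeasure W (B (y', s + e * (H * r powr p)) r)"
proof -
  define L where "L = max (2 / (1 - \<gamma>)) (K0 * (c + 1))"
  have L: "1 \<le> L" "2 \<le> (1 - \<gamma>) * L powr p" using dilation_bounds[OF g0 g1, of L] by (auto simp: L_def)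
  \<comment> \<open>In units of \<open>r powr p\<close>, the distance between the centres of the
    time intervals of the two halves.\<close>
  define H where "H = (1 + \<gamma>) * L powr p"
  have "1 \<le> L powr p" using L p by (intro ge_one_powr_ge_zero) auto
  then have H: "1 \<le> H" unfolding H_def using mult_mono[of 1 "1 + \<gamma>" 1 "L powr p"] g0 by simp
  obtain D' where D': "1 \<le> D'"
      "\<And>x r. 0 < r \<Longrightarrow> emeasure N (B x ((2 * K0 * (c + 2 * L)) * r)) \<le> ennreal D' * emeasure N (B x r)"
    using doubling_factor by blast
  \<comment> \<open>The half cylinder \<open>?U\<close> has at most \<open>D'\<close> times the
    measure of the target ball, so a fraction \<open>1 / (2 * D')\<close> of \<open>?U\<close> is at
    most half of that ball.\<close>
  obtain \<beta> where b: "0 < \<beta>" and tr: "\<And>x t l \<mu>. \<lbrakk>0 < l; 0 < \<mu>;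
      ennreal \<mu> * emeasure N (half (- e) \<gamma> x t l) \<le> emeasure W (half (- e) \<gamma> x t l)\<rbrakk> \<Longrightarrow>
      emeasure N (half e \<gamma> x t l \<inter> {z. v z \<le> \<beta> * \<mu>}) \<le> ennreal (1 / (2 * D')) * emeasure N (half e \<gamma> x t l)"
    using transfer[of "1 / (2 * D')"] D'(1) by auto
  have "emeasure W (B (y, s) r) \<le> ennreal (max 1 (2 * D' / \<beta>)) * emeasure W (B (y', s + e * (H * r powr p)) r)"
    if r: "0 < r" and yy: "\<rho> y y' \<le> c * r" for y y' s r
  proof -
    define s' where "s' = s + e * (H * r powr p)"
    define T where "T = s + e * ((1 + \<gamma>) / 2 * (L * r) powr p)"
    let ?E = "B (y', s') r"
    have Lr: "0 < L * r" using L r by simp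
    have pw: "(L * r) powr p = L powr p * r powr p" using L r by (simp add: powr_mult)
    have "2 * r powr p \<le> (1 - \<gamma>) * L powr p * r powr p" using L by (intro mult_right_mono) auto
    then have ti: "2 * r powr p \<le> (1 - \<gamma>) * (L * r) powr p" by (simp add: pw mult.assoc)
    have cr: "0 \<le> c * r" using assms r by simp
    have K: "K0 * (c * r + r) \<le> L * r"
    proof -
      have "K0 * (c + 1) * r \<le> L * r" using r by (intro mult_right_mono) (auto simp: L_def)
      then show ?thesis by (simp add: algebra_simps)
    qed
    have "K0 * (\<rho> y y + r) \<le> K0 * (c * r + r)" "K0 * (\<rho> y y' + r) \<le> K0 * (c * r + r)"
      using K0 cr yy by (auto simp: rho_self intro!: mult_left_mono)
    then have sp: "K0 * (\<rho> y y + r) \<le> L * r" "K0 * (\<rho> y y' + r) \<le> L * r" using K by auto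
    let ?U = "half e \<gamma> y T (L * r)" and ?V = "half (- e) \<gamma> y T (L * r)"
    have sub: "B (y, s) r \<subseteq> ?V"
      by (rule ball_subset_half[OF minus_e g0 g1 r sp(1) ti]) (simp add: T_def)
    have s'T: "s' = T + e * ((1 + \<gamma>) / 2 * (L * r) powr p)"
      by (simp add: s'_def T_def H_def pw algebra_simps add_divide_distrib)
    have sub': "?E \<subseteq> ?U"
      by (rule ball_subset_half[OF e g0 g1 r sp(2) ti s'T])
    have ts: "\<bar>T - s'\<bar> < (L * r) powr p"
    proof -
      have "\<bar>T - s'\<bar> = (1 + \<gamma>) / 2 * (L * r) powr p" using e g0 by (auto simp: s'T abs_mult)
      also have "\<dots> < 1 * (L * r) powr p" using g1 Lr by (intro mult_strict_right_mono) auto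
      finally show ?thesis by simp
    qed
    have "?U \<subseteq> B (y, s') (2 * (L * r))" by (rule half_subset[OF e g0 g1 Lr ts])
    also have "\<dots> \<subseteq> B (y', s') (2 * K0 * (c + 2 * L) * r)"
    proof (rule B_subset)
      have "pd (y', s') (y, s') = \<rho> y y'"
        using p by (simp add: parabolic_dist_def rho_sym[of y' y] rho_nonneg max_absorb1)
      then have "pd (y', s') (y, s') + 2 * (L * r) \<le> c * r + 2 * L * r" using yy by simp
      then have "2 * K0 * (pd (y', s') (y, s') + 2 * (L * r)) \<le> 2 * K0 * (c * r + 2 * L * r)"
        using K0 by (intro mult_left_mono) auto
      then show "2 * K0 * (pd (y', s') (y, s') + 2 * (L * r)) \<le> 2 * K0 * (c + 2 * L) * r"
        by (simp add: algebra_simps)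
    qed
    finally have "emeasure N ?U \<le> emeasure N (B (y', s') (2 * K0 * (c + 2 * L) * r))"
      by (intro emeasure_mono) auto
    also have "\<dots> \<le> ennreal D' * emeasure N ?E" by (rule D'(2)[OF r])
    finally have UE: "emeasure N ?U \<le> ennreal D' * emeasure N ?E" .
    have NUV: "emeasure N ?U = emeasure N ?V"
      using emeasure_half[OF e g0 g1] emeasure_half[OF minus_e g0 g1] by simp
    have Vs: "?V \<in> sets N" "?U \<in> sets N" using half_sets[OF minus_e g0 g1] half_sets[OF e g0 g1] by auto
    have Vle: "emeasure W ?V \<le> emeasure W (B (y, T) (L * r))"
      by (intro emeasure_mono half_subset_ball minus_e g0 g1 Lr) auto
    show ?thesis
    proof (cases "emeasure W ?V = 0")
      case True
      have "emeasure W (B (y, s) r) \<le> emeasure W ?V" using Vs by (intro emeasure_mono sub) auto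
      then show ?thesis using True by simp
    next
      case False
      define w where "w = measure W ?V"
      define n where "n = measure N ?V"
      have w: "emeasure W ?V = ennreal w" "0 < w"
        using False le_less_trans[OF Vle W_fin[OF Lr]]
        by (auto simp: w_def measure_def enn2real_positive_iff zero_less_iff_neq_zero)
      have n: "emeasure N ?V = ennreal n" "0 < n"
        using half_pos[OF minus_e g0 g1 Lr, of y T] half_fin[OF minus_e g0 g1 Lr, of y T]
        by (auto simp: n_def measure_def enn2real_positive_iff)
      have l: "0 < w / n" using w n by simp
      have "emeasure N (?U \<inter> {z. v z \<le> \<beta> * (w / n)}) \<le> ennreal (1 / (2 * D')) * emeasure N ?U"
        using w n by (intro tr Lr l) (simp add: ennreal_mult[symmetric])
      moreover have "emeasure N (?E \<inter> {z. v z \<le> \<beta> * (w / n)}) \<le> emeasure N (?U \<inter> {z. v z \<le> \<beta> * (w / n)})"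
        using sub' Vs sublevel_sets by (intro emeasure_mono) auto
      moreover have "ennreal (1 / (2 * D')) * emeasure N ?U \<le> ennreal (1 / (2 * D')) * (ennreal D' * emeasure N ?E)"
        by (intro mult_left_mono UE) auto
      moreover have "ennreal (1 / (2 * D')) * (ennreal D' * emeasure N ?E) = ennreal (1 / 2) * emeasure N ?E"
        using D'(1) by (simp add: mult.assoc[symmetric] ennreal_mult[symmetric] del: ennreal_half)
      ultimately have "emeasure N (?E \<inter> {z. v z \<le> \<beta> * (w / n)}) \<le> ennreal (1 / 2) * emeasure N ?E"
        by simp
      then have E2: "emeasure N ?E \<le> 2 * emeasure N (?E \<inter> {z. \<beta> * (w / n) < v z})"
        using B_fin[OF r] by (intro half_above) auto
      let ?F = "?E \<inter> {z. \<beta> * (w / n) < v z}"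
      have Fs: "?F \<in> sets N" using superlevel_sets by auto
      have "ennreal (\<beta> * (w / n)) * emeasure N ?F = (\<integral>\<^sup>+z. ennreal (\<beta> * (w / n)) * indicator ?F z \<partial>N)"
        using Fs by (simp add: nn_integral_cmult_indicator)
      also have "\<dots> \<le> (\<integral>\<^sup>+z. ennreal (v z) * indicator ?E z \<partial>N)"
        by (intro nn_integral_mono) (auto simp: indicator_def intro!: ennreal_leI)
      also have "\<dots> = emeasure W ?E" by (simp add: W_def emeasure_density)
      finally have WF: "ennreal (\<beta> * (w / n)) * emeasure N ?F \<le> emeasure W ?E" .
      have "emeasure W (B (y, s) r) \<le> emeasure W ?V" using Vs by (intro emeasure_mono sub) auto
      also have "\<dots> = ennreal (w / n) * emeasure N ?U"
        using w n by (simp add: NUV ennreal_mult[symmetric])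
      also have "\<dots> \<le> ennreal (w / n) * (ennreal D' * (2 * emeasure N ?F))"
        by (intro mult_left_mono order_trans[OF UE] E2) auto
      also have "\<dots> = ennreal (2 * D' / \<beta>) * (ennreal (\<beta> * (w / n)) * emeasure N ?F)"
      proof -
        have "ennreal (w / n) * (ennreal D' * (2 * emeasure N ?F))
            = (ennreal (w / n) * ennreal D' * ennreal 2) * emeasure N ?F" by (simp add: mult.assoc)
        also have "ennreal (w / n) * ennreal D' * ennreal 2 = ennreal (2 * D' / \<beta>) * ennreal (\<beta> * (w / n))"
          using l D'(1) b w n by (simp add: ennreal_mult[symmetric] field_simps del: ennreal_numeral)
        finally show ?thesis by (simp add: mult.assoc)
      qed
      also have "\<dots> \<le> ennreal (max 1 (2 * D' / \<beta>)) * emeasure W ?E"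
        by (intro mult_mono ennreal_leI WF) auto
      finally show ?thesis by (simp add: s'_def)
    qed
  qed
  then show thesis using H by (intro that[of "max 1 (2 * D' / \<beta>)" H]) auto
qed

text \<open>Each step of the monotone geodesic lowers the distance to its endpoint by at least
  \<open>r\<close>, which bounds the number of steps. The sequence is extended by its endpoint, so
  that time can go on there. Points closer than \<open>r\<close> are joined by one jump, hence the
  \<open>max 1\<close>.\<close>

lemma geodesic_chain:
  assumes r: "0 < r" and l: "\<rho> y x < l"
  obtains Z and m :: nat where "Z 0 = y" "\<And>i. m \<le> i \<Longrightarrow> Z i = x" "real m \<le> l / r + 1"
    "\<And>i. \<rho> (Z i) (Z (Suc i)) \<le> max 1 Kg * r"
proof (cases "r \<le> \<rho> y x")
  case True
  have Kr: "0 \<le> max 1 Kg * r" "Kg * r \<le> max 1 Kg * r" using r by (auto intro!: mult_right_mono)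
  obtain m :: nat and z where z: "z 0 = y" "z m = x"
      "\<And>i. i < m \<Longrightarrow> \<rho> (z i) (z (Suc i)) \<le> Kg * r \<and> \<rho> (z (Suc i)) (z m) \<le> \<rho> (z i) (z m) - r"
    using geodesic[OF r True] by blast
  have "\<rho> (z i) (z m) \<le> \<rho> y x - real i * r" if "i \<le> m" for i
    using that
  proof (induction i)
    case (Suc i)
    then show ?case using z(3)[of i] by (simp add: algebra_simps)
  qed (use z in simp)
  from this[of m] have "real m * r \<le> \<rho> y x" by (simp add: rho_self)
  then have "real m \<le> l / r" using r l by (simp add: field_simps)
  then show thesis
    using z Kr by (intro that[of "\<lambda>i. z (min i m)" m]) (auto simp: min_def rho_self not_le Suc_le_eq le_Suc_eq intro: order_trans)
next
  case False
  have "0 \<le> l / r" using l r rho_nonneg[of y x] by simp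
  moreover have "1 * r \<le> max 1 Kg * r" using r by (intro mult_right_mono) auto
  with False have "\<rho> y x \<le> max 1 Kg * r" by linarith
  ultimately show thesis
    using r by (intro that[of "\<lambda>i. if i = 0 then y else x" 1]) (auto simp: rho_self)
qed


text \<open>Once the chain has reached the centre of the spatial ball, only the time is shifted, until the
  ball lies in the middle of the half cylinder.\<close>

lemma chain:
  obtains k C where "0 < k" "k \<le> 1" "1 \<le> C"
    "\<And>x t y s l. \<lbrakk>0 < l; (y, s) \<in> half (- e) 0 x t l\<rbrakk>
      \<Longrightarrow> emeasure W (B (y, s) (k * l)) \<le> ennreal C * emeasure W (half e 0 x t l)"
proof -
  define c where "c = max 1 Kg"
  obtain C H where C: "1 \<le> C" "1 \<le> H" and sh: "\<And>y y' s r. \<lbrakk>0 < r; \<rho> y y' \<le> c * r\<rbrakk>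
    \<Longrightarrow> emeasure W (B (y, s) r) \<le> ennreal C * emeasure W (B (y', s + e * (H * r powr p)) r)"
    using shift_ball[of c] by (auto simp: c_def)
  \<comment> \<open>Since \<open>p > 1\<close>, the second bound gives
    \<open>4 * H * k powr p \<le> k\<close>, so the about \<open>1 / k\<close> steps in space take
    less than half the height of the half cylinder. The bound 1/4 also makes each time step at most
    1/16 of that height.\<close>
  define k where "k = min (1 / 4) ((1 / (4 * H)) powr (1 / (p - 1)))"
  have k: "0 < k" "k \<le> 1 / 4" using C by (auto simp: k_def)
  have kp: "4 * H * k powr p \<le> k"
  proof -
    have "k powr (p - 1) \<le> ((1 / (4 * H)) powr (1 / (p - 1))) powr (p - 1)"
      using p k by (intro powr_mono2) (auto simp: k_def)
    also have "\<dots> = 1 / (4 * H)" using p C by (simp add: powr_powr)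
    finally have "k * k powr (p - 1) \<le> k * (1 / (4 * H))" using k by (intro mult_left_mono) auto
    moreover have "k powr p = k * k powr (p - 1)" using k by (simp add: powr_diff)
    ultimately show ?thesis using C by (simp add: field_simps)
  qed
  have kp0: "0 < k powr p" using k by simp
  \<comment> \<open>A bound on the number of steps for every cylinder and starting point: at most
    3/2 of the height has to be travelled, plus one step for rounding up.\<close>
  define n0 where "n0 = nat \<lceil>3 / (2 * (H * k powr p)) + 1\<rceil>"
  show thesis
  proof (rule that[of k "C ^ n0"])
    show "0 < k" "k \<le> 1" "1 \<le> C ^ n0" using k C by auto
    fix x t y s and l :: real
    assume l: "0 < l" and ys: "(y, s) \<in> half (- e) 0 x t l"
    define r where "r = k * l"
    define q where "q = l powr p"
    define h where "h = H * r powr p"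
    define u where "u = - e * (s - t)"
    have r: "0 < r" using k l by (simp add: r_def)
    have q: "0 < q" using l by (simp add: q_def)
    have rp: "r powr p = k powr p * q" using k l by (simp add: r_def q_def powr_mult)
    have h: "0 < h" using C r by (simp add: h_def)
    have hq: "h = H * k powr p * q" by (simp add: h_def rp)
    have rxy: "\<rho> y x < l" and u: "0 < u" "u < q"
      using ys by (auto simp: half_def qball_def u_def q_def rho_sym[of y x])
    have h16: "16 * h \<le> q"
    proof -
      have "16 * (H * k powr p) \<le> 1" using kp k by simp
      then have "16 * (H * k powr p) * q \<le> 1 * q" using q by (intro mult_right_mono) auto
      then show ?thesis by (simp add: hq)
    qed
    have r16: "16 * r powr p \<le> q"
    proof -
      have "1 * r powr p \<le> h" unfolding h_def using C by (intro mult_right_mono) auto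
      then show ?thesis using h16 by simp
    qed
    obtain Z and m :: nat where Z: "Z 0 = y" "\<And>i. m \<le> i \<Longrightarrow> Z i = x" "real m \<le> l / r + 1"
        "\<And>i. \<rho> (Z i) (Z (Suc i)) \<le> c * r"
      using geodesic_chain[OF r rxy] unfolding c_def by blast
    have it: "emeasure W (B (y, s) r) \<le> ennreal (C ^ i) * emeasure W (B (Z i, s + e * (real i * h)) r)" for i
    proof (induction i)
      case 0
      show ?case by (simp add: Z)
    next
      case (Suc i)
      have "emeasure W (B (Z i, s + e * (real i * h)) r)
          \<le> ennreal C * emeasure W (B (Z (Suc i), (s + e * (real i * h)) + e * (H * r powr p)) r)"
        by (rule sh[OF r Z(4)])
      also have "(s + e * (real i * h)) + e * (H * r powr p) = s + e * (real (Suc i) * h)"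
        by (simp add: h_def algebra_simps)
      finally have "ennreal (C ^ i) * emeasure W (B (Z i, s + e * (real i * h)) r)
          \<le> ennreal (C ^ i) * (ennreal C * emeasure W (B (Z (Suc i), s + e * (real (Suc i) * h)) r))"
        by (intro mult_left_mono) auto
      also have "\<dots> = ennreal (C ^ Suc i) * emeasure W (B (Z (Suc i), s + e * (real (Suc i) * h)) r)"
        using C by (simp add: ennreal_mult mult_ac)
      finally show ?case using Suc by (rule order_trans[rotated])
    qed
    \<comment> \<open>After \<open>n\<close> steps the time lies between \<open>q / 2\<close> and
      \<open>q / 2 + h\<close> beyond \<open>t\<close>: it first makes up for the distance
      \<open>u\<close> to \<open>t\<close> and then goes to the middle of the target half.\<close>
    define n where "n = nat \<lceil>(q / 2 + u) / h\<rceil>"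
    have n: "(q / 2 + u) / h \<le> real n" "real n < (q / 2 + u) / h + 1"
    proof -
      have "0 \<le> (q / 2 + u) / h" using q u h by simp
      then have "real n = of_int \<lceil>(q / 2 + u) / h\<rceil>" unfolding n_def by (simp add: of_nat_nat)
      then show "(q / 2 + u) / h \<le> real n" "real n < (q / 2 + u) / h + 1"
        using ceiling_correct[of "(q / 2 + u) / h"] by linarith+
    qed
    have n1: "q / 2 + u \<le> real n * h" using n(1) h by (simp add: field_simps)
    have n2: "real n * h < q / 2 + u + h" using n(2) h by (simp add: field_simps)
    have "m \<le> n"
    proof -
      have "l / r = 1 / k" using k l by (simp add: r_def)
      \<comment> \<open>The time \<open>q / 2\<close> alone already allows
        \<open>1 / (2 * H * k powr p)\<close> steps, at least \<open>2 / k\<close> by the choice of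
        \<open>k\<close>; so the chain has reached \<open>x\<close>.\<close>
      then have "real m \<le> 1 / k + 1" using Z(3) by simp
      also have "\<dots> \<le> 2 / k" using k by (simp add: field_simps)
      also have "\<dots> \<le> q / 2 / h" using kp k C q kp0 by (simp add: hq field_simps)
      also have "\<dots> \<le> (q / 2 + u) / h" using u h by (intro divide_right_mono) auto
      finally show ?thesis using n(1) by linarith
    qed
    then have Zn: "Z n = x" by (rule Z)
    have "n \<le> n0"
    proof -
      have "real n \<le> (q / 2 + u) / h + 1" using n by simp
      also have "\<dots> \<le> (3 / 2 * q) / h + 1" using u h by (intro add_right_mono divide_right_mono) auto
      also have "\<dots> = 3 / (2 * (H * k powr p)) + 1" using q by (simp add: hq)
      also have "\<dots> \<le> real n0" unfolding n0_def by (rule real_nat_ceiling_ge)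
      finally show ?thesis by simp
    qed
    have "B (x, s + e * (real n * h)) r \<subseteq> half e 0 x t l"
    proof
      fix w assume "w \<in> B (x, s + e * (real n * h)) r"
      then obtain a b where w: "w = (a, b)" "\<rho> x a < r" "\<bar>b - (s + e * (real n * h))\<bar> < r powr p"
        using r by (cases w) (auto simp: mem_pball)
      have "r \<le> l" using k l by (simp add: r_def)
      have "e * (b - t) = e * (b - (s + e * (real n * h))) + (real n * h - u)"
        using e by (auto simp: u_def)
      moreover have "\<bar>e * (b - (s + e * (real n * h)))\<bar> < r powr p" using w e by auto
      ultimately have "0 < e * (b - t) \<and> e * (b - t) < q"
        using n1 n2 r16 h16 q unfolding abs_less_iff by linarith
      then show "w \<in> half e 0 x t l"
        using w \<open>r \<le> l\<close> by (simp add: half_def qball_def q_def)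
    qed
    then have 1: "emeasure W (B (x, s + e * (real n * h)) r) \<le> emeasure W (half e 0 x t l)"
      using half_sets[OF e order_refl zero_less_one] by (intro emeasure_mono) auto
    have "C ^ n \<le> C ^ n0" using \<open>n \<le> n0\<close> C by (intro power_increasing) auto
    then have "ennreal (C ^ n) * emeasure W (B (x, s + e * (real n * h)) r)
        \<le> ennreal (C ^ n0) * emeasure W (half e 0 x t l)"
      by (intro mult_mono ennreal_leI 1) auto
    then show "emeasure W (B (y, s) (k * l)) \<le> ennreal (C ^ n0) * emeasure W (half e 0 x t l)"
      using it[of n] Zn by (simp add: r_def)
  qed
qed

theorem reverse_holder:
  obtains \<kappa>0 where "0 < \<kappa>0" "\<And>\<kappa>. \<lbrakk>0 < \<kappa>; \<kappa> \<le> \<kappa>0\<rbrakk> \<Longrightarrow> \<exists>C>0. \<forall>x t l. 0 < l \<longrightarrow>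
      ennreal_powr (average N (half (- e) 0 x t l) (\<lambda>z. v z powr (\<kappa> + 1))) (1 / (\<kappa> + 1))
        \<le> ennreal C * average N (half e 0 x t l) v"
proof -
  let ?K = "2 * K0"
  obtain A L' \<beta> where "weak_A_infinity pd N ?K (C0 * 2 powr p) v W A L' \<beta>"
    using weak_A_infinity_parabolic by blast
  then interpret wa: weak_A_infinity pd N ?K "C0 * 2 powr p" v W A L' \<beta> .
  obtain \<kappa>0 L where k0: "0 < \<kappa>0" and L: "1 \<le> L" and rh: "\<And>\<kappa>. \<lbrakk>0 < \<kappa>; \<kappa> \<le> \<kappa>0\<rbrakk> \<Longrightarrow> \<exists>C>0. \<forall>z R. 0 < R \<longrightarrow>
      (\<integral>\<^sup>+w\<in>B z R. ennreal (v w powr (1 + \<kappa>)) \<partial>N)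
      \<le> ennreal (C * (measure W (B z (L * R)) / measure N (B z (L * R))) powr (1 + \<kappa>))
        * emeasure N (B z (L * R))"
    using wa.local_reverse_holder by blast
  obtain k C1 where k: "0 < k" "k \<le> 1" "1 \<le> C1" and ch: "\<And>x t y s l. \<lbrakk>0 < l; (y, s) \<in> half (- e) 0 x t l\<rbrakk>
      \<Longrightarrow> emeasure W (B (y, s) (k * l)) \<le> ennreal C1 * emeasure W (half e 0 x t l)"
    using chain by blast
  obtain C2 where C2: "1 \<le> C2"
      "\<And>x r. 0 < r \<Longrightarrow> emeasure N (B x ((2 * ?K / k) * r)) \<le> ennreal C2 * emeasure N (B x r)"
    using doubling_factor by blast
  obtain C3 where C3: "1 \<le> C3"
      "\<And>x r. 0 < r \<Longrightarrow> emeasure N (B x ((L * (3 * ?K)) * r)) \<le> ennreal C3 * emeasure N (B x r)"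
    using doubling_factor by blast
  obtain C4 where C4: "1 \<le> C4"
      "\<And>x r. 0 < r \<Longrightarrow> emeasure N (B x ((2 * ?K) * r)) \<le> ennreal C4 * emeasure N (B x r)"
    using doubling_factor by blast
  show thesis
  proof (rule that[OF k0])
    fix \<kappa> assume kap: "0 < \<kappa>" "\<kappa> \<le> \<kappa>0"
    obtain C where C: "0 < C" and rh': "\<And>z R. 0 < R \<Longrightarrow>
      (\<integral>\<^sup>+w\<in>B z R. ennreal (v w powr (1 + \<kappa>)) \<partial>N)
      \<le> ennreal (C * (measure W (B z (L * R)) / measure N (B z (L * R))) powr (1 + \<kappa>))
        * emeasure N (B z (L * R))"
      using rh[OF kap] by blast
    define W2 where "W2 = density N (\<lambda>w. ennreal (v w powr (1 + \<kappa>)))"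
    \<comment> \<open>\<open>C\<close> is the local inequality, \<open>C1 * C2\<close> compares the
      average over a small ball with that over the target half, \<open>C3\<close> passes from radius
      \<open>k * l\<close> to \<open>r\<close>, and \<open>2 * C4\<close> accounts for the Vitali
      balls reaching outside the source half.\<close>
    define E where "E = 2 * C4 * (C * (C1 * C2) powr (1 + \<kappa>) * C3)"
    have E: "0 < E" using C C2 C3 C4 k by (simp add: E_def)
    show "\<exists>C>0. \<forall>x t l. 0 < l \<longrightarrow>
      ennreal_powr (average N (half (- e) 0 x t l) (\<lambda>z. v z powr (\<kappa> + 1))) (1 / (\<kappa> + 1))
        \<le> ennreal C * average N (half e 0 x t l) v"
    proof (intro exI[of _ "E powr (1 / (\<kappa> + 1))"] conjI allI impI)
      show "0 < E powr (1 / (\<kappa> + 1))" using E by simp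
      fix x t and l :: real assume l: "0 < l"
      let ?U = "half e 0 x t l" and ?V = "half (- e) 0 x t l"
      have Us: "?U \<in> sets N" and Vs: "?V \<in> sets N"
        using half_sets[OF e order_refl zero_less_one] half_sets[OF minus_e order_refl zero_less_one] by auto
      have Vb: "?V \<subseteq> B (x, t) l" and Ub: "?U \<subseteq> B (x, t) l"
        using half_subset_ball[OF e order_refl zero_less_one l]
          half_subset_ball[OF minus_e order_refl zero_less_one l] by auto
      have NU: "emeasure N ?U = emeasure N ?V"
        using emeasure_half[OF e order_refl zero_less_one] emeasure_half[OF minus_e order_refl zero_less_one]
        by simp
      define n where "n = measure N ?U"
      define w where "w = measure W ?U"
      have n: "emeasure N ?U = ennreal n" "0 < n"
        using half_pos[OF e order_refl zero_less_one l, of x t] half_fin[OF e order_refl zero_less_one l, of x t]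
        by (auto simp: n_def measure_def enn2real_positive_iff)
      have "emeasure W ?U \<le> emeasure W (B (x, t) l)" using Ub by (intro emeasure_mono) auto
      then have Wfin: "emeasure W ?U < \<infinity>" using W_fin[OF l, of "(x, t)"] by (rule le_less_trans)
      then have w: "emeasure W ?U = ennreal w" "0 \<le> w"
        by (auto simp: w_def measure_def)
      define a where "a = w / n"
      have a: "0 \<le> a" using w n by (simp add: a_def)
      \<comment> \<open>Dilating by \<open>3 * ?K\<close> for the covering and by \<open>L\<close>
        for the local inequality leads from \<open>r\<close> exactly to \<open>k * l\<close>, the
        radius that the chain can transport.\<close>
      define r where "r = k * l / L / (3 * ?K)"
      have r: "0 < r" using k l L K0 by (simp add: r_def)
      have r3: "L * (3 * ?K * r) = k * l" using L K0 by (simp add: r_def)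
      have kl: "0 < k * l" using k l by simp
      have rl: "r \<le> l"
      proof -
        have "1 \<le> 3 * ?K" using K0 by simp
        then have "1 * 1 \<le> L * (3 * ?K)" using L by (intro mult_mono) auto
        then have "1 * r \<le> L * (3 * ?K) * r" using r by (intro mult_right_mono) auto
        also have "\<dots> = k * l" using r3 by (simp add: mult.assoc)
        also have "\<dots> \<le> l" using k l by simp
        finally show ?thesis by simp
      qed
      define q where "q = C * (C1 * C2) powr (1 + \<kappa>) * C3 * a powr (1 + \<kappa>)"
      have q: "0 \<le> q" using C C3 by (simp add: q_def)
      have local: "emeasure W2 (B z (3 * ?K * r)) \<le> ennreal q * emeasure N (B z r)"
        if z: "z \<in> ?V" for z
      proof -
        obtain y s where ys: "z = (y, s)" by (cases z)
        have NB: "emeasure N ?U \<le> ennreal C2 * emeasure N (B z (k * l))"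
        proof -
          have "pd z (x, t) < l" using z Vb d_sym[of z "(x, t)"] by (auto simp: qball_def)
          then have "?K * (pd z (x, t) + l) \<le> ?K * (l + l)" using K0 by (intro mult_left_mono) auto
          also have "\<dots> = (2 * ?K / k) * (k * l)" using k by simp
          finally have "B (x, t) l \<subseteq> B z ((2 * ?K / k) * (k * l))" by (rule B_subset)
          then have "emeasure N ?U \<le> emeasure N (B z ((2 * ?K / k) * (k * l)))"
            using Ub by (intro emeasure_mono) auto
          also have "\<dots> \<le> ennreal C2 * emeasure N (B z (k * l))" by (rule C2(2)[OF kl])
          finally show ?thesis .
        qed
        have WB: "emeasure W (B z (k * l)) \<le> ennreal C1 * emeasure W ?U"
          using ch[OF l] z by (simp add: ys)
        define n' where "n' = measure N (B z (k * l))"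
        define w' where "w' = measure W (B z (k * l))"
        have n': "emeasure N (B z (k * l)) = ennreal n'" "0 < n'"
          using B_pos[OF kl, of z] B_fin[OF kl, of z]
          by (auto simp: n'_def measure_def enn2real_positive_iff)
        have w': "emeasure W (B z (k * l)) = ennreal w'" "0 \<le> w'"
          using W_fin[OF kl, of z] by (auto simp: w'_def measure_def)
        have 1: "n \<le> C2 * n'" using NB n n' C2 by (simp add: ennreal_mult[symmetric])
        have 2: "w' \<le> C1 * w" using WB w w' k by (simp add: ennreal_mult[symmetric])
        have "w' / n' \<le> (C1 * w) / (n / C2)"
          using 1 2 n C2 w k by (intro frac_le) (auto simp: field_simps)
        also have "\<dots> = C1 * C2 * a" using C2 by (simp add: a_def)
        finally have "(w' / n') powr (1 + \<kappa>) \<le> (C1 * C2 * a) powr (1 + \<kappa>)"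
          using kap n' w' by (intro powr_mono2) auto
        also have "\<dots> = (C1 * C2) powr (1 + \<kappa>) * a powr (1 + \<kappa>)"
          using a k C2 by (simp add: powr_mult)
        finally have 3: "C * (w' / n') powr (1 + \<kappa>) \<le> C * ((C1 * C2) powr (1 + \<kappa>) * a powr (1 + \<kappa>))"
          using C by (intro mult_left_mono) auto
        have "emeasure W2 (B z (3 * ?K * r)) = (\<integral>\<^sup>+w\<in>B z (3 * ?K * r). ennreal (v w powr (1 + \<kappa>)) \<partial>N)"
          by (simp add: W2_def emeasure_density)
        also have "\<dots> \<le> ennreal (C * (w' / n') powr (1 + \<kappa>)) * emeasure N (B z (k * l))"
          using rh'[of "3 * ?K * r" z, unfolded r3] r K0 by (simp add: w'_def n'_def)
        also have "\<dots> \<le> ennreal (C * ((C1 * C2) powr (1 + \<kappa>) * a powr (1 + \<kappa>))) * (ennreal C3 * emeasure N (B z r))"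
          using C3(2)[OF r, of z] r3 by (intro mult_mono ennreal_leI 3) (auto simp: mult.assoc)
        also have "\<dots> = ennreal q * emeasure N (B z r)"
          using C C3 by (simp add: q_def mult.assoc[symmetric] ennreal_mult[symmetric]) (simp add: mult_ac)
        finally show ?thesis .
      qed
      have rb: "B z r \<subseteq> B (x, t) (2 * ?K * l)" if z: "z \<in> ?V" for z
      proof (rule B_subset)
        have "pd (x, t) z < l" using z Vb by (auto simp: qball_def)
        then have "?K * (pd (x, t) z + r) \<le> ?K * (2 * l)" using K0 rl by (intro mult_left_mono) auto
        then show "?K * (pd (x, t) z + r) \<le> 2 * ?K * l" by simp
      qed
      obtain G where G: "G \<subseteq> ?V" "countable G" "disjoint_family_on (\<lambda>g. B g r) G"
          "?V \<subseteq> (\<Union>g\<in>G. B g (3 * ?K * r))"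
        using vitali[of ?V "\<lambda>_. r" r "(x, t)" "2 * ?K * l"] r rb by auto
      have "emeasure W2 ?V \<le> emeasure W2 (\<Union>g\<in>G. B g (3 * ?K * r))"
        using sets.countable_UN''[OF G(2), of "\<lambda>g. B g (3 * ?K * r)" N]
        by (intro emeasure_mono G) (auto simp: W2_def)
      also have "\<dots> \<le> ennreal q * emeasure N (\<Union>g\<in>G. B g r)"
        using G local by (intro emeasure_countable_cover_le) (auto simp: W2_def)
      also have "\<dots> \<le> ennreal q * emeasure N (B (x, t) (2 * ?K * l))"
        using G(1) rb by (intro mult_left_mono emeasure_mono) auto
      also have "\<dots> \<le> ennreal q * (ennreal C4 * emeasure N (B (x, t) l))"
        by (intro mult_left_mono C4 l) auto
      also have "emeasure N (B (x, t) l) = ennreal 2 * emeasure N ?V"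
        using l by (simp add: pball_eq emeasure_rect emeasure_half[OF minus_e order_refl zero_less_one] ennreal_mult mult_ac)
      also have "ennreal q * (ennreal C4 * (ennreal 2 * emeasure N ?V)) = ennreal (E * a powr (1 + \<kappa>) * n)"
        using q C4 n C C3
        by (simp add: NU[symmetric] ennreal_mult[symmetric] E_def del: ennreal_numeral) (simp add: q_def mult_ac)
      finally have W2V: "emeasure W2 ?V \<le> ennreal (E * a powr (1 + \<kappa>) * n)" .
      have "average N ?V (\<lambda>z. v z powr (\<kappa> + 1)) = emeasure W2 ?V / ennreal n"
        using Vs n by (simp add: average_def W2_def emeasure_density add.commute NU[symmetric])
      also have "\<dots> \<le> ennreal (E * a powr (1 + \<kappa>) * n) / ennreal n"
        by (rule divide_right_mono_ennreal[OF W2V])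
      also have "\<dots> = ennreal (E * a powr (1 + \<kappa>))"
        using n E by (simp add: divide_ennreal)
      finally have av: "average N ?V (\<lambda>z. v z powr (\<kappa> + 1)) \<le> ennreal (E * a powr (1 + \<kappa>))" .
      have avU: "average N ?U v = ennreal a"
        using Us n w by (simp add: average_def W_def emeasure_density a_def divide_ennreal)
      obtain b where b: "average N ?V (\<lambda>z. v z powr (\<kappa> + 1)) = ennreal b" "0 \<le> b"
        using av by (cases "average N ?V (\<lambda>z. v z powr (\<kappa> + 1))") (auto simp: top_unique)
      have "b \<le> E * a powr (1 + \<kappa>)" using av b E by (simp add: ennreal_le_iff)
      then have "b powr (1 / (\<kappa> + 1)) \<le> (E * a powr (1 + \<kappa>)) powr (1 / (\<kappa> + 1))"
        using b kap by (intro powr_mono2) auto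
      also have "\<dots> = E powr (1 / (\<kappa> + 1)) * a"
        using E a kap by (simp add: powr_mult powr_powr add.commute)
      finally have "ennreal (b powr (1 / (\<kappa> + 1))) \<le> ennreal (E powr (1 / (\<kappa> + 1)) * a)"
        by (rule ennreal_leI)
      then show "ennreal_powr (average N ?V (\<lambda>z. v z powr (\<kappa> + 1))) (1 / (\<kappa> + 1))
          \<le> ennreal (E powr (1 / (\<kappa> + 1))) * average N ?U v"
        using b a by (simp add: avU ennreal_powr_def ennreal_mult)
    qed
  qed
qed

end

section \<open>The one-sided Muckenhoupt condition\<close>

lemma average_eq_imp:
  assumes "average N U u = ennreal S" "0 \<le> S" "emeasure N U = ennreal n" "0 < n"
  shows "(\<integral>\<^sup>+z\<in>U. ennreal (u z) \<partial>N) = ennreal (S * n)"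
proof (cases "\<integral>\<^sup>+z\<in>U. ennreal (u z) \<partial>N")
  case (real i)
  then have "i / n = S" using assms by (simp add: average_def divide_ennreal)
  then show ?thesis using real assms by (simp add: field_simps)
next
  case top
  then show ?thesis using assms by (simp add: average_def ennreal_top_divide)
qed

lemma average_pos:
  assumes "U \<in> sets N" "0 < emeasure N U" "emeasure N U < \<infinity>"
    and [measurable]: "u \<in> borel_measurable N" and pos: "AE z in N. 0 < u z"
  shows "0 < average N U u"
proof -
  have "(\<integral>\<^sup>+z\<in>U. ennreal (u z) \<partial>N) \<noteq> 0"
  proof
    assume "(\<integral>\<^sup>+z\<in>U. ennreal (u z) \<partial>N) = 0"
    then have "AE z in N. ennreal (u z) * indicator U z = 0"
      using assms(1) by (subst (asm) nn_integral_0_iff_AE) auto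
    then have "AE z in N. z \<notin> U"
      using pos by eventually_elim (auto simp: indicator_def)
    then have "emeasure N U = 0"
      using assms(1) sets.sets_into_space[OF assms(1)]
      by (subst (asm) AE_iff_measurable[of U]) auto
    then show False using assms(2) by simp
  qed
  then show ?thesis using assms(3)
    by (auto simp: average_def zero_less_iff_neq_zero ennreal_divide_eq_0_iff)
qed

text \<open>Chebyshev's inequality for \<open>u\<close>: where \<open>v \<le> c\<close>,
  \<open>u\<close> is at least \<open>c powr (- a)\<close>, so this set has at most the fraction
  \<open>c powr a * S\<close> of \<open>U\<close>. The threshold \<open>c\<close> is chosen to make
  this at most \<eta>, using \<open>l * S powr (1 / a) \<le> C\<close>.\<close>

lemma sublevel_le:
  assumes U: "U \<in> sets N" "0 < emeasure N U" "emeasure N U < \<infinity>"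
    and [measurable]: "v \<in> borel_measurable N" and vu: "AE z in N. 0 < v z \<and> u z = v z powr (- a)"
    and a: "0 < a" and av: "average N U u = ennreal S" "0 < S"
    and l: "0 < l" "l \<le> X" and C: "X * S powr (1 / a) \<le> C" and h: "0 < \<eta>"
  shows "emeasure N (U \<inter> {z. v z \<le> \<eta> powr (1 / a) / C * l}) \<le> ennreal \<eta> * emeasure N U"
proof -
  have "0 < X * S powr (1 / a)" using l av by simp
  then have C0: "0 < C" using C by simp
  define c where "c = \<eta> powr (1 / a) / C * l"
  have c: "0 < c" using h C0 l by (simp add: c_def)
  define E where "E = U \<inter> {z. v z \<le> c}"
  have "{z \<in> space N. v z \<le> c} \<inter> U \<in> sets N" using U by measurable
  moreover have "{z \<in> space N. v z \<le> c} \<inter> U = E"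
    using sets.sets_into_space[OF U(1)] by (auto simp: E_def)
  ultimately have Es: "E \<in> sets N" by simp
  obtain n where n: "emeasure N U = ennreal n" "0 < n"
    using U(2,3) by (cases "emeasure N U") auto
  have "emeasure N E \<le> ennreal n" unfolding n(1)[symmetric] using U by (intro emeasure_mono) (auto simp: E_def)
  then obtain m where m: "emeasure N E = ennreal m" "0 \<le> m"
    by (cases "emeasure N E") (auto simp: top_unique)
  have "ennreal (c powr (- a)) * emeasure N E = (\<integral>\<^sup>+z. ennreal (c powr (- a)) * indicator E z \<partial>N)"
    using Es by (simp add: nn_integral_cmult_indicator)
  also have "\<dots> \<le> (\<integral>\<^sup>+z. ennreal (u z) * indicator U z \<partial>N)"
  proof (rule nn_integral_mono_AE)
    show "AE z in N. ennreal (c powr (- a)) * indicator E z \<le> ennreal (u z) * indicator U z"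
      using vu
    proof eventually_elim
      case (elim z)
      show ?case
      proof (cases "z \<in> E")
        case True
        then have "c powr (- a) \<le> v z powr (- a)"
          using elim a by (intro powr_mono2') (auto simp: E_def)
        then show ?thesis using True elim by (auto simp: E_def intro!: ennreal_leI)
      qed simp
    qed
  qed
  also have "\<dots> = ennreal (S * n)" using average_eq_imp[OF av(1) _ n] av(2) by simp
  finally have "c powr (- a) * m \<le> S * n" using m n av by (simp add: ennreal_mult[symmetric])
  then have "m \<le> c powr a * S * n" using c by (simp add: powr_minus field_simps)
  also have "c powr a * S \<le> \<eta>"
  proof -
    have "c powr a * S = (c * S powr (1 / a)) powr a"
      using c a av by (simp add: powr_mult powr_powr)
    also have "\<dots> \<le> (\<eta> powr (1 / a)) powr a"
    proof (rule powr_mono2)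
      have "c * S powr (1 / a) = \<eta> powr (1 / a) / C * (l * S powr (1 / a))" by (simp add: c_def)
      also have "\<dots> \<le> \<eta> powr (1 / a) / C * C"
        using C0 l order_trans[OF mult_right_mono[OF l(2)] C] by (intro mult_left_mono) auto
      also have "\<dots> = \<eta> powr (1 / a)" using C0 by simp
      finally show "c * S powr (1 / a) \<le> \<eta> powr (1 / a)" .
    qed (use a c in auto)
    also have "\<dots> = \<eta>" using a h by (simp add: powr_powr)
    finally show ?thesis .
  qed
  finally have "m \<le> \<eta> * n" using n by simp
  then have "ennreal m \<le> ennreal (\<eta> * n)" by (rule ennreal_leI)
  then show ?thesis using m n h by (simp add: E_def c_def ennreal_mult)
qed

context parabolic_space
begin

text \<open>Stated for a pair \<open>v\<close>, \<open>u = v powr (- a)\<close> and a time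
  direction, so that it applies to the weight with \<open>a = 1 / (q - 1)\<close> and to the dual
  weight with \<open>a = q - 1\<close>, in opposite directions.\<close>

lemma reverse_holder_of_A_plus:
  assumes e: "e = 1 \<or> e = - 1" and g0: "0 \<le> \<gamma>" and g1: "\<gamma> < 1" and geo: "monotone_geodesic \<rho>"
    and vm [measurable]: "v \<in> borel_measurable N" and vu: "AE z in N. 0 < v z \<and> u z = v z powr (- a)"
    and a: "0 < a" and C: "0 < C"
    and prod: "\<And>x t l. 0 < l \<Longrightarrow> \<exists>X S. 0 < X \<and> 0 < S \<and> X * S powr (1 / a) \<le> C \<and>
      average N (half (- e) \<gamma> x t l) v = ennreal X \<and> average N (half e \<gamma> x t l) u = ennreal S"
  obtains \<kappa>0 where "0 < \<kappa>0" "\<And>\<kappa>. \<lbrakk>0 < \<kappa>; \<kappa> \<le> \<kappa>0\<rbrakk> \<Longrightarrow> \<exists>C>0. \<forall>x t l. 0 < l \<longrightarrow>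
      ennreal_powr (average N (half (- e) 0 x t l) (\<lambda>z. v z powr (\<kappa> + 1))) (1 / (\<kappa> + 1))
        \<le> ennreal C * average N (half e 0 x t l) v"
proof -
  have minus_e: "- e = 1 \<or> - e = - 1" using e by auto
  define W where "W = density N (\<lambda>z. ennreal (v z))"
  have W_half: "\<exists>X n. 0 < X \<and> 0 < n \<and> average N (half (- e) \<gamma> x t l) v = ennreal X \<and>
      emeasure N (half (- e) \<gamma> x t l) = ennreal n \<and> emeasure W (half (- e) \<gamma> x t l) = ennreal (X * n)"
    if l: "0 < l" for x t l
  proof -
    obtain X where X: "0 < X" "average N (half (- e) \<gamma> x t l) v = ennreal X"
      using prod[OF l] by blast
    obtain n where n: "emeasure N (half (- e) \<gamma> x t l) = ennreal n" "0 < n"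
      using half_pos[OF minus_e g0 g1 l, of x t] half_fin[OF minus_e g0 g1 l, of x t]
      by (cases "emeasure N (half (- e) \<gamma> x t l)") auto
    have "emeasure W (half (- e) \<gamma> x t l) = ennreal (X * n)"
      unfolding W_def using average_eq_imp[OF X(2) _ n] X(1) half_sets[OF minus_e g0 g1]
      by (subst emeasure_density) simp_all
    then show ?thesis using X n by blast
  qed
  obtain Kg where Kg: "0 < Kg \<and> (\<forall>s>0. \<forall>x y. s \<le> \<rho> x y \<longrightarrow> (\<exists>(m::nat) z. z 0 = x \<and> z m = y \<and>
      (\<forall>i<m. \<rho> (z i) (z (Suc i)) \<le> Kg * s \<and> \<rho> (z (Suc i)) (z m) \<le> \<rho> (z i) (z m) - s)))"
    using geo unfolding monotone_geodesic_def by (rule exE)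
  interpret pw: parabolic_weight \<rho> M p K0 C0 v W e \<gamma> Kg
  proof (unfold_locales)
    show "v \<in> borel_measurable N" by (rule vm)
    show "W = density N (\<lambda>z. ennreal (v z))" by (rule W_def)
    show "AE z in N. 0 < v z" using vu by eventually_elim simp
    show "emeasure W (B z r) < \<infinity>" if r: "0 < r" for z r
    proof -
      obtain y T l where l: "0 < l" "B z r \<subseteq> half (- e) \<gamma> y T l"
        using ball_in_half[OF minus_e g0 g1 r] .
      then have "emeasure W (B z r) \<le> emeasure W (half (- e) \<gamma> y T l)"
        using half_sets[OF minus_e g0 g1] by (intro emeasure_mono) (auto simp: W_def)
      also have "\<dots> < \<infinity>" using W_half[OF l(1), of y T] by auto
      finally show ?thesis .
    qed
    show "\<exists>\<beta>>0. \<forall>x t l \<mu>. 0 < l \<longrightarrow> 0 < \<mu> \<longrightarrow>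
      ennreal \<mu> * emeasure N (half (- e) \<gamma> x t l) \<le> emeasure W (half (- e) \<gamma> x t l) \<longrightarrow>
      emeasure N (half e \<gamma> x t l \<inter> {z. v z \<le> \<beta> * \<mu>}) \<le> ennreal \<eta> * emeasure N (half e \<gamma> x t l)"
      if h: "0 < \<eta>" for \<eta>
    proof (intro exI[of _ "\<eta> powr (1 / a) / C"] conjI allI impI)
      show "0 < \<eta> powr (1 / a) / C" using h C by simp
      fix x t and l \<mu> :: real
      assume l: "0 < l" and m: "0 < \<mu>"
        and le: "ennreal \<mu> * emeasure N (half (- e) \<gamma> x t l) \<le> emeasure W (half (- e) \<gamma> x t l)"
      obtain X S where XS: "0 < X" "0 < S" "X * S powr (1 / a) \<le> C"
          "average N (half (- e) \<gamma> x t l) v = ennreal X" "average N (half e \<gamma> x t l) u = ennreal S"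
        using prod[OF l] by blast
      obtain n where n: "0 < n" "emeasure N (half (- e) \<gamma> x t l) = ennreal n"
          "emeasure W (half (- e) \<gamma> x t l) = ennreal (X * n)"
        using W_half[OF l, of x t] XS(1,4) by auto
      have "\<mu> \<le> X" using le n m XS by (simp add: ennreal_mult[symmetric])
      then show "emeasure N (half e \<gamma> x t l \<inter> {z. v z \<le> \<eta> powr (1 / a) / C * \<mu>})
          \<le> ennreal \<eta> * emeasure N (half e \<gamma> x t l)"
        using half_sets[OF e g0 g1] half_pos[OF e g0 g1 l] half_fin[OF e g0 g1 l] XS
        by (intro sublevel_le[OF _ _ _ vm vu a XS(5,2) m _ XS(3) h]) auto
    qed
    show "\<exists>(m::nat) z. z 0 = x \<and> z m = y \<and>
        (\<forall>i<m. \<rho> (z i) (z (Suc i)) \<le> Kg * s \<and> \<rho> (z (Suc i)) (z m) \<le> \<rho> (z i) (z m) - s)"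
      if "0 < s" "s \<le> \<rho> x y" for s x y
      using Kg[THEN conjunct2, rule_format, OF that] .
  qed (use e g0 g1 in auto)
  show thesis by (rule pw.reverse_holder) (rule that)
qed

end

text \<open>A finite product of extended numbers bounds its factors only if neither is 0. Both
  averages are positive because the weight is positive almost everywhere, so both are
  finite.\<close>

lemma A_plus_averages:
  assumes "parabolic_space \<rho> M p K0 C0" and q: "1 < q" and g: "0 \<le> \<gamma>" "\<gamma> < 1"
    and w: "w \<in> A_plus \<rho> M p q \<gamma>"
  obtains C where "0 < C" "\<And>x t l. 0 < l \<Longrightarrow> \<exists>X S. 0 < X \<and> 0 < S \<and> X * S powr (q - 1) \<le> C \<and>
      average (parabolic_measure M) (cyl_lower \<rho> p \<gamma> x t l) w = ennreal X \<and>
      average (parabolic_measure M) (cyl_upper \<rho> p \<gamma> x t l) (\<lambda>z. w z powr (1 - conj_exp q)) = ennreal S"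
proof -
  interpret parabolic_space \<rho> M p K0 C0 by fact
  let ?u = "\<lambda>z. w z powr (1 - conj_exp q)"
  have wm [measurable]: "w \<in> borel_measurable N" and wp: "AE z in N. 0 < w z"
    using w by (auto simp: A_plus_def weight_def)
  have up: "AE z in N. 0 < ?u z" using wp by eventually_elim simp
  define Q where "Q = (SUP x. SUP t. SUP l\<in>{0<..}.
        average N (cyl_lower \<rho> p \<gamma> x t l) w * ennreal_powr (average N (cyl_upper \<rho> p \<gamma> x t l) ?u) (q - 1))"
  have "Q < \<infinity>" using w by (simp add: A_plus_def Q_def)
  then obtain c where c: "Q = ennreal c" "0 \<le> c" by (cases Q) auto
  show thesis
  proof (rule that[of "max 1 c"])
    fix x t and l :: real assume l: "0 < l"
    let ?a = "average N (cyl_lower \<rho> p \<gamma> x t l) w" and ?b = "average N (cyl_upper \<rho> p \<gamma> x t l) ?u"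
    have m1: "(- 1::real) = 1 \<or> (- 1::real) = - 1" and p1: "(1::real) = 1 \<or> (1::real) = - 1" by auto
    have a: "0 < ?a" unfolding half_lower[symmetric]
      using half_sets[OF m1 g] half_pos[OF m1 g l] half_fin[OF m1 g l] wp by (intro average_pos) auto
    have b: "0 < ?b" unfolding half_upper[symmetric]
      using half_sets[OF p1 g] half_pos[OF p1 g l] half_fin[OF p1 g l] up by (intro average_pos) auto
    have "?a * ennreal_powr ?b (q - 1) \<le> Q"
      unfolding Q_def using l by (intro SUP_upper2[OF UNIV_I] SUP_upper2[of l]) auto
    then have le: "?a * ennreal_powr ?b (q - 1) \<le> ennreal c" by (simp add: c)
    have bt: "?b \<noteq> top"
    proof
      assume "?b = top"
      then have "?a * ennreal_powr ?b (q - 1) = top" using a by (simp add: ennreal_powr_def ennreal_mult_top)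
      then show False using le by (simp add: top_unique)
    qed
    then obtain S where S: "?b = ennreal S" "0 < S" using b by (cases ?b) auto
    have pb: "ennreal_powr ?b (q - 1) = ennreal (S powr (q - 1))" using S by (simp add: ennreal_powr_def)
    have "?a \<noteq> top"
    proof
      assume "?a = top"
      then have "?a * ennreal_powr ?b (q - 1) = top" using S(2) by (simp add: pb ennreal_top_mult)
      then show False using le by (simp add: top_unique)
    qed
    then obtain X where X: "?a = ennreal X" "0 < X" using a by (cases ?a) auto
    have "X * S powr (q - 1) \<le> c" using le[unfolded pb X(1)] X(2) c(2) by (simp add: ennreal_mult[symmetric])
    then show "\<exists>X S. 0 < X \<and> 0 < S \<and> X * S powr (q - 1) \<le> max 1 c \<and> ?a = ennreal X \<and> ?b = ennreal S"
      using X S by (intro exI[of _ X] exI[of _ S]) auto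
  qed simp
qed

theorem theorem6p5:
  fixes \<rho> :: "'a \<Rightarrow> 'a \<Rightarrow> real" and M :: "'a measure"
    and p q \<gamma> :: real and \<omega> :: "'a \<times> real \<Rightarrow> real"
  assumes "homogeneous_type \<rho> M"
    and "basic_assumptions \<rho> M"
    and "monotone_geodesic \<rho>"
    and "1 < p"
    and "basic_assumptions (parabolic_dist \<rho> p) (parabolic_measure M)"
    and "1 < q"
    and "0 \<le> \<gamma>" and "\<gamma> < 1"
    and "\<omega> \<in> A_plus \<rho> M p q \<gamma>"
  shows "\<exists>\<kappa>>0. \<exists>C>0. \<forall>x t l. l > 0 \<longrightarrow>
      ennreal_powr (average (parabolic_measure M) (cyl_lower \<rho> p 0 x t l)
          (\<lambda>z. \<omega> z powr (\<kappa> + 1))) (1 / (\<kappa> + 1))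
        \<le> ennreal C * average (parabolic_measure M) (cyl_upper \<rho> p 0 x t l) \<omega> \<and>
      ennreal_powr (average (parabolic_measure M) (cyl_upper \<rho> p 0 x t l)
          (\<lambda>z. \<omega> z powr ((1 - conj_exp q) * (\<kappa> + 1)))) (1 / (\<kappa> + 1))
        \<le> ennreal C * average (parabolic_measure M) (cyl_lower \<rho> p 0 x t l)
            (\<lambda>z. \<omega> z powr (1 - conj_exp q))"
proof -
  interpret X: homogeneous_type \<rho> M by fact
  obtain K0 where K0: "1 \<le> K0" "\<And>x y z. \<rho> x y \<le> K0 * (\<rho> x z + \<rho> z y)"
    using X.quasi_triangle by blast
  obtain c where c: "\<And>x r. 0 < r \<Longrightarrow> emeasure M (qball \<rho> x (2 * r)) \<le> ennreal c * emeasure M (qball \<rho> x r)"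
    using X.doubling by blast
  have ps: "parabolic_space \<rho> M p K0 (max 1 c)"
  proof (rule parabolic_space.intro)
    show "\<rho> x x = 0" for x using X.zero_iff by blast
    show "emeasure M (qball \<rho> x (2 * r)) \<le> ennreal (max 1 c) * emeasure M (qball \<rho> x r)"
      if "0 < r" for x r
      by (rule order_trans[OF c[OF that]]) (intro mult_right_mono ennreal_leI, auto)
  qed (use assms X.nonneg X.symmetric X.qball_sets K0 in auto)
  interpret parabolic_space \<rho> M p K0 "max 1 c" by (rule ps)
  let ?u = "\<lambda>z. \<omega> z powr (1 - conj_exp q)"
  have wm [measurable]: "\<omega> \<in> borel_measurable N" and wp: "AE z in N. 0 < \<omega> z"
    using assms(9) by (auto simp: A_plus_def weight_def)
  have q: "0 < q - 1" "0 < 1 / (q - 1)" "1 - conj_exp q = - (1 / (q - 1))"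
    using \<open>1 < q\<close> by (auto simp: conj_exp_def field_simps)
  \<comment> \<open>Duality of exponents: the weight is recovered as the power
    \<open>- (q - 1)\<close> of its dual \<open>?u\<close>.\<close>
  have one: "(1 - conj_exp q) * - (q - 1) = 1" unfolding q(3) using q(1) by (simp add: field_simps)
  obtain C where C: "0 < C" and av: "\<And>x t l. 0 < l \<Longrightarrow> \<exists>X S. 0 < X \<and> 0 < S \<and> X * S powr (q - 1) \<le> C \<and>
      average N (cyl_lower \<rho> p \<gamma> x t l) \<omega> = ennreal X \<and> average N (cyl_upper \<rho> p \<gamma> x t l) ?u = ennreal S"
    using A_plus_averages[OF ps \<open>1 < q\<close> \<open>0 \<le> \<gamma>\<close> \<open>\<gamma> < 1\<close> assms(9)] by blast
  obtain \<kappa>1 where k1: "0 < \<kappa>1" and r1: "\<And>\<kappa>. \<lbrakk>0 < \<kappa>; \<kappa> \<le> \<kappa>1\<rbrakk> \<Longrightarrow> \<exists>C>0. \<forall>x t l. 0 < l \<longrightarrow>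
      ennreal_powr (average N (half (- 1) 0 x t l) (\<lambda>z. \<omega> z powr (\<kappa> + 1))) (1 / (\<kappa> + 1))
        \<le> ennreal C * average N (half 1 0 x t l) \<omega>"
  proof (rule reverse_holder_of_A_plus[of 1 \<gamma> \<omega> ?u "1 / (q - 1)" C])
    show "AE z in N. 0 < \<omega> z \<and> ?u z = \<omega> z powr - (1 / (q - 1))"
      using wp by eventually_elim (simp add: q(3))
    show "\<exists>X S. 0 < X \<and> 0 < S \<and> X * S powr (1 / (1 / (q - 1))) \<le> C \<and>
      average N (half (- 1) \<gamma> x t l) \<omega> = ennreal X \<and> average N (half 1 \<gamma> x t l) ?u = ennreal S"
      if "0 < l" for x t l
      using av[OF that, of x t] by (simp add: half_lower half_upper)
  qed (use assms q C in auto)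
  obtain \<kappa>2 where k2: "0 < \<kappa>2" and r2: "\<And>\<kappa>. \<lbrakk>0 < \<kappa>; \<kappa> \<le> \<kappa>2\<rbrakk> \<Longrightarrow> \<exists>C>0. \<forall>x t l. 0 < l \<longrightarrow>
      ennreal_powr (average N (half (- (- 1)) 0 x t l) (\<lambda>z. ?u z powr (\<kappa> + 1))) (1 / (\<kappa> + 1))
        \<le> ennreal C * average N (half (- 1) 0 x t l) ?u"
  proof (rule reverse_holder_of_A_plus[of "- 1" \<gamma> ?u \<omega> "q - 1" "C powr (1 / (q - 1))"])
    show "AE z in N. 0 < ?u z \<and> \<omega> z = ?u z powr - (q - 1)"
      using wp
    proof eventually_elim
      case (elim z)
      then show ?case by (simp only: powr_powr one) simp
    qed
    show "\<exists>X S. 0 < X \<and> 0 < S \<and> X * S powr (1 / (q - 1)) \<le> C powr (1 / (q - 1)) \<and>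
      average N (half (- (- 1)) \<gamma> x t l) ?u = ennreal X \<and> average N (half (- 1) \<gamma> x t l) \<omega> = ennreal S"
      if l: "0 < l" for x t l
    proof -
      obtain X S where XS: "0 < X" "0 < S" "X * S powr (q - 1) \<le> C"
          "average N (cyl_lower \<rho> p \<gamma> x t l) \<omega> = ennreal X"
          "average N (cyl_upper \<rho> p \<gamma> x t l) ?u = ennreal S"
        using av[OF l, of x t] by blast
      \<comment> \<open>Raising the product bound to the power \<open>1 / (q - 1)\<close> exchanges
        the roles of the two averages.\<close>
      have "(X * S powr (q - 1)) powr (1 / (q - 1)) \<le> C powr (1 / (q - 1))"
        using XS q by (intro powr_mono2) auto
      also have "(X * S powr (q - 1)) powr (1 / (q - 1)) = S * X powr (1 / (q - 1))"
        using XS q by (simp add: powr_mult powr_powr)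
      finally show ?thesis using XS
        by (intro exI[of _ S] exI[of _ X]) (simp add: half_lower half_upper)
    qed
  qed (use assms q C in auto)
  define \<kappa> where "\<kappa> = min \<kappa>1 \<kappa>2"
  have k: "0 < \<kappa>" "\<kappa> \<le> \<kappa>1" "\<kappa> \<le> \<kappa>2" using k1 k2 by (auto simp: \<kappa>_def)
  obtain C1 where C1: "0 < C1" "\<And>x t l. 0 < l \<Longrightarrow>
      ennreal_powr (average N (cyl_lower \<rho> p 0 x t l) (\<lambda>z. \<omega> z powr (\<kappa> + 1))) (1 / (\<kappa> + 1))
        \<le> ennreal C1 * average N (cyl_upper \<rho> p 0 x t l) \<omega>"
    using r1[OF k(1,2)] by (auto simp: half_lower half_upper)
  obtain C2 where C2: "0 < C2" "\<And>x t l. 0 < l \<Longrightarrow>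
      ennreal_powr (average N (cyl_upper \<rho> p 0 x t l) (\<lambda>z. \<omega> z powr ((1 - conj_exp q) * (\<kappa> + 1)))) (1 / (\<kappa> + 1))
        \<le> ennreal C2 * average N (cyl_lower \<rho> p 0 x t l) ?u"
    using r2[OF k(1,3)] by (auto simp: half_lower half_upper powr_powr)
  have up: "ennreal C1 * y \<le> ennreal (max C1 C2) * y" "ennreal C2 * y \<le> ennreal (max C1 C2) * y" for y
    by (auto intro!: mult_right_mono ennreal_leI)
  show ?thesis
  proof (rule exI[of _ \<kappa>], rule conjI[OF k(1)], rule exI[of _ "max C1 C2"], intro conjI allI impI)
    show "0 < max C1 C2" using C1 by simp
  qed (erule order_trans[OF C1(2) up(1)] order_trans[OF C2(2) up(2)])+
qed

end
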